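(* Let $G$ be a finite simple graph with toric ideal $I_G\subseteq\mathbb{K}[E(G)]$. Let $H$ be a graph obtained from $G$ by gluing a cycle of even length to $G$ along a single edge. If $I_G$ is geometrically vertex decomposable in $\mathbb{K}[E(G)]$, then $I_H$ is geometrically vertex decomposable in $\mathbb{K}[E(H)]$.
   Context: $\mathbb{K}$ is an algebraically closed field of characteristic zero. Toric ideal of a graph. For a finite simple graph $G$ with vertices $V(G)=\{x_1,\ldots,x_n\}$ and edges $E(G)=\{e_1,\ldots,e_t\}$, let $\mathbb{K}[E(G)]=\mathbb{K}[e_1,\ldots,e_t]$ and $\mathbb{K}[V(G)]=\mathbb{K}[x_1,\ldots,x_n]$ be polynomial rings. The toric ideal $I_G\subseteq\mathbb{K}[E(G)]$ is the kernel of the $\mathbb{K}$-algebra homomorphism $\varphi_G:\mathbb{K}[E(G)]\to\mathbb{K}[V(G)]$, $\varphi_G(e_i)=x_jx_k$ where $e_i=\{x_j,x_k\}$. Gluing. Let $C$ be a cycle of even length and let $e\in E(G)$, $f\in E(C)$ be edges. Gluing $C$ to $G$ along a single edge means taking the disjoint union $G\sqcup C$ and identifying the edge $f$ (and its two endpoints) with the edge $e$ (and its two endpoints). Geometric vertex decomposability. Let $R=\mathbb{K}[x_1,\ldots,x_n]$ be a polynomial ring and fix a variable $y=x_i$. Write $0\neq f\in R$ as $f=\sum_j\alpha_jy^j$ with $\alpha_j$ not involving $y$; if $d$ is the largest index with $\alpha_d\neq0$, put $\mathrm{in}_y(f)=\alpha_dy^d$. For an ideal $I$, $\mathrm{in}_y(I)=\langle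 \mathrm{in}_y(f)\mid f\in I\rangle$. A monomial order $<$ is $y$-compatible if $\mathrm{in}_<(f)=\mathrm{in}_<(\mathrm{in}_y(f))$ for all $f$. Given a $y$-compatible order $<$ and a Gröbner basis $\{g_1,\ldots,g_m\}$ of $I$ with respect to $<$, write $g_j=y^{d_j}q_j+r_j$ with $\mathrm{in}_y(g_j)=y^{d_j}q_j$ and $y$ dividing no term of $q_j$, and set $C_{y,I}=\langle q_1,\ldots,q_m\rangle$ and $N_{y,I}=\langle q_j\mid d_j=0\rangle$. An ideal $I$ is unmixed if $\dim(R/I)=\dim(R/P)$ for all $P\in\mathrm{Ass}_R(R/I)$. The ideal $I$ is geometrically vertex decomposable if $I$ is unmixed and either (1) $I=\langle1\rangle$ or $I$ is generated by a (possibly empty) subset of the variables of $R$; or (2) there are a variable $y=x_i$ and a $y$-compatible monomial order $<$ such that $\mathrm{in}_y(I)=C_{y,I}\cap(N_{y,I}+\langle y\rangle)$ and the contractions of $C_{y,I}$ and $N_{y,I}$ to $\mathbb{K}[x_1,\ldots,\hat{x}_i,\ldots,x_n]$ are geometrically vertex decomposable. By convention the ideals $\langle0\rangle$ and $\langle1\rangle$ of the ring $\mathbb{K}$ are geometrically vertex decomposable. *)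

theory Defs
  imports
    "HOL-Library.Poly_Mapping"
    "HOL-Library.Extended_Nat"
    "HOL-Computational_Algebra.Polynomial"
    "HOL-Algebra.QuotRing"
begin

section \<open>Polynomial rings\<close>

text \<open>
  A monomial is its finitely supported exponent function; a polynomial is a finitely supported
  family of coefficients indexed by monomials, multiplied by convolution.  The ring
  \<open>K[X]\<close> in a set \<open>X\<close> of variables is carved out of this type as a carrier, since the
  recursion in geometric vertex decomposability removes variables.
\<close>

type_synonym ('v, 'k) mpoly = "('v \<Rightarrow>\<^sub>0 nat) \<Rightarrow>\<^sub>0 'k"

definition monomials :: "'v set \<Rightarrow> ('v \<Rightarrow>\<^sub>0 nat) set" where
  "monomials X = {m. Poly_Mapping.keys m \<subseteq> X}"

definition mpoly_ring :: "'v set \<Rightarrow> ('v, 'k::comm_ring_1) mpoly ring" where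
  "mpoly_ring X =
    \<lparr>carrier = {p. Poly_Mapping.keys p \<subseteq> monomials X}, mult = (*), one = 1, zero = 0, add = (+)\<rparr>"

definition const :: "'k \<Rightarrow> ('v, 'k::comm_ring_1) mpoly" where
  "const c = Poly_Mapping.single 0 c"

definition var :: "'v \<Rightarrow> ('v, 'k::comm_ring_1) mpoly" where
  "var v = Poly_Mapping.single (Poly_Mapping.single v 1) 1"

lemma cring_mpoly_ring: "cring (mpoly_ring X :: ('v, 'k::comm_ring_1) mpoly ring)"
proof (rule cringI)
  let ?R = "mpoly_ring X :: ('v, 'k) mpoly ring"
  show "abelian_group ?R"
  proof (rule abelian_groupI)
    fix p q assume "p \<in> carrier ?R" "q \<in> carrier ?R"
    then show "p \<oplus>\<^bsub>?R\<^esub> q \<in> carrier ?R"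
      using Poly_Mapping.keys_add[of p q] by (auto simp: mpoly_ring_def)
  next
    fix p assume "p \<in> carrier ?R"
    then have "- p \<in> carrier ?R" "- p \<oplus>\<^bsub>?R\<^esub> p = \<zero>\<^bsub>?R\<^esub>"
      by (auto simp: mpoly_ring_def)
    then show "\<exists>q\<in>carrier ?R. q \<oplus>\<^bsub>?R\<^esub> p = \<zero>\<^bsub>?R\<^esub>" by blast
  qed (auto simp: mpoly_ring_def add_ac)
  show "comm_monoid ?R"
  proof (rule comm_monoidI)
    fix p q assume pq: "p \<in> carrier ?R" "q \<in> carrier ?R"
    have "Poly_Mapping.keys (a + b) \<subseteq> X" if "a \<in> Poly_Mapping.keys p" "b \<in> Poly_Mapping.keys q"
      for a b
    proof -
      have "Poly_Mapping.keys a \<subseteq> X" "Poly_Mapping.keys b \<subseteq> X"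
        using that pq unfolding mpoly_ring_def monomials_def by auto
      then show ?thesis using Poly_Mapping.keys_add[of a b] by blast
    qed
    then show "p \<otimes>\<^bsub>?R\<^esub> q \<in> carrier ?R"
      using keys_mult[of p q] unfolding mpoly_ring_def monomials_def by fastforce
  qed (auto simp: mpoly_ring_def monomials_def mult_ac)
qed (auto simp: mpoly_ring_def distrib_right)


section \<open>Unmixed ideals\<close>

text \<open>
  The supremum is taken in \<open>enat\<close>, so the zero ring gets dimension 0.
\<close>

definition krull_dim :: "('r, 'm) ring_scheme \<Rightarrow> enat" where
  "krull_dim R = Sup {enat n | n. \<exists>P. (\<forall>i\<le>n. primeideal (P i) R) \<and> (\<forall>i<n. P i \<subset> P (Suc i))}"

text \<open>
  \<open>Ass\<^sub>R(R/I)\<close>: the prime ideals that are the annihilator \<open>{r. r f \<in> I}\<close> of some class \<open>f + I\<close>.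
\<close>

definition associated_primes :: "('r, 'm) ring_scheme \<Rightarrow> 'r set \<Rightarrow> 'r set set" where
  "associated_primes R I =
    {P. primeideal P R \<and> (\<exists>f\<in>carrier R. P = {r \<in> carrier R. r \<otimes>\<^bsub>R\<^esub> f \<in> I})}"

definition unmixed :: "('r, 'm) ring_scheme \<Rightarrow> 'r set \<Rightarrow> bool" where
  "unmixed R I \<longleftrightarrow> (\<forall>P\<in>associated_primes R I. krull_dim (R Quot I) = krull_dim (R Quot P))"


section \<open>Initial forms and Groebner bases\<close>

text \<open>
  \<open>coeff_in y j f\<close> is the coefficient \<open>\<alpha>\<^sub>j\<close>, not involving \<open>y\<close>, in \<open>f = \<Sum>\<^sub>j \<alpha>\<^sub>j y\<^sup>j\<close>.
\<close>

definition coeff_in :: "'v \<Rightarrow> nat \<Rightarrow> ('v, 'k::comm_ring_1) mpoly \<Rightarrow> ('v, 'k) mpoly" where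
  "coeff_in y j f =
    (\<Sum>m | m \<in> Poly_Mapping.keys f \<and> Poly_Mapping.lookup m y = j.
      Poly_Mapping.single (m - Poly_Mapping.single y j) (Poly_Mapping.lookup f m))"

definition degree_in :: "'v \<Rightarrow> ('v, 'k::comm_ring_1) mpoly \<Rightarrow> nat" where
  "degree_in y f = Max {j. coeff_in y j f \<noteq> 0}"

definition lead_coeff_in :: "'v \<Rightarrow> ('v, 'k::comm_ring_1) mpoly \<Rightarrow> ('v, 'k) mpoly" where
  "lead_coeff_in y f = coeff_in y (degree_in y f) f"

text \<open>\<open>in\<^sub>y(0) = 0\<close>, as every coefficient of the zero polynomial vanishes.\<close>

definition init_in :: "'v \<Rightarrow> ('v, 'k::comm_ring_1) mpoly \<Rightarrow> ('v, 'k) mpoly" where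
  "init_in y f = lead_coeff_in y f * var y ^ degree_in y f"

definition init_in_ideal ::
    "'v set \<Rightarrow> 'v \<Rightarrow> ('v, 'k::comm_ring_1) mpoly set \<Rightarrow> ('v, 'k) mpoly set" where
  "init_in_ideal X y I = Idl\<^bsub>mpoly_ring X\<^esub> (init_in y ` (I - {0}))"

text \<open>A pair \<open>(s, t)\<close> in the order means \<open>s \<le> t\<close>.\<close>

definition monomial_order :: "'v set \<Rightarrow> (('v \<Rightarrow>\<^sub>0 nat) \<times> ('v \<Rightarrow>\<^sub>0 nat)) set \<Rightarrow> bool" where
  "monomial_order X r \<longleftrightarrow>
    well_order_on (monomials X) r \<and>
    (\<forall>s t. \<forall>u\<in>monomials X. (s, t) \<in> r \<longrightarrow> (s + u, t + u) \<in> r)"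

definition lead_monomial ::
    "(('v \<Rightarrow>\<^sub>0 nat) \<times> ('v \<Rightarrow>\<^sub>0 nat)) set \<Rightarrow> ('v, 'k::comm_ring_1) mpoly \<Rightarrow> ('v \<Rightarrow>\<^sub>0 nat)" where
  "lead_monomial r f =
    (THE m. m \<in> Poly_Mapping.keys f \<and> (\<forall>s\<in>Poly_Mapping.keys f. (s, m) \<in> r))"

text \<open>
  The initial term, with its coefficient.  It is 0 for \<open>f = 0\<close>, whatever \<open>THE\<close> returns.
\<close>

definition init_term ::
    "(('v \<Rightarrow>\<^sub>0 nat) \<times> ('v \<Rightarrow>\<^sub>0 nat)) set \<Rightarrow> ('v, 'k::comm_ring_1) mpoly \<Rightarrow> ('v, 'k) mpoly" where
  "init_term r f =
    Poly_Mapping.single (lead_monomial r f) (Poly_Mapping.lookup f (lead_monomial r f))"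

definition compatible_order ::
    "'k::comm_ring_1 itself \<Rightarrow> 'v set \<Rightarrow> 'v \<Rightarrow> (('v \<Rightarrow>\<^sub>0 nat) \<times> ('v \<Rightarrow>\<^sub>0 nat)) set \<Rightarrow> bool" where
  "compatible_order _ X y r \<longleftrightarrow>
    (\<forall>f\<in>carrier (mpoly_ring X :: ('v, 'k) mpoly ring). init_term r f = init_term r (init_in y f))"

definition groebner_basis ::
    "'v set \<Rightarrow> (('v \<Rightarrow>\<^sub>0 nat) \<times> ('v \<Rightarrow>\<^sub>0 nat)) set \<Rightarrow> ('v, 'k::comm_ring_1) mpoly set \<Rightarrow>
      ('v, 'k) mpoly set \<Rightarrow> bool" where
  "groebner_basis X r B I \<longleftrightarrow>
    finite B \<and> B \<subseteq> I - {0} \<and>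
    Idl\<^bsub>mpoly_ring X\<^esub> (init_term r ` B) = Idl\<^bsub>mpoly_ring X\<^esub> (init_term r ` (I - {0}))"


section \<open>Geometric vertex decomposability\<close>

text \<open>
  The ideals \<open>C\<^sub>y\<^sub>,\<^sub>I\<close> and \<open>N\<^sub>y\<^sub>,\<^sub>I\<close>, computed from a Groebner basis \<open>B\<close> of \<open>I\<close>.
\<close>

definition C_ideal ::
    "'v set \<Rightarrow> 'v \<Rightarrow> ('v, 'k::comm_ring_1) mpoly set \<Rightarrow> ('v, 'k) mpoly set" where
  "C_ideal X y B = Idl\<^bsub>mpoly_ring X\<^esub> (lead_coeff_in y ` B)"

definition N_ideal ::
    "'v set \<Rightarrow> 'v \<Rightarrow> ('v, 'k::comm_ring_1) mpoly set \<Rightarrow> ('v, 'k) mpoly set" where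
  "N_ideal X y B = Idl\<^bsub>mpoly_ring X\<^esub> (lead_coeff_in y ` {g \<in> B. degree_in y g = 0})"

definition contraction ::
    "'v set \<Rightarrow> ('v, 'k::comm_ring_1) mpoly set \<Rightarrow> ('v, 'k) mpoly set" where
  "contraction X I = I \<inter> carrier (mpoly_ring X)"

text \<open>
  \<open>gvd X I\<close>: the ideal \<open>I\<close> of \<open>K[X]\<close> is geometrically vertex decomposable.  For \<open>X = {}\<close> the
  first two rules give the ideals \<open>\<langle>1\<rangle>\<close> and \<open>\<langle>0\<rangle>\<close> of the field of coefficients.
\<close>

inductive gvd :: "'v set \<Rightarrow> ('v, 'k::field) mpoly set \<Rightarrow> bool" where
  unit:
    "\<lbrakk>ideal I (mpoly_ring X); unmixed (mpoly_ring X) I; I = Idl\<^bsub>mpoly_ring X\<^esub> {1}\<rbrakk>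
     \<Longrightarrow> gvd X I"
| variables:
    "\<lbrakk>ideal I (mpoly_ring X); unmixed (mpoly_ring X) I;
      Y \<subseteq> X; I = Idl\<^bsub>mpoly_ring X\<^esub> (var ` Y)\<rbrakk>
     \<Longrightarrow> gvd X I"
| decompose:
    "\<lbrakk>ideal I (mpoly_ring X); unmixed (mpoly_ring X) I;
      y \<in> X; monomial_order X r; compatible_order TYPE('k) X y r; groebner_basis X r B I;
      init_in_ideal X y I =
        C_ideal X y B \<inter> (N_ideal X y B <+>\<^bsub>mpoly_ring X\<^esub> Idl\<^bsub>mpoly_ring X\<^esub> {var y});
      gvd (X - {y}) (contraction (X - {y}) (C_ideal X y B));
      gvd (X - {y}) (contraction (X - {y}) (N_ideal X y B))\<rbrakk>
     \<Longrightarrow> gvd X I"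


section \<open>Graphs, toric ideals and gluing\<close>

record 'a ugraph =
  verts :: "'a set"
  edges :: "'a set set"

definition finite_simple_graph :: "'a ugraph \<Rightarrow> bool" where
  "finite_simple_graph G \<longleftrightarrow> finite (verts G) \<and> (\<forall>e\<in>edges G. e \<subseteq> verts G \<and> card e = 2)"

text \<open>
  The \<open>K\<close>-algebra homomorphism \<open>K[E(G)] \<rightarrow> K[V(G)]\<close> sending the variable \<open>e = {u, v}\<close> to
  \<open>x\<^sub>u x\<^sub>v\<close>.
\<close>

definition edge_hom :: "('a set, 'k::comm_ring_1) mpoly \<Rightarrow> ('a, 'k) mpoly" where
  "edge_hom p =
    (\<Sum>m\<in>Poly_Mapping.keys p. const (Poly_Mapping.lookup p m) *
      (\<Prod>e\<in>Poly_Mapping.keys m. (\<Prod>v\<in>e. var v) ^ Poly_Mapping.lookup m e))"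

definition toric_ideal :: "'a ugraph \<Rightarrow> ('a set, 'k::comm_ring_1) mpoly set" where
  "toric_ideal G = a_kernel (mpoly_ring (edges G)) (mpoly_ring (verts G)) edge_hom"

definition cycle_graph :: "nat \<Rightarrow> 'a ugraph \<Rightarrow> bool" where
  "cycle_graph n C \<longleftrightarrow> n \<ge> 3 \<and>
    (\<exists>v. inj_on v {..<n} \<and> verts C = v ` {..<n} \<and>
         edges C = {{v i, v (Suc i mod n)} | i. i < n})"

definition map_graph :: "('a \<Rightarrow> 'b) \<Rightarrow> 'a ugraph \<Rightarrow> 'b ugraph" where
  "map_graph h G = \<lparr>verts = h ` verts G, edges = (`) h ` edges G\<rparr>"

definition graph_iso :: "'a ugraph \<Rightarrow> 'b ugraph \<Rightarrow> bool" where
  "graph_iso G H \<longleftrightarrow> (\<exists>h. inj_on h (verts G) \<and> H = map_graph h G)"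

definition disjoint_union :: "'a ugraph \<Rightarrow> 'b ugraph \<Rightarrow> ('a + 'b) ugraph" where
  "disjoint_union G C =
    \<lparr>verts = verts G <+> verts C, edges = (`) Inl ` edges G \<union> (`) Inr ` edges C\<rparr>"

text \<open>
  The quotient of \<open>G \<squnion> C\<close> by the identifications \<open>c \<sim> a\<close> and \<open>d \<sim> b\<close>, which merge the edge
  \<open>{c, d}\<close> of \<open>C\<close> with the edge \<open>{a, b}\<close> of \<open>G\<close>; each class \<open>{Inl a, Inr c}\<close>, \<open>{Inl b, Inr d}\<close>
  is represented by its element coming from \<open>G\<close>.
\<close>

definition glue_along_edge ::
    "'a ugraph \<Rightarrow> 'a \<times> 'a \<Rightarrow> 'b ugraph \<Rightarrow> 'b \<times> 'b \<Rightarrow> ('a + 'b) ugraph" where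
  "glue_along_edge G = (\<lambda>(a, b) C (c, d).
    map_graph (id(Inr c := Inl a, Inr d := Inl b)) (disjoint_union G C))"

end

theory Submission
  imports Defs
begin

text \<open>
  Let \<open>X\<close> be the edge set of \<open>G\<close>, and number the edges of the cycle \<open>f\<^sub>0, \<dots>, f\<^sub>2\<^sub>k\<^sub>-\<^sub>1\<close> in such a way
  that \<open>f\<^sub>0 \<in> X\<close> is the edge along which it is glued.  Each new vertex lies on just two edges of
  \<open>H\<close>, both on the cycle.  Hence, for two monomials with the same vertex degrees, the differences of
  the exponents alternate in sign along \<open>f\<^sub>1, f\<^sub>2, \<dots>\<close>, and trading odd edges of the cycle for even
  ones makes the two monomials agree outside \<open>X\<close>.  So \<open>I\<^sub>H\<close> is generated by \<open>I\<^sub>G\<close> and the single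
  binomial \<open>f\<^sub>1 f\<^sub>3 \<dots> - f\<^sub>0 f\<^sub>2 \<dots>\<close> (\<open>toric_kernel_add_cycle\<close>).

  With respect to \<open>y = f\<^sub>1\<close> this binomial is \<open>y q + s\<close> with \<open>q = f\<^sub>3 f\<^sub>5 \<dots>\<close>.  Since \<open>I\<^sub>G\<close> is prime
  and does not contain \<open>q\<close>, decomposing \<open>I\<^sub>H\<close> at \<open>y\<close> gives \<open>C = I\<^sub>G + \<langle>q\<rangle>\<close> and \<open>N = I\<^sub>G\<close>
  (\<open>gvd_step\<close>).  The ideal \<open>N\<close> stays geometrically vertex decomposable when variables are adjoined
  (\<open>gvd_ext\<close>), and \<open>C\<close> is decomposed by splitting off the factors of \<open>q\<close> one after the other: this
  is the case \<open>s = 0\<close> of the same step, and it ends with the unit ideal.  The inductive bookkeeping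
  is \<open>decomposable_with\<close>.

  What takes work is the requirement that all ideals on the way be unmixed.  Prime ideals are.  For
  the ideals obtained by adjoining a variable, the associated primes are the extended ones
  (\<open>associated_primes_ext\<close>), and the dimension of the quotient must be seen to grow by exactly one.
  This is immediate once the Krull dimension is known combinatorially: \<open>dim K[X]/I\<close> is the largest
  size of a set \<open>Y\<close> of variables with \<open>I \<inter> K[Y] = 0\<close> (\<open>krull_dim_affine\<close>).  That formula is the
  dimension theorem for affine algebras; it is obtained by eliminating generators of modules over \<open>K[Y]\<close>.
  Finally \<open>I + \<langle>y q\<rangle>\<close> is the intersection of the extension of \<open>I + \<langle>q\<rangle>\<close> with the prime ideal
  \<open>I + \<langle>y\<rangle>\<close>, and its two parts have the same dimension (\<open>unmixed_mult_var\<close>).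
\<close>


abbreviation "lookup \<equiv> Poly_Mapping.lookup"
abbreviation "keys \<equiv> Poly_Mapping.keys"
abbreviation "single \<equiv> Poly_Mapping.single"

section \<open>Polynomials as finitely supported families\<close>

text \<open>
  The elements of \<open>K[X]\<close>.  Computations take place in the ambient type, where the type classes give
  ring arithmetic; only membership in this carrier is tracked.
\<close>

definition polys :: "'v set \<Rightarrow> ('v, 'k::comm_ring_1) mpoly set" where
  "polys X = {p. keys p \<subseteq> monomials X}"

lemma mpoly_ring_simps [simp]:
  "carrier (mpoly_ring X) = polys X"
  "p \<otimes>\<^bsub>mpoly_ring X\<^esub> q = p * q" "p \<oplus>\<^bsub>mpoly_ring X\<^esub> q = p + q"
  "\<one>\<^bsub>mpoly_ring X\<^esub> = 1" "\<zero>\<^bsub>mpoly_ring X\<^esub> = 0"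
  by (auto simp: mpoly_ring_def polys_def)

lemma monomials_iff: "m \<in> monomials X \<longleftrightarrow> (\<forall>v. v \<notin> X \<longrightarrow> lookup m v = 0)"
  by (auto simp: monomials_def in_keys_iff)

lemma monomials_zero [simp]: "0 \<in> monomials X"
  and monomials_add: "m \<in> monomials X \<Longrightarrow> n \<in> monomials X \<Longrightarrow> m + n \<in> monomials X"
  and monomials_addD: "m + n \<in> monomials X \<Longrightarrow> m \<in> monomials X \<and> n \<in> monomials X"
  and monomials_single: "v \<in> X \<Longrightarrow> single v j \<in> monomials X"
  and monomials_mono: "X \<subseteq> Y \<Longrightarrow> m \<in> monomials X \<Longrightarrow> m \<in> monomials Y"
  by (auto simp: monomials_iff lookup_add lookup_minus lookup_single when_def)

lemma polys_iff: "p \<in> polys X \<longleftrightarrow> (\<forall>m. lookup p m \<noteq> 0 \<longrightarrow> m \<in> monomials X)"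
  by (auto simp: polys_def in_keys_iff)

lemma polys_keysD: "p \<in> polys X \<Longrightarrow> m \<in> keys p \<Longrightarrow> m \<in> monomials X"
  by (auto simp: polys_def)

lemma polys_mono: "X \<subseteq> Y \<Longrightarrow> p \<in> polys X \<Longrightarrow> p \<in> polys Y"
  by (auto simp: polys_iff intro: monomials_mono)

lemma polys_zero [simp]: "0 \<in> polys X" by (simp add: polys_iff)

lemma polys_one [simp]: "1 \<in> polys X"
  by (auto simp: polys_def)

lemma polys_add: "p \<in> polys X \<Longrightarrow> q \<in> polys X \<Longrightarrow> p + q \<in> polys X"
  by (auto simp: polys_iff lookup_add) (metis add.left_neutral)

lemma polys_uminus: "p \<in> polys X \<Longrightarrow> - p \<in> polys X"
  by (auto simp: polys_iff)

lemma polys_minus: "p \<in> polys X \<Longrightarrow> q \<in> polys X \<Longrightarrow> p - q \<in> polys X"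
  using polys_add[of p X "- q"] polys_uminus[of q X] by simp

lemma polys_mult: "p \<in> polys X \<Longrightarrow> q \<in> polys X \<Longrightarrow> p * q \<in> polys X"
  using keys_mult[of p q] by (fastforce simp: polys_def intro: monomials_add)

lemma polys_sum: "(\<And>i. i \<in> A \<Longrightarrow> f i \<in> polys X) \<Longrightarrow> sum f A \<in> polys X"
  by (induction A rule: infinite_finite_induct) (auto intro: polys_add)

lemma polys_prod: "(\<And>i. i \<in> A \<Longrightarrow> f i \<in> polys X) \<Longrightarrow> prod f A \<in> polys X"
  by (induction A rule: infinite_finite_induct) (auto intro: polys_mult)

lemma polys_power: "p \<in> polys X \<Longrightarrow> p ^ n \<in> polys X"
  by (induction n) (auto intro: polys_mult)

lemma polys_single: "m \<in> monomials X \<Longrightarrow> single m c \<in> polys X"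
  by (auto simp: polys_iff lookup_single when_def)

lemma polys_var: "v \<in> X \<Longrightarrow> var v \<in> polys X"
  unfolding var_def by (intro polys_single monomials_single)

lemma var_power: "var y ^ j = single (single y j) 1"
  by (induction j) (auto simp: var_def mult_single single_add[symmetric])

lemma sum_singles: "(\<Sum>m\<in>keys p. single m (lookup p m)) = p"
  by (rule poly_mapping_eqI) (auto simp: lookup_sum lookup_single when_def in_keys_iff)

lemma mpoly_induct [case_names single add]:
  assumes s: "\<And>m c. P (single m c)" and a: "\<And>p q. P p \<Longrightarrow> P q \<Longrightarrow> P (p + q)"
  shows "P (p :: 'a \<Rightarrow>\<^sub>0 'b::comm_monoid_add)"
proof -
  have "P (\<Sum>m\<in>A. single m (lookup p m))" if "finite A" for A
    using that
  proof induction
    case empty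
    then show ?case using s[of undefined 0] by simp
  qed (auto intro: s a)
  from this[OF finite_keys[of p]] show ?thesis by (simp add: sum_singles)
qed

lemma lookup_single_mult_add:
  fixes k m :: "'a \<Rightarrow>\<^sub>0 nat"
  shows "lookup (single k c * p) (k + m) = c * lookup p m"
  by (induction p rule: mpoly_induct)
    (auto simp: mult_single lookup_single when_def distrib_left lookup_add)

lemma lookup_single_mult_eq_0:
  fixes k m :: "'a \<Rightarrow>\<^sub>0 nat"
  assumes "\<And>n. m \<noteq> k + n"
  shows "lookup (single k c * p) m = 0"
  using assms by (induction p rule: mpoly_induct)
    (auto simp: mult_single lookup_single when_def distrib_left lookup_add)

lemma keys_single_mult:
  fixes k m :: "'a \<Rightarrow>\<^sub>0 nat"
  assumes "m \<in> keys (single k c * p)"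
  obtains n where "m = k + n" "n \<in> keys p"
proof -
  obtain n where n: "m = k + n" using assms lookup_single_mult_eq_0[of m k c p]
    by (auto simp: in_keys_iff)
  show ?thesis
    by (rule that[OF n]) (use assms n in \<open>auto simp: in_keys_iff lookup_single_mult_add\<close>)
qed


section \<open>Ideals\<close>

lemma ideal_mpoly_iff:
  "ideal I (mpoly_ring X) \<longleftrightarrow> I \<subseteq> polys X \<and> 0 \<in> I \<and> (\<forall>p\<in>I. \<forall>q\<in>I. p + q \<in> I) \<and>
     (\<forall>p\<in>polys X. \<forall>q\<in>I. p * q \<in> I)" (is "_ \<longleftrightarrow> ?R")
proof
  assume I: "ideal I (mpoly_ring X)"
  interpret ideal I "mpoly_ring X" by fact
  show ?R
    using a_subset additive_subgroup.zero_closed[OF additive_subgroup_axioms] additive_subgroup.a_closed[OF additive_subgroup_axioms] I_l_closed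
    by auto
next
  assume r: ?R
  interpret R: cring "mpoly_ring X" by (rule cring_mpoly_ring)
  have u: "- p \<in> I" if "p \<in> I" for p
  proof -
    have "(- 1) * p \<in> I" using r that polys_uminus[OF polys_one] by blast
    then show ?thesis by simp
  qed
  show "ideal I (mpoly_ring X)"
  proof (rule idealI)
    show "subgroup I (add_monoid (mpoly_ring X))"
    proof (rule R.add.subgroupI)
      fix p assume p: "p \<in> I"
      then have "\<ominus>\<^bsub>mpoly_ring X\<^esub> p = - p"
        using r by (intro R.minus_equality) (auto intro: polys_uminus)
      then show "\<ominus>\<^bsub>mpoly_ring X\<^esub> p \<in> I" using u p by simp
    qed (use r in auto)
    have "q * p \<in> I" if "q \<in> I" "p \<in> polys X" for p q
      using r that by (subst mult.commute) blast
    then show "\<And>a x. a \<in> I \<Longrightarrow> x \<in> carrier (mpoly_ring X) \<Longrightarrow> a \<otimes>\<^bsub>mpoly_ring X\<^esub> x \<in> I" by simp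
  qed (use r in \<open>auto simp: R.ring_axioms\<close>)
qed

lemma idealD:
  assumes "ideal I (mpoly_ring X)"
  shows ideal_subset: "I \<subseteq> polys X" and ideal_zero: "0 \<in> I"
    and ideal_add: "p \<in> I \<Longrightarrow> q \<in> I \<Longrightarrow> p + q \<in> I"
    and ideal_mult: "r \<in> polys X \<Longrightarrow> p \<in> I \<Longrightarrow> r * p \<in> I"
    and ideal_mult_right: "r \<in> polys X \<Longrightarrow> p \<in> I \<Longrightarrow> p * r \<in> I"
    and ideal_uminus: "p \<in> I \<Longrightarrow> - p \<in> I"
    and ideal_minus: "p \<in> I \<Longrightarrow> q \<in> I \<Longrightarrow> p - q \<in> I"
    and ideal_sum: "(\<And>i. i \<in> A \<Longrightarrow> f i \<in> I) \<Longrightarrow> sum f A \<in> I"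
proof -
  note a = assms[unfolded ideal_mpoly_iff]
  show "I \<subseteq> polys X" "0 \<in> I" "p \<in> I \<Longrightarrow> q \<in> I \<Longrightarrow> p + q \<in> I"
    "r \<in> polys X \<Longrightarrow> p \<in> I \<Longrightarrow> r * p \<in> I" "r \<in> polys X \<Longrightarrow> p \<in> I \<Longrightarrow> p * r \<in> I"
    using a by (auto simp: mult.commute)
  have u: "- p \<in> I" if "p \<in> I" for p
  proof -
    have "(- 1) * p \<in> I" using a that polys_uminus[OF polys_one] by blast
    then show ?thesis by simp
  qed
  then show "p \<in> I \<Longrightarrow> - p \<in> I" by blast
  show "p \<in> I \<Longrightarrow> q \<in> I \<Longrightarrow> p - q \<in> I" using a u[of q] by (metis add_uminus_conv_diff)
  show "sum f A \<in> I" if "\<And>i. i \<in> A \<Longrightarrow> f i \<in> I"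
    using that a by (induction A rule: infinite_finite_induct) auto
qed

lemma ideal_add_cancel:
  assumes "ideal I (mpoly_ring X)" "q \<in> I"
  shows "p + q \<in> I \<longleftrightarrow> p \<in> I"
  using ideal_add[OF assms(1), of p q] ideal_minus[OF assms(1), of "p + q" q] assms(2) by auto

lemma ideal_eq_polys_iff:
  assumes "ideal I (mpoly_ring X)"
  shows "I = polys X \<longleftrightarrow> 1 \<in> I"
  using ideal_mult[OF assms, of _ 1] ideal_subset[OF assms] by auto

lemma primeideal_mpoly_iff:
  "primeideal P (mpoly_ring X) \<longleftrightarrow> ideal P (mpoly_ring X) \<and> 1 \<notin> P \<and>
     (\<forall>p\<in>polys X. \<forall>q\<in>polys X. p * q \<in> P \<longrightarrow> p \<in> P \<or> q \<in> P)"
proof -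
  have "1 \<notin> P \<longleftrightarrow> polys X \<noteq> P" if "ideal P (mpoly_ring X)"
    using ideal_eq_polys_iff[OF that] by auto
  then show ?thesis
    unfolding primeideal_def primeideal_axioms_def using cring_mpoly_ring by auto
qed

lemma primeD:
  assumes "primeideal P (mpoly_ring X)"
  shows prime_ideal: "ideal P (mpoly_ring X)" and prime_one: "1 \<notin> P"
    and prime_mult: "p * q \<in> P \<Longrightarrow> p \<in> polys X \<Longrightarrow> q \<in> polys X \<Longrightarrow> p \<in> P \<or> q \<in> P"
    and prime_power: "p ^ n \<in> P \<Longrightarrow> p \<in> polys X \<Longrightarrow> p \<in> P"
proof -
  note a = assms[unfolded primeideal_mpoly_iff]
  show "ideal P (mpoly_ring X)" "1 \<notin> P"
    "p * q \<in> P \<Longrightarrow> p \<in> polys X \<Longrightarrow> q \<in> polys X \<Longrightarrow> p \<in> P \<or> q \<in> P" using a by auto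
  show "p \<in> P" if "p ^ n \<in> P" "p \<in> polys X"
    using that(1)
  proof (induction n)
    case (Suc n)
    then show ?case using a that(2) polys_power[OF that(2), of n] by auto
  qed (use a in auto)
qed

abbreviation gen :: "'v set \<Rightarrow> ('v, 'k::comm_ring_1) mpoly set \<Rightarrow> ('v, 'k) mpoly set" where
  "gen X S \<equiv> Idl\<^bsub>mpoly_ring X\<^esub> S"

lemma gen_ideal: "S \<subseteq> polys X \<Longrightarrow> ideal (gen X S) (mpoly_ring X)"
  and gen_superset: "S \<subseteq> polys X \<Longrightarrow> S \<subseteq> gen X S"
  and gen_least: "ideal I (mpoly_ring X) \<Longrightarrow> S \<subseteq> I \<Longrightarrow> gen X S \<subseteq> I"
proof -
  interpret R: cring "mpoly_ring X :: ('a, 'b) mpoly ring" by (rule cring_mpoly_ring)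
  show "S \<subseteq> polys X \<Longrightarrow> ideal (gen X S) (mpoly_ring X)" using R.genideal_ideal[of S] by simp
  show "S \<subseteq> polys X \<Longrightarrow> S \<subseteq> gen X S" using R.genideal_self[of S] by simp
  show "ideal I (mpoly_ring X) \<Longrightarrow> S \<subseteq> I \<Longrightarrow> gen X S \<subseteq> I" using R.genideal_minimal by blast
qed

lemma gen_eqI: "ideal I (mpoly_ring X) \<Longrightarrow> S \<subseteq> I \<Longrightarrow>
    (\<And>J. ideal J (mpoly_ring X) \<Longrightarrow> S \<subseteq> J \<Longrightarrow> I \<subseteq> J) \<Longrightarrow> gen X S = I"
  using gen_least[of I X S] gen_ideal[of S X] gen_superset[of S X] ideal_subset[of I X] by blast

lemma gen_self: "ideal I (mpoly_ring X) \<Longrightarrow> gen X I = I"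
  by (rule gen_eqI) auto

lemma gen_insert_mem_iff:
  fixes I :: "('v, 'k::comm_ring_1) mpoly set"
  assumes I: "ideal I (mpoly_ring X)" and q: "q \<in> polys X"
  shows "p \<in> gen X (insert q I) \<longleftrightarrow> (\<exists>a\<in>I. \<exists>h\<in>polys X. p = a + h * q)"
proof -
  let ?M = "{a + h * q | a h. a \<in> I \<and> h \<in> polys X}"
  have "gen X (insert q I) = ?M"
  proof (rule gen_eqI)
    show "ideal ?M (mpoly_ring X)"
      unfolding ideal_mpoly_iff
    proof (intro conjI ballI)
      show "?M \<subseteq> polys X" using ideal_subset[OF I] q by (auto intro!: polys_add polys_mult)
      show "0 \<in> ?M" using ideal_zero[OF I] polys_zero[of X] by (metis (mono_tags, lifting) add_0 mem_Collect_eq mult_zero_left)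
    next
      fix p p' assume "p \<in> ?M" "p' \<in> ?M"
      then obtain a h a' h' where "p = a + h * q" "p' = a' + h' * q"
        "a \<in> I" "a' \<in> I" "h \<in> polys X" "h' \<in> polys X" by blast
      then have "p + p' = (a + a') + (h + h') * q" "a + a' \<in> I" "h + h' \<in> polys X"
        by (auto simp: algebra_simps intro: polys_add ideal_add[OF I])
      then show "p + p' \<in> ?M" by blast
    next
      fix r p :: "('v, 'k) mpoly" assume r: "r \<in> polys X" and "p \<in> ?M"
      then obtain a h where "p = a + h * q" "a \<in> I" "h \<in> polys X" by blast
      then have "r * p = r * a + (r * h) * q" "r * a \<in> I" "r * h \<in> polys X"
        using r by (simp_all only: distrib_left mult.assoc polys_mult ideal_mult[OF I])
      then show "r * p \<in> ?M" by blast
    qed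
    have "a \<in> ?M" if "a \<in> I" for a using that polys_zero[of X]
      by (metis (mono_tags, lifting) add.right_neutral mem_Collect_eq mult_zero_left)
    moreover have "q \<in> ?M" using ideal_zero[OF I] polys_one[of X]
      by (metis (mono_tags, lifting) add_0 mem_Collect_eq mult_1)
    ultimately show "insert q I \<subseteq> ?M" by blast
    show "?M \<subseteq> J" if "ideal J (mpoly_ring X)" "insert q I \<subseteq> J" for J
      using that by (auto intro!: ideal_add ideal_mult)
  qed
  then show ?thesis by auto
qed


section \<open>Expansion in one variable\<close>

text \<open>
  The coefficients in \<open>y\<close> are compared entry by entry below, always through this formula.
\<close>

lemma lookup_coeff_in:
  "lookup (coeff_in y j f) m =
    (if lookup m y = 0 then lookup f (m + single y j) else 0)"
proof -
  have *: "n - single y j = m \<longleftrightarrow> lookup m y = 0 \<and> n = m + single y j"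
    if "lookup n y = j" for n
  proof -
    have "lookup n v = lookup (n - single y j) v + lookup (single y j) v" for v
      using that by (auto simp: lookup_minus lookup_single when_def)
    then have "n = (n - single y j) + single y j"
      by (intro poly_mapping_eqI) (simp add: lookup_add)
    moreover have "lookup (n - single y j) y = 0" using that by (simp add: lookup_minus)
    ultimately show ?thesis by auto
  qed
  have "lookup (coeff_in y j f) m = (\<Sum>n | n \<in> keys f \<and> lookup n y = j.
      if lookup m y = 0 \<and> n = m + single y j then lookup f n else 0)"
    unfolding coeff_in_def lookup_sum lookup_single when_def by (intro sum.cong) (use * in auto)
  also have "\<dots> = (if lookup m y = 0 then lookup f (m + single y j) else 0)"
    by (auto simp: sum.delta lookup_add in_keys_iff)
  finally show ?thesis .
qed

lemma coeff_in_zero [simp]: "coeff_in y j 0 = 0"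
  and coeff_in_add: "coeff_in y j (p + q) = coeff_in y j p + coeff_in y j q"
  by (auto intro!: poly_mapping_eqI simp: lookup_coeff_in lookup_add lookup_minus)

lemma coeff_in_sum: "coeff_in y j (sum f A) = (\<Sum>i\<in>A. coeff_in y j (f i))"
  by (induction A rule: infinite_finite_induct) (auto simp: coeff_in_add)

lemma monomial_split: "(m :: 'v \<Rightarrow>\<^sub>0 nat) = (m - single y (lookup m y)) + single y (lookup m y)"
  by (rule poly_mapping_eqI) (auto simp: lookup_add lookup_minus lookup_single when_def)

lemma coeff_in_single:
  "coeff_in y j (single m c) =
    (if lookup m y = j then single (m - single y j) c else 0)"
proof (rule poly_mapping_eqI)
  fix n
  have "m = n + single y j \<and> lookup n y = 0 \<longleftrightarrow>
      lookup m y = j \<and> m - single y j = n"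
    using monomial_split[of m y, symmetric] by (auto simp: lookup_add lookup_minus)
  then show "lookup (coeff_in y j (single m c)) n = lookup
      (if lookup m y = j then single (m - single y j) c else 0) n"
    by (auto simp: lookup_coeff_in lookup_single when_def)
qed

text \<open>
  The Cauchy product.  Both sides are bilinear, so it is enough to compare them on terms.
\<close>

lemma coeff_in_mult:
  "coeff_in y n (p * q) = (\<Sum>i\<le>n. coeff_in y i p * coeff_in y (n - i) q)"
proof (induction p rule: mpoly_induct)
  case (single m c)
  show ?case
  proof (induction q rule: mpoly_induct)
    case (single m' c')
    have "(\<Sum>i\<le>n. coeff_in y i (single m c) * coeff_in y (n - i) (single m' c'))
      = (\<Sum>i\<le>n. if i = lookup m y then coeff_in y i (single m c) *
            coeff_in y (n - i) (single m' c') else 0)"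
      by (intro sum.cong) (auto simp: coeff_in_single)
    also have "\<dots> = (if lookup m y \<le> n then coeff_in y (lookup m y) (single m c) *
            coeff_in y (n - lookup m y) (single m' c') else 0)"
      by (subst sum.delta) auto
    also have "\<dots> = coeff_in y n (single m c * single m' c')"
    proof (cases "lookup m y + lookup m' y = n")
      case True
      then have "m + m' - single y n =
          m - single y (lookup m y) + (m' - single y (lookup m' y))"
        by (intro poly_mapping_eqI) (auto simp: lookup_add lookup_minus lookup_single when_def)
      then show ?thesis using True by (auto simp: coeff_in_single mult_single lookup_add)
    next
      case False
      then show ?thesis by (auto simp: coeff_in_single mult_single lookup_add)
    qed
    finally show ?case by simp
  qed (simp add: coeff_in_add distrib_left sum.distrib)
qed (simp add: coeff_in_add distrib_right sum.distrib)

lemma coeff_in_free: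
  assumes "p \<in> polys X" "y \<notin> X"
  shows "coeff_in y j p = (if j = 0 then p else 0)"
proof (rule poly_mapping_eqI)
  fix m
  have z: "lookup p n = 0" if "lookup n y \<noteq> 0" for n
    using that assms by (auto simp: polys_iff monomials_iff)
  show "lookup (coeff_in y j p) m = lookup (if j = 0 then p else 0) m"
    using z[of m] z[of "m + single y j"]
    by (auto simp: lookup_coeff_in lookup_add)
qed

lemma coeff_in_polys:
  assumes "p \<in> polys X" shows "coeff_in y j p \<in> polys (X - {y})"
  unfolding polys_iff
proof (intro allI impI)
  fix m assume "lookup (coeff_in y j p) m \<noteq> 0"
  then have "lookup m y = 0" "lookup p (m + single y j) \<noteq> 0"
    by (auto simp: lookup_coeff_in split: if_splits)
  then show "m \<in> monomials (X - {y})" using assms monomials_addD[of m _ X]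
    by (auto simp: polys_iff monomials_iff)
qed

lemma coeff_in_polys_insert:
  assumes "p \<in> polys (insert y X)" shows "coeff_in y j p \<in> polys X"
  using coeff_in_polys[OF assms, of y j] by (auto intro: polys_mono[rotated])

lemma coeff_in_mult_free:
  assumes "q \<in> polys X" "y \<notin> X"
  shows "coeff_in y j (p * q) = coeff_in y j p * q"
proof -
  have "coeff_in y j (p * q) = (\<Sum>i\<le>j. if i = j then coeff_in y i p * q else 0)"
    unfolding coeff_in_mult by (intro sum.cong) (auto simp: coeff_in_free[OF assms])
  then show ?thesis by simp
qed

lemma coeff_in_mult_free':
  assumes "q \<in> polys X" "y \<notin> X"
  shows "coeff_in y j (q * p) = q * coeff_in y j p"
  using coeff_in_mult_free[OF assms, of j p] by (simp add: mult.commute)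

lemma coeff_in_mult_var:
  "coeff_in y j (p * var y ^ k) = (if k \<le> j then coeff_in y (j - k) p else 0)"
proof -
  have "coeff_in y j (p * var y ^ k) = (\<Sum>i\<le>j. if i = j - k \<and> k \<le> j then coeff_in y i p else 0)"
    unfolding coeff_in_mult var_power
  proof (intro sum.cong refl)
    fix i assume "i \<in> {..j}"
    then show "coeff_in y i p * coeff_in y (j - i) (single (single y k) 1) =
        (if i = j - k \<and> k \<le> j then coeff_in y i p else 0)"
      by (cases "k = j - i") (auto simp: coeff_in_single)
  qed
  also have "\<dots> = (if k \<le> j then coeff_in y (j - k) p else 0)" by (cases "k \<le> j") simp_all
  finally show ?thesis .
qed

lemma coeff_in_eq_iff: "(\<forall>j. coeff_in y j p = coeff_in y j q) \<longleftrightarrow> p = q"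
proof
  assume a: "\<forall>j. coeff_in y j p = coeff_in y j q"
  show "p = q"
  proof (rule poly_mapping_eqI)
    fix m
    have e: "lookup f m = lookup (coeff_in y (lookup m y) f) (m - single y (lookup m y))" for f :: "('a, 'b) mpoly"
      unfolding lookup_coeff_in using monomial_split[of m y] by (simp only: lookup_minus lookup_single_eq diff_self_eq_0 simp_thms if_True)
    show "lookup p m = lookup q m" unfolding e[of p] e[of q] using a by simp
  qed
qed simp

lemma finite_coeff_in: "finite {j. coeff_in y j p \<noteq> 0}"
proof (rule finite_subset)
  show "{j. coeff_in y j p \<noteq> 0} \<subseteq> (\<lambda>m. lookup m y) ` keys p"
  proof
    fix j assume "j \<in> {j. coeff_in y j p \<noteq> 0}"
    then obtain m where "lookup (coeff_in y j p) m \<noteq> 0" unfolding poly_mapping_eq_iff fun_eq_iff lookup_zero by blast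
    then have "lookup m y = 0" "lookup p (m + single y j) \<noteq> 0"
      unfolding lookup_coeff_in by presburger+
    then show "j \<in> (\<lambda>m. lookup m y) ` keys p"
      by (intro image_eqI[of _ _ "m + single y j"]) (auto simp: lookup_add in_keys_iff)
  qed
qed simp

lemma coeff_in_ex_nonzero: "p \<noteq> 0 \<Longrightarrow> \<exists>j. coeff_in y j p \<noteq> 0"
  using coeff_in_eq_iff[of y p 0] by auto

lemma degree_in_ge: "coeff_in y j p \<noteq> 0 \<Longrightarrow> j \<le> degree_in y p"
  unfolding degree_in_def using finite_coeff_in by (intro Max_ge) auto

lemma degree_in_less: "degree_in y p < j \<Longrightarrow> coeff_in y j p = 0"
  using degree_in_ge[of y j p] by fastforce

lemma lead_coeff_in_nonzero: "p \<noteq> 0 \<Longrightarrow> lead_coeff_in y p \<noteq> 0"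
  unfolding lead_coeff_in_def degree_in_def
  using Max_in[OF finite_coeff_in[of y p]] coeff_in_ex_nonzero[of p y] by auto

lemma degree_in_eqI: "coeff_in y j p \<noteq> 0 \<Longrightarrow> (\<And>i. j < i \<Longrightarrow> coeff_in y i p = 0) \<Longrightarrow> degree_in y p = j"
  using lead_coeff_in_nonzero[of p y] degree_in_ge[of y j p] unfolding lead_coeff_in_def
  by (metis coeff_in_zero linorder_neqE_nat not_less)

lemma expand_in:
  assumes "\<And>j. N < j \<Longrightarrow> coeff_in y j p = 0"
  shows "p = (\<Sum>j\<le>N. coeff_in y j p * var y ^ j)"
proof -
  have c: "coeff_in y i (coeff_in y j p) = (if i = 0 then coeff_in y j p else 0)" for i j
    by (rule coeff_in_free[of _ "UNIV - {y}"])
      (use coeff_in_polys[of p UNIV y j] in \<open>simp_all add: polys_def monomials_def\<close>)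
  have "coeff_in y i p = coeff_in y i (\<Sum>j\<le>N. coeff_in y j p * var y ^ j)" for i
  proof -
    have "coeff_in y i (\<Sum>j\<le>N. coeff_in y j p * var y ^ j) = (\<Sum>j\<le>N. if j = i then coeff_in y j p else 0)"
      unfolding coeff_in_sum coeff_in_mult_var c by (intro sum.cong) auto
    also have "\<dots> = coeff_in y i p" using assms[of i] by auto
    finally show ?thesis by simp
  qed
  then have "\<forall>i. coeff_in y i p = coeff_in y i (\<Sum>j\<le>N. coeff_in y j p * var y ^ j)" by (rule allI)
  then show ?thesis by (rule coeff_in_eq_iff[THEN iffD1])
qed

lemma expand_in_degree: "p = (\<Sum>j\<le>degree_in y p. coeff_in y j p * var y ^ j)"
  by (intro expand_in degree_in_less)

lemma coeff_in_mult_top: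
  assumes "\<And>i. m < i \<Longrightarrow> coeff_in y i p = 0" "\<And>i. n < i \<Longrightarrow> coeff_in y i q = 0"
  shows "coeff_in y (m + n) (p * q) = coeff_in y m p * coeff_in y n q"
proof -
  have "coeff_in y (m + n) (p * q) = (\<Sum>i\<le>m + n. if i = m then coeff_in y m p * coeff_in y n q else 0)"
    unfolding coeff_in_mult
  proof (intro sum.cong refl)
    fix i
    show "coeff_in y i p * coeff_in y (m + n - i) q = (if i = m then coeff_in y m p * coeff_in y n q else 0)"
    proof (cases i m rule: linorder_cases)
      case less
      then have "n < m + n - i" by simp
      then show ?thesis using assms(2) less by simp
    qed (use assms(1) in auto)
  qed
  then show ?thesis by simp
qed

text \<open>
  Only finitely many variables occur in \<open>p\<close> and \<open>q\<close>, so they can be adjoined one at a time; the lead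
  coefficients in the last one multiply.
\<close>

lemma mpoly_no_zero_divisors:
  fixes p q :: "('v, 'k::idom) mpoly"
  assumes "p * q = 0" shows "p = 0 \<or> q = 0"
proof -
  define X where "X = (\<Union>m\<in>keys p \<union> keys q. keys m)"
  have "p \<in> polys X" "q \<in> polys X" "finite X"
    by (auto simp: X_def polys_def monomials_def)
  have "p = 0 \<or> q = 0" if "p \<in> polys X" "q \<in> polys X" "p * q = 0" "finite X"
    for X and p q :: "('v, 'k) mpoly"
    using that(4,1-3)
  proof (induction X arbitrary: p q)
    case empty
    have c: "f = single 0 (lookup f 0)" if "f \<in> polys {}" for f :: "('v, 'k) mpoly"
    proof (rule poly_mapping_eqI)
      fix m show "lookup f m = lookup (single 0 (lookup f 0)) m"
        using that by (cases "m = 0") (auto simp: polys_iff monomials_def lookup_single when_def)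
    qed
    have "single 0 (lookup p 0 * lookup q 0) = p * q"
      using c[OF empty(1)] c[OF empty(2)] by (metis mult_single add_0)
    then have "lookup p 0 * lookup q 0 = 0" using empty(3) by (metis lookup_single_eq lookup_zero)
    then show ?case using c[OF empty(1)] c[OF empty(2)] by (metis mult_eq_0_iff single_zero)
  next
    case (insert y X)
    show ?case
    proof (rule ccontr)
      assume a: "\<not> (p = 0 \<or> q = 0)"
      have "coeff_in y (degree_in y p + degree_in y q) (p * q) = lead_coeff_in y p * lead_coeff_in y q"
        unfolding lead_coeff_in_def by (intro coeff_in_mult_top degree_in_less)
      then have "lead_coeff_in y p * lead_coeff_in y q = 0" using insert.prems by simp
      moreover have "lead_coeff_in y p \<in> polys X" "lead_coeff_in y q \<in> polys X"
        using insert.prems unfolding lead_coeff_in_def by (auto intro: coeff_in_polys_insert)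
      ultimately show False using insert.IH[of "lead_coeff_in y p" "lead_coeff_in y q"] a
          lead_coeff_in_nonzero by metis
    qed
  qed
  from this[OF \<open>p \<in> polys X\<close> \<open>q \<in> polys X\<close> assms \<open>finite X\<close>] show ?thesis .
qed

lemma mpoly_mult_eq_0_iff: "p * q = 0 \<longleftrightarrow> p = 0 \<or> q = (0 :: ('v, 'k::idom) mpoly)"
  using mpoly_no_zero_divisors[of p q] by auto

lemma mpoly_power_nonzero: "p \<noteq> 0 \<Longrightarrow> p ^ n \<noteq> (0 :: ('v, 'k::idom) mpoly)"
  by (induction n) (simp_all add: mpoly_mult_eq_0_iff)

lemma mpoly_prod_nonzero: "(\<And>i. i \<in> A \<Longrightarrow> f i \<noteq> 0) \<Longrightarrow> prod f A \<noteq> (0 :: ('v, 'k::idom) mpoly)"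
  by (induction A rule: infinite_finite_induct) (simp_all add: mpoly_mult_eq_0_iff)


section \<open>Prime ideals of a quotient and prime ideals avoiding a set\<close>

text \<open>
  The projection matches the primes of \<open>R/I\<close> with the primes of \<open>R\<close> above \<open>I\<close> and respects
  inclusions, so chains of one kind are chains of the other.
\<close>

lemma (in cring) krull_dim_Quot:
  assumes I: "ideal I R"
  shows "krull_dim (R Quot I) = Sup {enat n | n. \<exists>P. (\<forall>i\<le>n. primeideal (P i) R \<and> I \<subseteq> P i) \<and> (\<forall>i<n. P i \<subset> P (Suc i))}"
proof -
  let ?q = "\<lambda>J. (+>) I ` J"
  interpret Q: cring "R Quot I" using ideal.quotient_is_cring[OF I] is_cring by blast
  interpret h: ring_hom_ring R "R Quot I" "(+>) I" by (rule ideal.rcos_ring_hom_ring[OF I])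
  note bij = quot_ideal_correspondence[OF I]
  have sub: "J \<subseteq> carrier (R Quot I)" if "ideal J (R Quot I)" for J
    using that additive_subgroup.a_subset ideal_def by blast
  have down: "primeideal (\<Union>J) R" "I \<subseteq> \<Union>J" "?q (\<Union>J) = J" if "primeideal J (R Quot I)" for J
  proof -
    have J: "ideal J (R Quot I)" using that by (rule primeideal.axioms(1))
    have eq: "\<Union>J = {r \<in> carrier R. I +> r \<in> J}"
      using canonical_proj_vimage_in_carrier[OF I sub[OF J]] canonical_proj_vimage_mem_iff[OF I sub[OF J]]
      by blast
    show "primeideal (\<Union>J) R" unfolding eq by (rule h.primeideal_vimage[OF is_cring that])
    obtain K where K: "ideal K R" "I \<subseteq> K" "J = ?q K"
    proof -
      have "J \<in> (\<lambda>J. ?q J) ` {J. ideal J R \<and> I \<subseteq> J}"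
        unfolding bij_betw_imp_surj_on[OF bij] using J by simp
      then show ?thesis using that by blast
    qed
    have "\<Union>J = K" using K ideal_incl_iff[OF I K(1)] by auto
    then show "I \<subseteq> \<Union>J" "?q (\<Union>J) = J" using K by auto
  qed
  have forth: "primeideal (?q P) (R Quot I)" "\<Union>(?q P) = P" if P: "primeideal P R" "I \<subseteq> P" for P
  proof -
    have Pi: "ideal P R" using P(1) by (rule primeideal.axioms(1))
    show U: "\<Union>(?q P) = P" using ideal_incl_iff[OF I Pi] P(2) by auto
    have qi: "ideal (?q P) (R Quot I)" by (rule ring_ideal_imp_quot_ideal[OF I Pi])
    have mem: "I +> r \<in> ?q P \<longleftrightarrow> r \<in> P" if "r \<in> carrier R" for r
      using canonical_proj_vimage_mem_iff[OF I sub[OF qi] that] U by simp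
    have rep: "\<exists>r\<in>carrier R. x = I +> r" if "x \<in> carrier (R Quot I)" for x
      using that unfolding FactRing_def A_RCOSETS_def' by auto
    show "primeideal (?q P) (R Quot I)"
    proof (rule primeidealI[OF qi Q.is_cring])
      have "I +> \<one> \<notin> ?q P" using mem[OF one_closed] primeideal.I_notcarr[OF P(1)]
          ideal.one_imp_carrier[OF Pi] by auto
      then show "carrier (R Quot I) \<noteq> ?q P" using h.hom_closed[OF one_closed] by blast
      fix x y assume xy: "x \<in> carrier (R Quot I)" "y \<in> carrier (R Quot I)" "x \<otimes>\<^bsub>R Quot I\<^esub> y \<in> ?q P"
      obtain r s where rs: "r \<in> carrier R" "s \<in> carrier R" "x = I +> r" "y = I +> s"
        using rep xy by meson
      then have "I +> (r \<otimes> s) \<in> ?q P" using xy(3) h.hom_mult[of r s] by metis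
      then have "r \<otimes> s \<in> P" using mem[of "r \<otimes> s"] rs by auto
      then show "x \<in> ?q P \<or> y \<in> ?q P" using primeideal.I_prime[OF P(1) rs(1,2)] rs by blast
    qed
  qed
  have "(\<exists>P. (\<forall>i\<le>n. primeideal (P i) (R Quot I)) \<and> (\<forall>i<n. P i \<subset> P (Suc i))) \<longleftrightarrow>
      (\<exists>P. (\<forall>i\<le>n. primeideal (P i) R \<and> I \<subseteq> P i) \<and> (\<forall>i<n. P i \<subset> P (Suc i)))" (is "?L \<longleftrightarrow> ?R") for n :: nat
  proof
    assume ?L
    then obtain P where P: "\<And>i. i \<le> n \<Longrightarrow> primeideal (P i) (R Quot I)" "\<And>i. i < n \<Longrightarrow> P i \<subset> P (Suc i)" by blast
    have "\<Union>(P i) \<subset> \<Union>(P (Suc i))" if "i < n" for i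
    proof -
      have "P i = ?q (\<Union>(P i))" "P (Suc i) = ?q (\<Union>(P (Suc i)))"
        using down(3)[OF P(1), of i] down(3)[OF P(1), of "Suc i"] that by simp_all
      then have "\<Union>(P i) \<noteq> \<Union>(P (Suc i))" using P(2)[OF that] by (metis psubset_eq)
      then show ?thesis using P(2)[OF that] by blast
    qed
    then show ?R using P down by (intro exI[of _ "\<lambda>i. \<Union>(P i)"]) auto
  next
    assume ?R
    then obtain P where P: "\<And>i. i \<le> n \<Longrightarrow> primeideal (P i) R \<and> I \<subseteq> P i" "\<And>i. i < n \<Longrightarrow> P i \<subset> P (Suc i)" by blast
    have "?q (P i) \<subset> ?q (P (Suc i))" if "i < n" for i
    proof -
      have "P i = \<Union>(?q (P i))" "P (Suc i) = \<Union>(?q (P (Suc i)))"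
        using forth(2)[of "P i"] forth(2)[of "P (Suc i)"] P(1)[of i] P(1)[of "Suc i"] that by simp_all
      then have "?q (P i) \<noteq> ?q (P (Suc i))" using P(2)[OF that] by (metis psubset_eq)
      then show ?thesis using P(2)[OF that] by blast
    qed
    then show ?L using P forth by (intro exI[of _ "\<lambda>i. ?q (P i)"]) auto
  qed
  then show ?thesis unfolding krull_dim_def by simp
qed

text \<open>
  An ideal \<open>M\<close> that is maximal among those avoiding \<open>S\<close> is prime: if \<open>p\<close> and \<open>q\<close> lie outside \<open>M\<close>, then
  \<open>M + \<langle>p\<rangle>\<close> and \<open>M + \<langle>q\<rangle>\<close> both meet \<open>S\<close>, and for \<open>p q \<in> M\<close> the product of two such elements would lie in
  \<open>M \<inter> S\<close>.
\<close>

lemma exists_prime_avoiding: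
  fixes I :: "('v, 'k::comm_ring_1) mpoly set"
  assumes I: "ideal I (mpoly_ring X)" and S: "S \<subseteq> polys X" "1 \<in> S"
    and mult: "\<And>s t. s \<in> S \<Longrightarrow> t \<in> S \<Longrightarrow> s * t \<in> S" and disj: "I \<inter> S = {}"
  obtains P where "primeideal P (mpoly_ring X)" "I \<subseteq> P" "P \<inter> S = {}"
proof -
  define A where "A = {J. ideal J (mpoly_ring X) \<and> I \<subseteq> J \<and> J \<inter> S = {}}"
  have "\<exists>M\<in>A. \<forall>J\<in>A. M \<subseteq> J \<longrightarrow> J = M"
  proof (rule subset_Zorn_nonempty)
    show "A \<noteq> {}" using I disj by (auto simp: A_def)
    fix C assume C: "C \<noteq> {}" "subset.chain A C"
    then have CA: "C \<subseteq> A" by (auto simp: subset.chain_def)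
    have dir: "\<exists>J\<in>C. p \<in> J \<and> q \<in> J" if "p \<in> \<Union>C" "q \<in> \<Union>C" for p q
      using that C(2) unfolding subset.chain_def by blast
    have "ideal (\<Union>C) (mpoly_ring X)"
      unfolding ideal_mpoly_iff
    proof (intro conjI ballI)
      show "\<Union>C \<subseteq> polys X" "0 \<in> \<Union>C" using CA C(1) by (auto simp: A_def ideal_mpoly_iff)
      fix p assume p: "p \<in> \<Union>C"
      fix q assume q: "q \<in> \<Union>C"
      obtain J where "J \<in> C" "p \<in> J" "q \<in> J" using dir[OF p q] by blast
      then show "p + q \<in> \<Union>C" using CA by (auto simp: A_def intro: ideal_add)
    next
      fix p q :: "('v, 'k) mpoly" assume "p \<in> polys X" "q \<in> \<Union>C"
      then show "p * q \<in> \<Union>C" using CA by (auto simp: A_def intro: ideal_mult)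
    qed
    then show "\<Union>C \<in> A" using CA C(1) unfolding A_def by blast
  qed
  then obtain M where M: "ideal M (mpoly_ring X)" "I \<subseteq> M" "M \<inter> S = {}"
    and max: "\<And>J. J \<in> A \<Longrightarrow> M \<subseteq> J \<Longrightarrow> J = M" by (auto simp: A_def)
  have meet: "\<exists>m\<in>M. \<exists>h\<in>polys X. m + h * p \<in> S"
    if p: "p \<in> polys X" "p \<notin> M" for p :: "('v, 'k) mpoly"
  proof -
    have sub: "insert p M \<subseteq> polys X" using p ideal_subset[OF M(1)] by auto
    have "gen X (insert p M) \<noteq> M" using gen_superset[OF sub] p by auto
    then have "gen X (insert p M) \<inter> S \<noteq> {}"
      using max[of "gen X (insert p M)"] gen_ideal[OF sub] gen_superset[OF sub] M(2) by (auto simp: A_def)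
    then obtain q where "q \<in> gen X (insert p M)" "q \<in> S" by blast
    then show ?thesis using gen_insert_mem_iff[OF M(1) p(1), of q] by blast
  qed
  have "primeideal M (mpoly_ring X)"
    unfolding primeideal_mpoly_iff
  proof (intro conjI ballI impI)
    show "1 \<notin> M" using M(3) S(2) by auto
    fix p q :: "('v, 'k) mpoly" assume pq: "p \<in> polys X" "q \<in> polys X" "p * q \<in> M"
    show "p \<in> M \<or> q \<in> M"
    proof (rule ccontr)
      assume "\<not> (p \<in> M \<or> q \<in> M)"
      then obtain m h m' h' where s: "m \<in> M" "h \<in> polys X" "m + h * p \<in> S" "m' \<in> M" "h' \<in> polys X" "m' + h' * q \<in> S"
        using meet[of p] meet[of q] pq by blast
      have "(m + h * p) * (m' + h' * q) = (m' + h' * q) * m + (h * p) * m' + (h * h') * (p * q)"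
        by (simp add: algebra_simps)
      also have "\<dots> \<in> M" 
        by (intro ideal_add[OF M(1)]; rule ideal_mult[OF M(1)])
          (use s pq S(1) in \<open>auto intro: polys_mult\<close>)
      finally show False using mult[OF s(3,6)] M(3) by blast
    qed
  qed (rule M(1))
  then show ?thesis using that M by blast
qed


section \<open>Elimination over a polynomial ring\<close>

text \<open>
  More than \<open>card K\<close> rows over the domain \<open>K[Y]\<close> are dependent: cross-multiplying with a pivot clears
  a column without any division.
\<close>

lemma polys_linear_dependence:
  fixes c :: "'i \<Rightarrow> 'w \<Rightarrow> ('v, 'k::idom) mpoly"
  assumes "finite K" "finite I" "card K < card I" "\<And>i k. i \<in> I \<Longrightarrow> k \<in> K \<Longrightarrow> c i k \<in> polys Y"
  shows "\<exists>d. (\<forall>i\<in>I. d i \<in> polys Y) \<and> (\<exists>i\<in>I. d i \<noteq> 0) \<and> (\<forall>k\<in>K. (\<Sum>i\<in>I. d i * c i k) = 0)"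
  using assms
proof (induction K arbitrary: I c)
  case empty
  then have "I \<noteq> {}" by auto
  then show ?case by (intro exI[of _ "\<lambda>_. 1"]) auto
next
  case (insert k0 K)
  show ?case
  proof (cases "\<forall>i\<in>I. c i k0 = 0")
    case True
    obtain d where d: "\<forall>i\<in>I. d i \<in> polys Y" "\<exists>i\<in>I. d i \<noteq> 0" "\<forall>k\<in>K. (\<Sum>i\<in>I. d i * c i k) = 0"
      using insert.IH[of I c] insert.prems insert.hyps by auto
    have "(\<Sum>i\<in>I. d i * c i k0) = 0" using True by (intro sum.neutral) auto
    then show ?thesis using d by blast
  next
    case False
    then obtain p where p: "p \<in> I" "c p k0 \<noteq> 0" by blast
    let ?J = "I - {p}"
    have "\<exists>d. (\<forall>i\<in>?J. d i \<in> polys Y) \<and> (\<exists>i\<in>?J. d i \<noteq> 0) \<and>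
        (\<forall>k\<in>K. (\<Sum>i\<in>?J. d i * (c p k0 * c i k - c i k0 * c p k)) = 0)"
      using insert.prems insert.hyps p by (intro insert.IH) (auto intro!: polys_minus polys_mult)
    then obtain d where d: "\<And>i. i \<in> ?J \<Longrightarrow> d i \<in> polys Y" "\<exists>i\<in>?J. d i \<noteq> 0"
      "\<And>k. k \<in> K \<Longrightarrow> (\<Sum>i\<in>?J. d i * (c p k0 * c i k - c i k0 * c p k)) = 0" by blast
    define e where "e i = (if i = p then - (\<Sum>j\<in>?J. d j * c j k0) else c p k0 * d i)" for i
    have sum: "(\<Sum>i\<in>I. e i * c i k) = (\<Sum>i\<in>?J. d i * (c p k0 * c i k - c i k0 * c p k))" for k
    proof -
      have "(\<Sum>i\<in>I. e i * c i k) = e p * c p k + (\<Sum>i\<in>?J. e i * c i k)"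
        using p insert.prems(1) by (simp add: sum.remove)
      also have "(\<Sum>i\<in>?J. e i * c i k) = (\<Sum>i\<in>?J. c p k0 * d i * c i k)"
        by (intro sum.cong) (auto simp: e_def)
      also have "e p * c p k + \<dots> = (\<Sum>i\<in>?J. d i * (c p k0 * c i k - c i k0 * c p k))"
        by (simp add: e_def sum_distrib_left sum_distrib_right algebra_simps sum_subtractf sum_negf)
      finally show ?thesis .
    qed
    have "e i \<in> polys Y" if "i \<in> I" for i
      using that d(1) insert.prems p by (auto simp: e_def intro!: polys_uminus polys_sum polys_mult)
    moreover have "\<exists>i\<in>I. e i \<noteq> 0"
    proof -
      obtain i where "i \<in> ?J" "d i \<noteq> 0" using d(2) by blast
      then show ?thesis using p by (intro bexI[of _ i]) (auto simp: e_def mpoly_mult_eq_0_iff)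
    qed
    moreover have "(\<Sum>i\<in>I. e i * c i k) = 0" if "k \<in> insert k0 K" for k
    proof (cases "k = k0")
      case True
      then show ?thesis unfolding sum by (intro sum.neutral) (simp add: mult.commute)
    next
      case False
      then show ?thesis unfolding sum using that d(3) by blast
    qed
    ultimately show ?thesis by blast
  qed
qed

lemma power_minus_multiple:
  assumes "x \<in> polys Y" "t \<in> polys Y" "e \<in> polys Y"
  shows "\<exists>f\<in>polys Y. (x - t * e) ^ n = x ^ n - t * f"
proof (induction n)
  case (Suc n)
  then obtain f where f: "f \<in> polys Y" "(x - t * e) ^ n = x ^ n - t * f" by blast
  have "(x - t * e) ^ Suc n = x ^ Suc n - t * (x * f + e * (x ^ n - t * f))"
    unfolding power_Suc f(2) by (simp add: algebra_simps)
  moreover have "x * f + e * (x ^ n - t * f) \<in> polys Y"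
    using assms f by (intro polys_add polys_mult polys_minus polys_power)
  ultimately show ?case by blast
qed (auto intro: bexI[of _ 0])

text \<open>
  A substitute for the determinant trick.  The hypothesis says that \<open>u\<close> maps a finite module into its
  multiple by \<open>t\<close>, modulo \<open>P\<close>.  The equation of a generator \<open>v\<close> has the coefficient \<open>u - t c v v\<close> at \<open>v\<close>
  itself, so \<open>v\<close> can be eliminated from the other equations after multiplying them by this element.
  Modulo \<open>t\<close> the multiplier on the left stays a power of \<open>u\<close> throughout, and at the end a single
  generator \<open>w0\<close> is left.
\<close>

lemma eliminate_generators:
  fixes P :: "('v, 'k::comm_ring_1) mpoly set"
  assumes "finite V" "w0 \<notin> V" and P: "ideal P (mpoly_ring X)" and YX: "Y \<subseteq> X"
    and "u \<in> polys Y" and t: "t \<in> polys Y"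
    and "\<And>j k. j \<in> insert w0 V \<Longrightarrow> k \<in> insert w0 V \<Longrightarrow> c j k \<in> polys Y"
    and "\<And>j. j \<in> insert w0 V \<Longrightarrow> u * j - t * (\<Sum>k\<in>insert w0 V. c j k * k) \<in> P"
  shows "\<exists>n. \<exists>d\<in>polys Y. (u ^ n - t * d) * w0 \<in> P"
  using assms(1,2,5,7-)
proof (induction V arbitrary: u c)
  case empty
  have "(u ^ 1 - t * c w0 w0) * w0 \<in> P" using empty.prems(4)[of w0] by (simp add: algebra_simps)
  then show ?case using empty.prems(3)[of w0 w0] by blast
next
  case (insert v V)
  define v' where "v' = u - t * c v v"
  define c' where "c' j k = v' * c j k + t * c j v * c v k" for j k
  have v': "v' \<in> polys Y" using insert.prems t by (auto simp: v'_def intro!: polys_minus polys_mult)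
  have Y: "p \<in> polys X" if "p \<in> polys Y" for p using that YX polys_mono by blast
  let ?E = "\<lambda>j. u * j - t * (\<Sum>k\<in>insert w0 (insert v V). c j k * k)"
  have E: "?E j \<in> P" if "j \<in> insert w0 (insert v V)" for j using insert.prems(4)[OF that] .
  have vn: "v \<noteq> w0" "v \<notin> insert w0 V" using insert.prems(1) insert.hyps by auto
  have split: "(\<Sum>k\<in>insert w0 (insert v V). f k) = f v + (\<Sum>k\<in>insert w0 V. f k)" for f :: "_ \<Rightarrow> ('v, 'k) mpoly"
    using vn insert.hyps by (subst insert_commute) simp
  have "(u * v') * j - t * (\<Sum>k\<in>insert w0 V. c' j k * k) \<in> P" if j: "j \<in> insert w0 V" for j
  proof -
    let ?S = "\<lambda>i. \<Sum>k\<in>insert w0 V. c i k * k"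
    have S': "(\<Sum>k\<in>insert w0 V. c' j k * k) = v' * ?S j + t * c j v * ?S v"
      by (simp add: c'_def distrib_right sum.distrib sum_distrib_left mult.assoc del: sum.insert sum.insert_if)
    have "(u * v') * j - t * (\<Sum>k\<in>insert w0 V. c' j k * k) = v' * ?E j + (t * c j v) * ?E v"
      unfolding split S' by (simp add: v'_def algebra_simps del: sum.insert sum.insert_if)
    also have "\<dots> \<in> P"
      using j v' t insert.prems(3) by (intro ideal_add[OF P] ideal_mult[OF P] E Y polys_mult) auto
    finally show ?thesis .
  qed
  then have "\<exists>n. \<exists>d\<in>polys Y. ((u * v') ^ n - t * d) * w0 \<in> P"
    using insert.prems v' t by (intro insert.IH[of "u * v'" c']) (auto simp: c'_def intro!: polys_add polys_mult)
  then obtain n d where d: "d \<in> polys Y" "((u * v') ^ n - t * d) * w0 \<in> P" by blast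
  have "u * v' = u * u - t * (u * c v v)" by (simp add: v'_def algebra_simps)
  moreover obtain f where f: "f \<in> polys Y" "(u * u - t * (u * c v v)) ^ n = (u * u) ^ n - t * f"
    using power_minus_multiple[of "u * u" Y t "u * c v v" n] insert.prems t by (auto intro: polys_mult)
  ultimately have "(u * v') ^ n = u ^ (2 * n) - t * f"
    by (simp add: power_mult power2_eq_square)
  then have "(u * v') ^ n - t * d = u ^ (2 * n) - t * (f + d)" by (simp add: algebra_simps)
  then show ?case using d f by (metis polys_add)
qed


section \<open>Spanning modulo a prime ideal\<close>

text \<open>
  \<open>p\<close> lies in the \<open>K[Y]\<^sub>a\<close>-span of \<open>W\<close> modulo \<open>P\<close>, denominators being cleared by powers of \<open>a\<close>.
\<close>

definition spanned ::
    "'v set \<Rightarrow> ('v, 'k::comm_ring_1) mpoly \<Rightarrow> ('v, 'k) mpoly set \<Rightarrow> ('v, 'k) mpoly set \<Rightarrow> ('v, 'k) mpoly \<Rightarrow> bool" where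
  "spanned Y a P W p \<longleftrightarrow> (\<exists>N c. (\<forall>w\<in>W. c w \<in> polys Y) \<and> a ^ N * p - (\<Sum>w\<in>W. c w * w) \<in> P)"

lemma spanned_cancel:
  assumes "spanned Y a P W (a ^ N * p)" shows "spanned Y a P W p"
proof -
  obtain M c where "\<forall>w\<in>W. c w \<in> polys Y" "a ^ M * (a ^ N * p) - (\<Sum>w\<in>W. c w * w) \<in> P"
    using assms unfolding spanned_def by blast
  then show ?thesis unfolding spanned_def by (intro exI[of _ "M + N"]) (auto simp: power_add mult.assoc)
qed

context
  fixes X Y :: "'v set" and a :: "('v, 'k::comm_ring_1) mpoly" and P :: "('v, 'k) mpoly set"
  assumes P: "ideal P (mpoly_ring X)" and YX: "Y \<subseteq> X" and a: "a \<in> polys Y"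
begin

private lemma YtoX: "p \<in> polys Y \<Longrightarrow> p \<in> polys X"
  using YX polys_mono by blast

private lemma power_a: "a ^ N \<in> polys X" by (intro polys_power YtoX a)

lemma spanned_zero: "spanned Y a P W 0"
  unfolding spanned_def using ideal_zero[OF P] by (intro exI[of _ 0] exI[of _ "\<lambda>_. 0"]) auto

lemma spanned_base:
  assumes "finite W" "w \<in> W" shows "spanned Y a P W w"
proof -
  have "(\<Sum>v\<in>W. (if v = w then 1 else 0) * v) = (\<Sum>v\<in>W. if v = w then v else 0)"
    by (intro sum.cong) auto
  then have "(\<Sum>v\<in>W. (if v = w then 1 else 0) * v) = w" using assms by simp
  then show ?thesis unfolding spanned_def using ideal_zero[OF P]
    by (intro exI[of _ 0] exI[of _ "\<lambda>v. if v = w then 1 else 0"]) auto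
qed

lemma spanned_add:
  assumes "spanned Y a P W p" "spanned Y a P W q" shows "spanned Y a P W (p + q)"
proof -
  obtain N c M d where c: "\<forall>w\<in>W. c w \<in> polys Y" "a ^ N * p - (\<Sum>w\<in>W. c w * w) \<in> P"
    and d: "\<forall>w\<in>W. d w \<in> polys Y" "a ^ M * q - (\<Sum>w\<in>W. d w * w) \<in> P"
    using assms unfolding spanned_def by blast
  have "a ^ (N + M) * (p + q) - (\<Sum>w\<in>W. (a ^ M * c w + a ^ N * d w) * w) =
      a ^ M * (a ^ N * p - (\<Sum>w\<in>W. c w * w)) + a ^ N * (a ^ M * q - (\<Sum>w\<in>W. d w * w))"
    by (simp add: algebra_simps power_add sum.distrib sum_distrib_left)
  also have "\<dots> \<in> P" using c d power_a by (intro ideal_add[OF P] ideal_mult[OF P]) auto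
  finally show ?thesis unfolding spanned_def using c d a
    by (intro exI[of _ "N + M"] exI[of _ "\<lambda>w. a ^ M * c w + a ^ N * d w"])
      (auto intro!: polys_add polys_mult polys_power)
qed

lemma spanned_sum: "(\<And>i. i \<in> A \<Longrightarrow> spanned Y a P W (f i)) \<Longrightarrow> spanned Y a P W (sum f A)"
  by (induction A rule: infinite_finite_induct) (auto intro: spanned_add spanned_zero)

lemma spanned_scale:
  assumes "spanned Y a P W p" "b \<in> polys Y" shows "spanned Y a P W (b * p)"
proof -
  obtain N c where c: "\<forall>w\<in>W. c w \<in> polys Y" "a ^ N * p - (\<Sum>w\<in>W. c w * w) \<in> P"
    using assms unfolding spanned_def by blast
  have "a ^ N * (b * p) - (\<Sum>w\<in>W. (b * c w) * w) = b * (a ^ N * p - (\<Sum>w\<in>W. c w * w))"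
    by (simp add: algebra_simps sum_distrib_left)
  also have "\<dots> \<in> P" using c assms by (intro ideal_mult[OF P] YtoX)
  finally show ?thesis unfolding spanned_def using c assms
    by (intro exI[of _ "N"] exI[of _ "\<lambda>w. b * c w"]) (auto intro!: polys_mult)
qed

lemma spanned_cong:
  assumes "spanned Y a P W q" "p - q \<in> P" shows "spanned Y a P W p"
proof -
  obtain N c where c: "\<forall>w\<in>W. c w \<in> polys Y" "a ^ N * q - (\<Sum>w\<in>W. c w * w) \<in> P"
    using assms unfolding spanned_def by blast
  have "a ^ N * p - (\<Sum>w\<in>W. c w * w) = a ^ N * (p - q) + (a ^ N * q - (\<Sum>w\<in>W. c w * w))"
    by (simp add: algebra_simps)
  also have "\<dots> \<in> P" using c assms power_a by (intro ideal_add[OF P] ideal_mult[OF P])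
  finally show ?thesis unfolding spanned_def using c by blast
qed

text \<open>
  Multiplication by \<open>q\<close> maps the span of \<open>V\<close> into that of \<open>W\<close> as soon as it does so on \<open>V\<close>.
\<close>

lemma spanned_mult:
  assumes "spanned Y a P V p" "\<And>v. v \<in> V \<Longrightarrow> spanned Y a P W (v * q)" "q \<in> polys X"
  shows "spanned Y a P W (p * q)"
proof -
  obtain N c where c: "\<forall>w\<in>V. c w \<in> polys Y" "a ^ N * p - (\<Sum>w\<in>V. c w * w) \<in> P"
    using assms(1) unfolding spanned_def by blast
  have sp: "spanned Y a P W (\<Sum>w\<in>V. c w * (w * q))"
    using c assms(2) by (intro spanned_sum) (rule spanned_scale, auto)
  have "a ^ N * (p * q) - (\<Sum>w\<in>V. c w * (w * q)) = (a ^ N * p - (\<Sum>w\<in>V. c w * w)) * q"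
    by (simp add: algebra_simps sum_distrib_left sum_distrib_right)
  also have "\<dots> \<in> P" using c assms(3) by (intro ideal_mult_right[OF P])
  finally have "spanned Y a P W (a ^ N * (p * q))" by (rule spanned_cong[OF sp])
  then show ?thesis by (rule spanned_cancel)
qed

text \<open>
  The relation of \<open>x\<close> rewrites \<open>a x\<^sup>e\<close> in terms of lower powers of \<open>x\<close>.  So \<open>1, x, \<dots>, x\<^sup>e\<^sup>-\<^sup>1\<close> span all powers
  of \<open>x\<close>, and multiplying these by a spanning set for the earlier variables gives one that takes \<open>x\<close>
  into account as well.
\<close>

lemma spanned_by_finite:
  assumes "finite Z" "Z \<subseteq> X"
    and rel: "\<And>x. x \<in> Z \<Longrightarrow> \<exists>e>0. \<exists>c. (\<forall>i<e. c i \<in> polys Y) \<and> a * var x ^ e - (\<Sum>i<e. c i * var x ^ i) \<in> P"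
  shows "\<exists>W. finite W \<and> W \<subseteq> polys X \<and> 1 \<in> W \<and> (\<forall>p\<in>polys (Y \<union> Z). spanned Y a P W p)"
  using assms
proof (induction Z)
  case empty
  have "spanned Y a P {1} p" if "p \<in> polys Y" for p
    using spanned_scale[OF spanned_base[of "{1}" 1] that] by simp
  then show ?case by (intro exI[of _ "{1}"]) auto
next
  case (insert x Z)
  then obtain V where V: "finite V" "V \<subseteq> polys X" "1 \<in> V" "\<And>p. p \<in> polys (Y \<union> Z) \<Longrightarrow> spanned Y a P V p"
  proof -
    have "\<exists>V. finite V \<and> V \<subseteq> polys X \<and> 1 \<in> V \<and> (\<forall>p\<in>polys (Y \<union> Z). spanned Y a P V p)"
      by (intro insert.IH insert.prems(2) insertI2) (use insert.prems(1) in auto)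
    then show ?thesis using that by blast
  qed
  obtain e c where e: "e > 0" "\<And>i. i < e \<Longrightarrow> c i \<in> polys Y" "a * var x ^ e - (\<Sum>i<e. c i * var x ^ i) \<in> P"
    using insert.prems(2)[OF insertI1] by blast
  have x: "var x ^ i \<in> polys X" for i using insert.prems by (intro polys_power polys_var) auto
  let ?T = "(\<lambda>i. var x ^ i) ` {..<e}" and ?W = "(\<lambda>(v, i). v * var x ^ i) ` (V \<times> {..<e})"
  have T: "spanned Y a P ?T (var x ^ i)" for i
  proof (induction i)
    case 0
    show ?case by (rule spanned_base) (use e in \<open>auto intro: image_eqI[of _ _ 0]\<close>)
  next
    case (Suc i)
    have "spanned Y a P ?T (v * var x)" if v: "v \<in> ?T" for v
    proof -
      obtain j where j: "v = var x ^ j" "j < e" using v by auto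
      show ?thesis
      proof (cases "Suc j < e")
        case True
        then show ?thesis using j by (intro spanned_base) (auto intro: image_eqI[of _ _ "Suc j"] simp: mult.commute)
      next
        case False
        then have vx: "v * var x = var x ^ e" using j by (metis Suc_lessI mult.commute power_Suc)
        have "spanned Y a P ?T (\<Sum>i<e. c i * var x ^ i)"
          by (intro spanned_sum spanned_scale spanned_base e) auto
        then have "spanned Y a P ?T (a ^ 1 * (v * var x))" unfolding vx power_one_right
          by (rule spanned_cong) (rule e)
        then show ?thesis by (rule spanned_cancel)
      qed
    qed
    then have "spanned Y a P ?T (var x ^ i * var x)" using x[of 1] by (intro spanned_mult[OF Suc]) auto
    then show ?case by (simp add: mult.commute)
  qed
  have vx: "spanned Y a P ?W (v * var x ^ i)" if "v \<in> V" for v i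
  proof -
    have "spanned Y a P ?W (var x ^ i * v)"
    proof (rule spanned_mult[OF T])
      fix w :: "('v, 'k) mpoly" assume "w \<in> ?T"
      then show "spanned Y a P ?W (w * v)" using that V(1)
        by (intro spanned_base) (auto simp: image_iff mult.commute intro!: bexI[of _ v])
    qed (use that V in auto)
    then show ?thesis by (simp add: mult.commute)
  qed
  have "spanned Y a P ?W p" if p: "p \<in> polys (Y \<union> insert x Z)" for p
  proof -
    have "spanned Y a P ?W (coeff_in x j p * var x ^ j)" for j
    proof (rule spanned_mult[OF _ _ x])
      have "coeff_in x j p \<in> polys (Y \<union> Z)"
        by (rule coeff_in_polys_insert) (use p in \<open>simp add: Un_insert_right\<close>)
      then show "spanned Y a P V (coeff_in x j p)" by (rule V(4))
    qed (rule vx)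
    then have "spanned Y a P ?W (\<Sum>j\<le>degree_in x p. coeff_in x j p * var x ^ j)" by (intro spanned_sum)
    then show ?thesis using expand_in_degree[of p x] by simp
  qed
  moreover have "finite ?W" "?W \<subseteq> polys X" using V x by (auto intro!: polys_mult)
  moreover have "1 \<in> ?W" using V(3) e(1) by (intro image_eqI[of _ _ "(1, 0)"]) auto
  ultimately show ?case by blast
qed

end


section \<open>The dimension of an affine ring\<close>

abbreviation indep :: "('v, 'k::comm_ring_1) mpoly set \<Rightarrow> 'v set \<Rightarrow> bool" where
  "indep I Y \<equiv> I \<inter> polys Y \<subseteq> {0}"

lemma bchoice2: "(\<And>i. i \<in> A \<Longrightarrow> \<exists>x y. R i x y) \<Longrightarrow> \<exists>f g. \<forall>i\<in>A. R i (f i) (g i)"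
  by metis

text \<open>
  As \<open>Y\<close> cannot be enlarged, every further variable \<open>x\<close> satisfies a relation over \<open>K[Y]\<close> modulo \<open>P\<close>.
  The product \<open>a\<close> of the leading coefficients is a common denominator.
\<close>

lemma maximal_independent_spans:
  fixes P :: "('v, 'k::field) mpoly set"
  assumes P: "ideal P (mpoly_ring X)" and X: "finite X" and Y: "Y \<subseteq> X" "indep P Y"
    and max: "\<And>Y'. Y' \<subseteq> X \<Longrightarrow> indep P Y' \<Longrightarrow> card Y' \<le> card Y"
  shows "\<exists>a W. a \<in> polys Y \<and> a \<noteq> 0 \<and> finite W \<and> W \<subseteq> polys X \<and> 1 \<in> W \<and>
    (\<forall>p\<in>polys X. spanned Y a P W p)"
proof -
  have finY: "finite Y" using X Y(1) finite_subset by blast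
  have "\<exists>g. g \<in> P \<and> g \<in> polys (insert x Y) \<and> g \<noteq> 0" if "x \<in> X - Y" for x
  proof -
    have "\<not> indep P (insert x Y)"
      using max[of "insert x Y"] that Y(1) finY by auto
    then show ?thesis by auto
  qed
  then obtain g where g: "\<And>x. x \<in> X - Y \<Longrightarrow> g x \<in> P" "\<And>x. x \<in> X - Y \<Longrightarrow> g x \<in> polys (insert x Y)"
    "\<And>x. x \<in> X - Y \<Longrightarrow> g x \<noteq> 0" by metis
  define l where "l x = lead_coeff_in x (g x)" for x
  define a where "a = (\<Prod>x\<in>X - Y. l x)"
  have cY: "coeff_in x j (g x) \<in> polys Y" if "x \<in> X - Y" for x j
    using g(2)[OF that] by (rule coeff_in_polys_insert)
  have l: "l x \<in> polys Y" "l x \<noteq> 0" if "x \<in> X - Y" for x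
    using cY[OF that] lead_coeff_in_nonzero[OF g(3)[OF that]] by (simp_all add: l_def lead_coeff_in_def)
  have a: "a \<in> polys Y" "a \<noteq> 0" unfolding a_def using l by (auto intro!: polys_prod mpoly_prod_nonzero)
  have "\<exists>e>0. \<exists>c. (\<forall>i<e. c i \<in> polys Y) \<and> a * var x ^ e - (\<Sum>i<e. c i * var x ^ i) \<in> P" if x: "x \<in> X - Y" for x
  proof -
    define e where "e = degree_in x (g x)"
    define b where "b = (\<Prod>z\<in>X - Y - {x}. l z)"
    have b: "b \<in> polys Y" unfolding b_def using l by (auto intro!: polys_prod)
    have ab: "a = b * l x" unfolding a_def b_def using x X by (simp add: prod.remove mult.commute)
    have gx: "g x = (\<Sum>i<e. coeff_in x i (g x) * var x ^ i) + l x * var x ^ e"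
    proof -
      have "g x = (\<Sum>i\<le>e. coeff_in x i (g x) * var x ^ i)" unfolding e_def by (rule expand_in_degree)
      also have "\<dots> = (\<Sum>i<e. coeff_in x i (g x) * var x ^ i) + coeff_in x e (g x) * var x ^ e"
        by (simp add: lessThan_Suc_atMost[symmetric])
      finally show ?thesis by (simp add: l_def lead_coeff_in_def e_def)
    qed
    have "e > 0"
    proof (rule ccontr)
      assume "\<not> e > 0"
      then have "g x = l x" using gx by simp
      then show False using l[OF x] g(1)[OF x] Y(2) by auto
    qed
    moreover have rel: "a * var x ^ e - (\<Sum>i<e. (- b * coeff_in x i (g x)) * var x ^ i) = b * g x"
      unfolding ab by (subst (2) gx) (simp add: algebra_simps sum_distrib_left sum_negf)
    moreover have "b * g x \<in> P" using b Y(1) polys_mono g(1)[OF x] by (intro ideal_mult[OF P]) blast+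
    moreover have "- b * coeff_in x i (g x) \<in> polys Y" for i
      using b cY[OF x] by (intro polys_mult polys_uminus)
    ultimately show ?thesis
      by (intro exI[of _ e] exI[of _ "\<lambda>i. - b * coeff_in x i (g x)"] conjI allI impI) (simp_all only: rel)
  qed
  from spanned_by_finite[OF P Y(1) a(1), of "X - Y", OF _ _ this]
  obtain W where "finite W" "W \<subseteq> polys X" "1 \<in> W" "\<forall>p\<in>polys (Y \<union> (X - Y)). spanned Y a P W p"
    using X by auto
  moreover have "Y \<union> (X - Y) = X" using Y(1) by auto
  ultimately show ?thesis using a by auto
qed

text \<open>
  Transcendence degree drops along a strict inclusion of primes: if \<open>Y\<close> were a transcendence
  basis modulo both, an element of \<open>Q - P\<close> would be algebraic over \<open>K(Y)\<close>, and the constant term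
  of a relation, cleared of its factor \<open>f ^ i\<close>, would be a nonzero element of \<open>Q\<close> in \<open>K[Y]\<close>.
\<close>

lemma independent_grows:
  fixes P Q :: "('v, 'k::field) mpoly set"
  assumes P: "primeideal P (mpoly_ring X)" and Q: "ideal Q (mpoly_ring X)" and PQ: "P \<subset> Q"
    and X: "finite X" and Y: "Y \<subseteq> X" "indep Q Y"
  shows "\<exists>Y'\<subseteq>X. indep P Y' \<and> card Y < card Y'"
proof (rule ccontr)
  assume contr: "\<not> ?thesis"
  have PI: "ideal P (mpoly_ring X)" using P by (rule prime_ideal)
  have YP: "indep P Y" using Y(2) PQ by blast
  have YX: "p \<in> polys X" if "p \<in> polys Y" for p :: "('v, 'k) mpoly"
    using that Y(1) polys_mono by blast
  have max: "card Y' \<le> card Y" if "Y' \<subseteq> X" "indep P Y'" for Y'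
    using contr that by (meson linorder_not_less)
  obtain a W where aW: "a \<in> polys Y" "a \<noteq> 0" "finite W" "W \<subseteq> polys X" "\<forall>p\<in>polys X. spanned Y a P W p"
    using maximal_independent_spans[OF PI X Y(1) YP max] by blast
  obtain f where f: "f \<in> Q" "f \<notin> P" using PQ by blast
  have fX: "f ^ i \<in> polys X" for i using f(1) ideal_subset[OF Q] by (intro polys_power) auto
  have ex: "\<exists>N c. (\<forall>w\<in>W. c w \<in> polys Y) \<and> a ^ N * f ^ i - (\<Sum>w\<in>W. c w * w) \<in> P" for i
    using aW(5)[rule_format, OF fX] unfolding spanned_def by blast
  have "\<exists>N c. \<forall>i\<in>UNIV. (\<forall>w\<in>W. c i w \<in> polys Y) \<and> a ^ N i * f ^ i - (\<Sum>w\<in>W. c i w * w) \<in> P"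
    by (rule bchoice2) (rule ex)
  then obtain N c where c': "\<forall>i\<in>UNIV. (\<forall>w\<in>W. c i w \<in> polys Y) \<and> a ^ N i * f ^ i - (\<Sum>w\<in>W. c i w * w) \<in> P"
    by (elim exE) (rule that)
  then have c: "\<And>i w. w \<in> W \<Longrightarrow> c i w \<in> polys Y"
    "\<And>i. a ^ N i * f ^ i - (\<Sum>w\<in>W. c i w * w) \<in> P" by simp_all
  let ?I = "{..card W}"
  have "\<exists>d. (\<forall>i\<in>?I. d i \<in> polys Y) \<and> (\<exists>i\<in>?I. d i \<noteq> 0) \<and> (\<forall>w\<in>W. (\<Sum>i\<in>?I. d i * c i w) = 0)"
    using aW(3) c(1) by (intro polys_linear_dependence) auto
  then obtain d where d': "\<forall>i\<in>?I. d i \<in> polys Y" "\<exists>i\<in>?I. d i \<noteq> 0" "\<forall>w\<in>W. (\<Sum>i\<in>?I. d i * c i w) = 0"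
    by (elim exE conjE) (rule that)
  note d = d'(1)[rule_format] d'(2) d'(3)[rule_format]
  define b where "b i = d i * a ^ N i" for i
  have b: "b i \<in> polys Y" if "i \<in> ?I" for i
    unfolding b_def using d(1)[OF that] aW(1) by (intro polys_mult polys_power)
  have "(\<Sum>i\<in>?I. b i * f ^ i) = (\<Sum>i\<in>?I. d i * (a ^ N i * f ^ i - (\<Sum>w\<in>W. c i w * w)))"
  proof -
    have "(\<Sum>i\<in>?I. d i * (\<Sum>w\<in>W. c i w * w)) = (\<Sum>w\<in>W. (\<Sum>i\<in>?I. d i * c i w) * w)"
      unfolding sum_distrib_left sum_distrib_right mult.assoc by (rule sum.swap)
    also have "\<dots> = 0" using d(3) by (intro sum.neutral) simp
    finally show ?thesis by (simp add: b_def algebra_simps sum_subtractf)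
  qed
  also have "\<dots> \<in> P" using c(2) d(1) YX by (intro ideal_sum[OF PI] ideal_mult[OF PI]) auto
  finally have rel: "(\<Sum>i\<in>?I. b i * f ^ i) \<in> P" .
  define k where "k = (LEAST i. i \<in> ?I \<and> b i \<noteq> 0)"
  have "\<exists>i. i \<in> ?I \<and> b i \<noteq> 0"
    using d(2) aW(2) by (auto simp: b_def mpoly_mult_eq_0_iff mpoly_power_nonzero)
  then have k: "k \<in> ?I" "b k \<noteq> 0" unfolding k_def using LeastI_ex[of "\<lambda>i. i \<in> ?I \<and> b i \<noteq> 0"] by auto
  have small: "b i = 0" if "i < k" for i
    using not_less_Least[of i "\<lambda>i. i \<in> ?I \<and> b i \<noteq> 0"] that k(1) unfolding k_def[symmetric] by auto
  define h where "h = (\<Sum>i\<in>{Suc k..card W}. b i * f ^ (i - Suc k))"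
  have h: "h \<in> polys X" unfolding h_def using b YX fX by (intro polys_sum polys_mult) auto
  have "(\<Sum>i\<in>?I. b i * f ^ i) = (\<Sum>i\<in>{k..card W}. b i * f ^ i)"
    using small by (intro sum.mono_neutral_right) (auto simp: not_le)
  also have "\<dots> = b k * f ^ k + (\<Sum>i\<in>{Suc k..card W}. b i * f ^ i)"
    using k(1) by (simp add: sum.atLeast_Suc_atMost)
  also have "(\<Sum>i\<in>{Suc k..card W}. b i * f ^ i) = f ^ k * (f * h)"
    unfolding h_def sum_distrib_left
  proof (intro sum.cong refl)
    fix i assume "i \<in> {Suc k..card W}"
    then have "f ^ i = f ^ k * (f * f ^ (i - Suc k))"
      by (metis Suc_le_D add_Suc_right atLeastAtMost_iff diff_add_inverse le_add_diff_inverse power_Suc power_add plus_nat.simps(2))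
    then show "b i * f ^ i = f ^ k * (f * (b i * f ^ (i - Suc k)))" by (simp add: algebra_simps)
  qed
  finally have "f ^ k * (b k + f * h) \<in> P" using rel by (simp add: algebra_simps)
  moreover have "f ^ k \<notin> P" using prime_power[OF P] f(2) fX[of 1] by auto
  ultimately have "b k + f * h \<in> Q"
    using prime_mult[OF P _ fX] YX[OF b[OF k(1)]] h fX[of 1] PQ by (auto intro: polys_add polys_mult)
  moreover have "f * h \<in> Q" using f h by (intro ideal_mult_right[OF Q])
  ultimately have "b k \<in> Q" using ideal_add_cancel[OF Q] by blast
  then show False using Y(2) b[OF k(1)] k(2) by blast
qed

text \<open>
  The prime \<open>Q\<close> is to contain \<open>t = 1 + y a\<close>, where \<open>a\<close> is the common denominator above, so it must be seen
  that \<open>P + \<langle>t\<rangle>\<close> contains no nonzero \<open>s\<close> in \<open>K[Y - y]\<close>.  Let \<open>s\<close> agree with \<open>t h\<close> modulo \<open>P\<close>.  Multiplication by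
  \<open>h\<close> preserves the finite module spanned by \<open>W\<close> up to powers of \<open>a\<close>, so eliminating generators makes a
  power of \<open>s a\<^sup>M\<close> a multiple of \<open>t\<close>, first modulo \<open>P\<close> and then, by independence, in \<open>K[Y]\<close>.  Modulo \<open>t\<close> the
  element \<open>a\<close> has the inverse \<open>- y\<close>, so \<open>t\<close> divides a power of \<open>s\<close> itself.  But \<open>t\<close> has positive degree in
  \<open>y\<close> and \<open>s\<close> does not involve \<open>y\<close>.
\<close>

lemma exists_prime_above:
  fixes P :: "('v, 'k::field) mpoly set"
  assumes P: "primeideal P (mpoly_ring X)" and X: "finite X" and Y: "Y \<subseteq> X" "indep P Y"
    and max: "\<And>Y'. Y' \<subseteq> X \<Longrightarrow> indep P Y' \<Longrightarrow> card Y' \<le> card Y" and y: "y \<in> Y"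
  obtains Q where "primeideal Q (mpoly_ring X)" "P \<subset> Q" "indep Q (Y - {y})"
proof -
  have PI: "ideal P (mpoly_ring X)" using P by (rule prime_ideal)
  have YX: "p \<in> polys X" if "p \<in> polys Y" for p :: "('v, 'k) mpoly"
    using that Y(1) polys_mono by blast
  obtain a W where aW: "a \<in> polys Y" "a \<noteq> 0" "finite W" "W \<subseteq> polys X" "1 \<in> W" "\<forall>p\<in>polys X. spanned Y a P W p"
    using maximal_independent_spans[OF PI X Y max] by blast
  define t where "t = 1 + var y * a"
  have t: "t \<in> polys Y" unfolding t_def using aW(1) y by (intro polys_add polys_mult polys_var) auto
  let ?S = "polys (Y - {y}) - {0 :: ('v, 'k) mpoly}"
  have SY: "s \<in> polys Y" if "s \<in> polys (Y - {y})" for s :: "('v, 'k) mpoly"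
    using that polys_mono[of "Y - {y}" Y] by blast
  have ct: "coeff_in y (Suc (degree_in y a)) t \<noteq> 0" "\<And>i. Suc (degree_in y a) < i \<Longrightarrow> coeff_in y i t = 0"
  proof -
    have one: "coeff_in y i (1 :: ('v, 'k) mpoly) = (if i = 0 then 1 else 0)" for i
      using coeff_in_free[of 1 "{}" y i] by simp
    have "coeff_in y i t = (if i = 0 then 1 else coeff_in y (i - 1) a)" for i
      using coeff_in_mult_var[of y i a 1] unfolding t_def coeff_in_add one
      by (auto simp: mult.commute)
    then show "coeff_in y (Suc (degree_in y a)) t \<noteq> 0" "\<And>i. Suc (degree_in y a) < i \<Longrightarrow> coeff_in y i t = 0"
      using lead_coeff_in_nonzero[OF aW(2), of y] by (auto simp: lead_coeff_in_def intro: degree_in_less)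
  qed
  have not_multiple: "s \<noteq> t * d" if "s \<in> ?S" for s d
  proof
    assume e: "s = t * d"
    then have "d \<noteq> 0" using that by auto
    then have "coeff_in y (Suc (degree_in y a) + degree_in y d) (t * d) \<noteq> 0"
      using ct(1) lead_coeff_in_nonzero[of d y]
      by (subst coeff_in_mult_top[OF ct(2) degree_in_less]) (simp_all add: lead_coeff_in_def mpoly_mult_eq_0_iff)
    moreover have "coeff_in y (Suc (degree_in y a) + degree_in y d) s = 0"
      using coeff_in_free[of s "Y - {y}" y] that by auto
    ultimately show False using e by simp
  qed
  have tP: "t \<notin> P"
    using ct(1) Y(2) t by auto
  have sub: "insert t P \<subseteq> polys X" using ideal_subset[OF PI] YX[OF t] by blast
  let ?I = "gen X (insert t P)"
  have "?I \<inter> ?S = {}"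
  proof (rule ccontr)
    assume "?I \<inter> ?S \<noteq> {}"
    then obtain s where "s \<in> ?I" and s: "s \<in> ?S" by blast
    then obtain p h where ph: "p \<in> P" "h \<in> polys X" "s = p + h * t"
      using gen_insert_mem_iff[OF PI YX[OF t]] by blast
    have ex: "\<exists>N c. (\<forall>w\<in>W. c w \<in> polys Y) \<and> a ^ N * (h * v) - (\<Sum>w\<in>W. c w * w) \<in> P" if "v \<in> W" for v
      using aW(6)[rule_format, of "h * v"] ph(2) aW(4) that unfolding spanned_def by (auto intro: polys_mult)
    have "\<exists>N c. \<forall>v\<in>W. (\<forall>w\<in>W. c v w \<in> polys Y) \<and> a ^ N v * (h * v) - (\<Sum>w\<in>W. c v w * w) \<in> P"
      by (rule bchoice2) (rule ex)
    then obtain N c where c': "\<forall>v\<in>W. (\<forall>w\<in>W. c v w \<in> polys Y) \<and> a ^ N v * (h * v) - (\<Sum>w\<in>W. c v w * w) \<in> P"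
      by (elim exE) (rule that)
    then have c: "\<And>v w. v \<in> W \<Longrightarrow> w \<in> W \<Longrightarrow> c v w \<in> polys Y"
      "\<And>v. v \<in> W \<Longrightarrow> a ^ N v * (h * v) - (\<Sum>w\<in>W. c v w * w) \<in> P" by simp_all
    define M where "M = Max (N ` W)"
    have NM: "N v \<le> M" if "v \<in> W" for v unfolding M_def using aW(3) that by (intro Max_ge) auto
    define e where "e v w = a ^ (M - N v) * c v w" for v w
    have e: "e v w \<in> polys Y" if "v \<in> W" "w \<in> W" for v w
      unfolding e_def using c(1)[OF that] aW(1) by (intro polys_mult polys_power)
    define u where "u = s * a ^ M"
    have u: "u \<in> polys Y" unfolding u_def using s SY aW(1) by (intro polys_mult polys_power) auto
    have "u * v - t * (\<Sum>w\<in>W. e v w * w) \<in> P" if v: "v \<in> W" for v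
    proof -
      have r: "a ^ M * v \<in> polys X" "t * a ^ (M - N v) \<in> polys X"
        using v aW(4) YX[OF aW(1)] YX[OF t] by (auto intro!: polys_mult polys_power)
      have "a ^ M = a ^ (M - N v) * a ^ N v" using NM[OF v] by (simp add: power_add[symmetric])
      then have "u * v - t * (\<Sum>w\<in>W. e v w * w) =
          (a ^ M * v) * p + (t * a ^ (M - N v)) * (a ^ N v * (h * v) - (\<Sum>w\<in>W. c v w * w))"
        unfolding u_def ph(3) e_def by (simp add: algebra_simps sum_distrib_left)
      also have "\<dots> \<in> P"
        by (rule ideal_add[OF PI ideal_mult[OF PI r(1) ph(1)] ideal_mult[OF PI r(2) c(2)[OF v]]])
      finally show ?thesis .
    qed
    then have "\<exists>n. \<exists>d\<in>polys Y. (u ^ n - t * d) * 1 \<in> P"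
      using aW(3,5) u t e by (intro eliminate_generators[of "W - {1}" 1 P X Y u t e] PI Y(1)) (auto simp: insert_absorb)
    then obtain n d where d: "d \<in> polys Y" "u ^ n - t * d \<in> P" by auto
    have "u ^ n - t * d \<in> polys Y" using u t d(1) by (intro polys_minus polys_power polys_mult)
    then have ud: "u ^ n = t * d" using d(2) Y(2) by auto
    define m where "m = M * n"
    obtain f where f: "(t - 1) ^ m = t * f + (- 1) ^ m"
    proof -
      have "\<exists>f\<in>polys Y. ((- 1) - t * (- 1)) ^ m = (- 1) ^ m - t * f"
        using t by (intro power_minus_multiple polys_uminus polys_one)
      then obtain f where "(t - 1) ^ m = (- 1) ^ m - t * f" by (auto simp: add.commute)
      then show ?thesis using that[of "- f"] by simp
    qed
    have "s ^ n * (t * f + (- 1) ^ m) = s ^ n * (var y * a) ^ m"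
      using f by (simp add: t_def)
    also have "\<dots> = var y ^ m * u ^ n"
      by (simp add: u_def m_def power_mult_distrib power_mult mult_ac)
    finally have *: "s ^ n * (- 1) ^ m = t * (var y ^ m * d - s ^ n * f)"
      unfolding ud by (simp add: algebra_simps)
    have "(- 1) ^ m * (- 1) ^ m = (1 :: ('v, 'k) mpoly)" by (simp add: power_mult_distrib[symmetric])
    then have "s ^ n = s ^ n * (- 1) ^ m * (- 1) ^ m" by (simp only: mult.assoc mult_1_right)
    also have "\<dots> = t * ((var y ^ m * d - s ^ n * f) * (- 1) ^ m)" unfolding * by (simp only: mult.assoc)
    finally have "s ^ n = t * ((var y ^ m * d - s ^ n * f) * (- 1) ^ m)" .
    moreover have "s ^ n \<in> ?S" using s by (auto intro: polys_power simp: mpoly_power_nonzero)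
    ultimately show False using not_multiple by blast
  qed
  moreover have "1 \<in> ?S" by simp
  moreover have "s * s' \<in> ?S" if "s \<in> ?S" "s' \<in> ?S" for s s'
    using that by (auto simp: mpoly_mult_eq_0_iff intro: polys_mult)
  moreover have "?S \<subseteq> polys X" using SY YX by blast
  ultimately obtain Q where Q: "primeideal Q (mpoly_ring X)" "?I \<subseteq> Q" "Q \<inter> ?S = {}"
    using exists_prime_avoiding[OF gen_ideal[OF sub], of ?S] by metis
  have "P \<subseteq> Q" "t \<in> Q" using gen_superset[OF sub] Q(2) by auto
  then show ?thesis using that Q tP by blast
qed

text \<open>
  Each step gives up one variable, and by \<open>independent_grows\<close> a largest independent set modulo the
  next prime is exactly one smaller.
\<close>

lemma exists_prime_chain:
  fixes P :: "('v, 'k::field) mpoly set"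
  assumes X: "finite X"
  shows "primeideal P (mpoly_ring X) \<Longrightarrow> Y \<subseteq> X \<Longrightarrow> indep P Y \<Longrightarrow>
    (\<And>Y'. Y' \<subseteq> X \<Longrightarrow> indep P Y' \<Longrightarrow> card Y' \<le> card Y) \<Longrightarrow>
    \<exists>Q. (\<forall>i\<le>card Y. primeideal (Q i) (mpoly_ring X) \<and> P \<subseteq> Q i) \<and> (\<forall>i<card Y. Q i \<subset> Q (Suc i))"
proof (induction "card Y" arbitrary: P Y)
  case 0
  then show ?case by (intro exI[of _ "\<lambda>_. P"]) simp
next
  case (Suc n)
  then obtain y where y: "y \<in> Y" by fastforce
  obtain Q where Q: "primeideal Q (mpoly_ring X)" "P \<subset> Q" "indep Q (Y - {y})"
    using exists_prime_above[OF Suc.prems(1) X Suc.prems(2,3,4) y] by blast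
  have n: "card (Y - {y}) = n" using Suc.hyps(2) y by simp
  have "card Y' \<le> card (Y - {y})" if Y': "Y' \<subseteq> X" "indep Q Y'" for Y'
  proof -
    obtain Z where "Z \<subseteq> X" "indep P Z" "card Y' < card Z"
      using independent_grows[OF Suc.prems(1) prime_ideal[OF Q(1)] Q(2) X Y'] by blast
    then show ?thesis using Suc.prems(4)[of Z] Suc.hyps(2) n by simp
  qed
  then obtain R where R: "\<And>i. i \<le> n \<Longrightarrow> primeideal (R i) (mpoly_ring X) \<and> Q \<subseteq> R i" "\<And>i. i < n \<Longrightarrow> R i \<subset> R (Suc i)"
    using Suc.hyps(1)[OF n[symmetric] Q(1) _ Q(3)] Suc.prems(2) unfolding n by blast
  define T where "T i = (case i of 0 \<Rightarrow> P | Suc j \<Rightarrow> R j)" for i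
  have "primeideal (T i) (mpoly_ring X) \<and> P \<subseteq> T i" if "i \<le> Suc n" for i
    using that R(1) Q(2) Suc.prems(1) by (cases i) (auto simp: T_def)
  moreover have "T i \<subset> T (Suc i)" if "i < Suc n" for i
    using that psubset_subset_trans[OF Q(2)] R(1)[of 0] R(2) by (cases i) (auto simp: T_def)
  ultimately show ?case unfolding Suc.hyps(2)[symmetric] by blast
qed

text \<open>
  A nonzero constant is a unit.
\<close>

lemma indep_empty:
  fixes I :: "('v, 'k::field) mpoly set"
  assumes I: "ideal I (mpoly_ring X)" and one: "1 \<notin> I"
  shows "indep I {}"
proof
  fix p assume p: "p \<in> I \<inter> polys {}"
  have pc: "p = single 0 (lookup p 0)"
  proof (rule poly_mapping_eqI)
    fix m show "lookup p m = lookup (single 0 (lookup p 0)) m"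
      using p by (cases "m = 0") (auto simp: polys_iff monomials_def lookup_single when_def)
  qed
  show "p \<in> {0}"
  proof (rule ccontr)
    assume "p \<notin> {0}"
    then have "lookup p 0 \<noteq> 0" using pc by (metis insert_iff single_zero)
    then have "single 0 (inverse (lookup p 0)) * p = 1" by (subst (2) pc) (simp add: mult_single)
    moreover have "single 0 (inverse (lookup p 0)) * p \<in> I"
      using p by (intro ideal_mult[OF I] polys_single) auto
    ultimately show False using one by auto
  qed
qed

text \<open>
  Going down a chain of primes above \<open>I\<close>, each step allows a larger independent set, which is then
  independent modulo \<open>I\<close> too.  Conversely, if \<open>Y\<close> is independent modulo \<open>I\<close>, a prime above \<open>I\<close> that avoids
  \<open>K[Y] - 0\<close> is the bottom of a chain of length at least \<open>card Y\<close>.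
\<close>

theorem krull_dim_affine:
  fixes I :: "('v, 'k::field) mpoly set"
  assumes X: "finite X" and I: "ideal I (mpoly_ring X)"
  shows "krull_dim (mpoly_ring X Quot I) = Sup {enat (card Y) | Y. Y \<subseteq> X \<and> indep I Y}"
proof -
  interpret R: cring "mpoly_ring X :: ('v, 'k) mpoly ring" by (rule cring_mpoly_ring)
  let ?C = "{enat n | n. \<exists>P. (\<forall>i\<le>n. primeideal (P i) (mpoly_ring X) \<and> I \<subseteq> P i) \<and> (\<forall>i<n. P i \<subset> P (Suc i))}"
  let ?D = "{enat (card Y) | Y. Y \<subseteq> X \<and> indep I Y}"
  have "\<exists>d'\<in>?D. d \<le> d'" if dC: "d \<in> ?C" for d
  proof -
    obtain n P where d: "d = enat n" and P': "\<forall>i\<le>n. primeideal (P i) (mpoly_ring X) \<and> I \<subseteq> P i"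
      "\<forall>i<n. P i \<subset> P (Suc i)" using dC by blast
    note P = P'[rule_format]
    have "\<exists>Y\<subseteq>X. indep (P (n - i)) Y \<and> i \<le> card Y" if "i \<le> n" for i
      using that
    proof (induction i)
      case 0
      have "indep (P n) {}" using P(1)[of n] indep_empty[OF prime_ideal prime_one, of "P n" X] by auto
      then show ?case by (intro exI[of _ "{}"]) auto
    next
      case (Suc i)
      then obtain Y where Y: "Y \<subseteq> X" "indep (P (n - i)) Y" "i \<le> card Y" by auto
      have *: "Suc (n - Suc i) = n - i" using Suc.prems by simp
      obtain Z where "Z \<subseteq> X" "indep (P (n - Suc i)) Z" "card Y < card Z"
        using independent_grows[OF _ prime_ideal _ X Y(1,2), of "P (n - Suc i)"] P(1)[of "n - i"] P(1)[of "n - Suc i"]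
          P(2)[of "n - Suc i"] Suc.prems unfolding * by auto
      then show ?case using Y(3) by (intro exI[of _ Z]) auto
    qed
    from this[of n] obtain Y where Y: "Y \<subseteq> X" "indep (P 0) Y" "n \<le> card Y" by auto
    then have "indep I Y" using P(1)[of 0] by auto
    then show ?thesis using Y d by (intro bexI[of _ "enat (card Y)"]) auto
  qed
  moreover have "\<exists>d'\<in>?C. d \<le> d'" if dD: "d \<in> ?D" for d
  proof -
    obtain Y where d: "d = enat (card Y)" and Y: "Y \<subseteq> X" "indep I Y" using dD by blast
    let ?S = "polys Y - {0 :: ('v, 'k) mpoly}"
    obtain P where P: "primeideal P (mpoly_ring X)" "I \<subseteq> P" "P \<inter> ?S = {}"
    proof (rule exists_prime_avoiding[OF I, of ?S])
      show "?S \<subseteq> polys X" using polys_mono[OF Y(1)] by blast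
      show "s * t \<in> ?S" if "s \<in> ?S" "t \<in> ?S" for s t
        using that by (auto simp: mpoly_mult_eq_0_iff intro: polys_mult)
    qed (use Y in auto)
    then have YP: "indep P Y" by blast
    let ?A = "{Z. Z \<subseteq> X \<and> indep P Z}"
    have fin: "finite ?A" using X by (rule finite_subset[OF _ finite_Pow_iff[THEN iffD2], rotated]) auto
    obtain Z where Z: "Z \<in> ?A" "\<And>Z'. Z' \<in> ?A \<Longrightarrow> card Z' \<le> card Z"
    proof -
      have ne: "?A \<noteq> {}" using YP Y by blast
      have "Max (card ` ?A) \<in> card ` ?A" using fin ne by (intro Max_in) auto
      then obtain Z where Z: "Z \<in> ?A" "Max (card ` ?A) = card Z" by (elim imageE)
      have "card Z' \<le> card Z" if "Z' \<in> ?A" for Z'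
        unfolding Z(2)[symmetric] using fin that by (intro Max_ge) auto
      then show ?thesis using Z(1) by (rule that[rotated])
    qed
    have "\<exists>Q. (\<forall>i\<le>card Z. primeideal (Q i) (mpoly_ring X) \<and> P \<subseteq> Q i) \<and> (\<forall>i<card Z. Q i \<subset> Q (Suc i))"
      by (rule exists_prime_chain[OF X P(1)]) (use Z in auto)
    then obtain Q where Q: "\<forall>i\<le>card Z. primeideal (Q i) (mpoly_ring X) \<and> P \<subseteq> Q i" "\<forall>i<card Z. Q i \<subset> Q (Suc i)"
      by (elim exE conjE) (rule that)
    have "\<forall>i\<le>card Z. primeideal (Q i) (mpoly_ring X) \<and> I \<subseteq> Q i" using Q(1) P(2) by auto
    then have "enat (card Z) \<in> ?C" using Q(2)
      by (intro CollectI exI[of _ "card Z"] exI[of _ Q] conjI refl)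
    moreover have "d \<le> enat (card Z)" using d Z(2)[of Y] Y(1) YP by auto
    ultimately show ?thesis by blast
  qed
  ultimately have "Sup ?C = Sup ?D" by (intro antisym Sup_mono)
  then show ?thesis using R.krull_dim_Quot[OF I] by simp
qed


section \<open>Extension of an ideal by one variable\<close>

text \<open>
  For an ideal \<open>I\<close> of \<open>K[X]\<close> and a variable \<open>z\<close> outside \<open>X\<close> this is the ideal that \<open>I\<close> generates in
  \<open>K[X, z]\<close>, see \<open>ext_gen\<close>; the coefficientwise description makes membership a matter of \<open>K[X]\<close>.
\<close>

definition ext :: "'v \<Rightarrow> ('v, 'k::comm_ring_1) mpoly set \<Rightarrow> ('v, 'k) mpoly set" where
  "ext z I = {p. \<forall>j. coeff_in z j p \<in> I}"

lemma extI: "(\<And>j. coeff_in z j p \<in> I) \<Longrightarrow> p \<in> ext z I"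
  and extD: "p \<in> ext z I \<Longrightarrow> coeff_in z j p \<in> I"
  by (auto simp: ext_def)

context
  fixes X :: "'v set" and z :: 'v and I :: "('v, 'k::comm_ring_1) mpoly set"
  assumes I: "ideal I (mpoly_ring X)" and z: "z \<notin> X"
begin

lemma ext_polys: "ext z I \<subseteq> polys (insert z X)"
proof
  fix p assume p: "p \<in> ext z I"
  have "coeff_in z j p \<in> polys (insert z X)" for j
    using extD[OF p, of j] ideal_subset[OF I] polys_mono[of X "insert z X"] by auto
  then have "(\<Sum>j\<le>degree_in z p. coeff_in z j p * var z ^ j) \<in> polys (insert z X)"
    by (intro polys_sum polys_mult polys_power polys_var) auto
  then show "p \<in> polys (insert z X)" using expand_in_degree[of p z] by simp
qed

lemma ext_free: "p \<in> polys X \<Longrightarrow> p \<in> ext z I \<longleftrightarrow> p \<in> I"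
  using coeff_in_free[of p X z] z ideal_zero[OF I] unfolding ext_def by (auto split: if_splits)

lemma ext_superset: "I \<subseteq> ext z I"
  using ideal_subset[OF I] ext_free by blast

lemma ext_contraction: "ext z I \<inter> polys X = I"
  using ideal_subset[OF I] ext_free by blast

lemma ext_ideal: "ideal (ext z I) (mpoly_ring (insert z X))"
  unfolding ideal_mpoly_iff
proof (intro conjI ballI ext_polys)
  show "0 \<in> ext z I" using ideal_zero[OF I] by (auto simp: ext_def)
  show "p + q \<in> ext z I" if "p \<in> ext z I" "q \<in> ext z I" for p q
    using that by (auto simp: ext_def coeff_in_add intro: ideal_add[OF I])
  show "p * q \<in> ext z I" if "p \<in> polys (insert z X)" "q \<in> ext z I" for p q
  proof (rule extI)
    fix j
    show "coeff_in z j (p * q) \<in> I" unfolding coeff_in_mult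
      by (intro ideal_sum[OF I] ideal_mult[OF I] coeff_in_polys_insert that extD)
  qed
qed

lemma ext_one: "1 \<in> ext z I \<longleftrightarrow> 1 \<in> I"
  by (rule ext_free) simp

lemma ext_top:
  assumes "p \<notin> ext z I"
  obtains i where "coeff_in z i p \<notin> I" "\<And>k. i < k \<Longrightarrow> coeff_in z k p \<in> I"
proof -
  let ?A = "{i. coeff_in z i p \<notin> I}"
  have "?A \<subseteq> {i. coeff_in z i p \<noteq> 0}" using ideal_zero[OF I] by auto
  then have fin: "finite ?A" by (rule finite_subset[OF _ finite_coeff_in])
  have "?A \<noteq> {}" using assms by (auto simp: ext_def)
  then have "Max ?A \<in> ?A" using fin by (intro Max_in)
  moreover have "coeff_in z k p \<in> I" if "Max ?A < k" for k using Max_ge[OF fin, of k] that by auto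
  ultimately show ?thesis using that by blast
qed

text \<open>
  Degrees in \<open>z\<close> are counted modulo \<open>I\<close> here: in the Cauchy product at \<open>m + n\<close>, every other summand has an
  index above \<open>m\<close> in its first factor or one above \<open>n\<close> in its second.
\<close>

lemma coeff_in_mult_top_mod:
  assumes p: "\<And>k l. m < k \<Longrightarrow> coeff_in z k p * coeff_in z l q \<in> I"
    and q: "\<And>k l. n < k \<Longrightarrow> coeff_in z l p * coeff_in z k q \<in> I"
  shows "coeff_in z (m + n) (p * q) \<in> I \<longleftrightarrow> coeff_in z m p * coeff_in z n q \<in> I"
proof -
  have "coeff_in z (m + n) (p * q) = coeff_in z m p * coeff_in z n q
      + (\<Sum>i\<in>{..m + n} - {m}. coeff_in z i p * coeff_in z (m + n - i) q)"
    unfolding coeff_in_mult by (subst sum.remove[of _ m]) auto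
  moreover have "(\<Sum>i\<in>{..m + n} - {m}. coeff_in z i p * coeff_in z (m + n - i) q) \<in> I"
  proof (rule ideal_sum[OF I])
    fix i assume "i \<in> {..m + n} - {m}"
    then have "m < i \<or> n < m + n - i" by auto
    then show "coeff_in z i p * coeff_in z (m + n - i) q \<in> I" using p q by blast
  qed
  ultimately show ?thesis using ideal_add_cancel[OF I] by simp
qed

end

lemma ext_Int: "ext z (I \<inter> J) = ext z I \<inter> ext z J"
  by (auto simp: ext_def)

lemma contraction_ideal:
  assumes "ideal J (mpoly_ring Y)" "X \<subseteq> Y"
  shows "ideal (J \<inter> polys X) (mpoly_ring X)"
  unfolding ideal_mpoly_iff
  using polys_mono[OF assms(2)]
  by (auto intro: ideal_zero[OF assms(1)] ideal_add[OF assms(1)] ideal_mult[OF assms(1)] polys_add polys_mult)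

lemma contraction_prime:
  assumes "primeideal P (mpoly_ring Y)" "X \<subseteq> Y"
  shows "primeideal (P \<inter> polys X) (mpoly_ring X)"
  using contraction_ideal[OF prime_ideal[OF assms(1)] assms(2)] prime_one[OF assms(1)] prime_mult[OF assms(1)]
    polys_mono[OF assms(2)] unfolding primeideal_mpoly_iff by blast

lemma ext_gen:
  assumes S: "S \<subseteq> polys X" and z: "z \<notin> X"
  shows "gen (insert z X) S = ext z (gen X S)"
proof (rule gen_eqI)
  note I = gen_ideal[OF S]
  show "ideal (ext z (gen X S)) (mpoly_ring (insert z X))" by (rule ext_ideal[OF I z])
  show "S \<subseteq> ext z (gen X S)" using gen_superset[OF S] ext_superset[OF I z] by blast
  fix J assume J: "ideal J (mpoly_ring (insert z X))" "S \<subseteq> J"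
  have "gen X S \<subseteq> J \<inter> polys X" using J(2) S by (intro gen_least contraction_ideal[OF J(1)]) auto
  then have "(\<Sum>j\<le>degree_in z p. coeff_in z j p * var z ^ j) \<in> J" if "p \<in> ext z (gen X S)" for p
    using extD[OF that]
    by (intro ideal_sum[OF J(1)] ideal_mult_right[OF J(1)] polys_power polys_var) auto
  then show "ext z (gen X S) \<subseteq> J" unfolding expand_in_degree[of _ z, symmetric] by blast
qed

text \<open>
  The highest coefficients of \<open>p\<close> and \<open>q\<close> outside \<open>P\<close> have a product outside \<open>P\<close>, which is a coefficient
  of \<open>p q\<close> modulo \<open>P\<close>.
\<close>

lemma ext_prime:
  assumes P: "primeideal P (mpoly_ring X)" and z: "z \<notin> X"
  shows "primeideal (ext z P) (mpoly_ring (insert z X))"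
  unfolding primeideal_mpoly_iff
proof (intro conjI ballI impI)
  note PI = prime_ideal[OF P]
  show "ideal (ext z P) (mpoly_ring (insert z X))" by (rule ext_ideal[OF PI z])
  show "1 \<notin> ext z P" using prime_one[OF P] ext_one[OF PI z] by simp
  fix p q :: "('a, 'b) mpoly"
  assume pq: "p \<in> polys (insert z X)" "q \<in> polys (insert z X)" "p * q \<in> ext z P"
  show "p \<in> ext z P \<or> q \<in> ext z P"
  proof (rule ccontr)
    assume "\<not> (p \<in> ext z P \<or> q \<in> ext z P)"
    then obtain m n where m: "coeff_in z m p \<notin> P" "\<And>k. m < k \<Longrightarrow> coeff_in z k p \<in> P"
      and n: "coeff_in z n q \<notin> P" "\<And>k. n < k \<Longrightarrow> coeff_in z k q \<in> P"
      using ext_top[OF PI z, of p] ext_top[OF PI z, of q] by metis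
    have c: "coeff_in z k p \<in> polys X" "coeff_in z k q \<in> polys X" for k
      using pq by (auto intro: coeff_in_polys_insert)
    have "coeff_in z m p * coeff_in z n q \<in> P"
      using extD[OF pq(3)] ideal_mult_right[OF PI c(2) m(2)] ideal_mult[OF PI c(1) n(2)]
      by (rule coeff_in_mult_top_mod[OF PI z, THEN iffD1, rotated 2])
    then show False using prime_mult[OF P _ c(1) c(2)] m(1) n(1) by blast
  qed
qed


section \<open>Unmixedness under extension\<close>

lemma krull_dim_eq_card:
  fixes I :: "('v, 'k::field) mpoly set"
  assumes X: "finite X" and I: "ideal I (mpoly_ring X)" and Y: "Y \<subseteq> X" "indep I Y"
    and max: "\<And>Y'. Y' \<subseteq> X \<Longrightarrow> indep I Y' \<Longrightarrow> card Y' \<le> card Y"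
  shows "krull_dim (mpoly_ring X Quot I) = enat (card Y)"
  unfolding krull_dim_affine[OF X I]
proof (rule antisym)
  show "Sup {enat (card Y) |Y. Y \<subseteq> X \<and> indep I Y} \<le> enat (card Y)"
    by (rule Sup_least) (use max in auto)
  show "enat (card Y) \<le> Sup {enat (card Y) |Y. Y \<subseteq> X \<and> indep I Y}"
    by (rule Sup_upper) (use Y in blast)
qed

lemma krull_dim_cong:
  fixes I :: "('v, 'k::field) mpoly set" and I' :: "('w, 'k) mpoly set"
  assumes "finite X" "ideal I (mpoly_ring X)" "finite X'" "ideal I' (mpoly_ring X')"
    and "\<And>Y. Y \<subseteq> X \<Longrightarrow> indep I Y \<Longrightarrow> \<exists>Y'\<subseteq>X'. indep I' Y' \<and> card Y \<le> card Y'"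
    and "\<And>Y. Y \<subseteq> X' \<Longrightarrow> indep I' Y \<Longrightarrow> \<exists>Y'\<subseteq>X. indep I Y' \<and> card Y \<le> card Y'"
  shows "krull_dim (mpoly_ring X Quot I) = krull_dim (mpoly_ring X' Quot I')"
  unfolding krull_dim_affine[OF assms(1,2)] krull_dim_affine[OF assms(3,4)]
proof (rule antisym; rule Sup_mono)
  fix d assume "d \<in> {enat (card Y) |Y. Y \<subseteq> X \<and> indep I Y}"
  then obtain Y where Y: "d = enat (card Y)" "Y \<subseteq> X" "indep I Y" by blast
  obtain Y' where Y': "Y' \<subseteq> X'" "indep I' Y'" "card Y \<le> card Y'" using assms(5)[OF Y(2,3)] by blast
  show "\<exists>d'\<in>{enat (card Y) |Y. Y \<subseteq> X' \<and> indep I' Y}. d \<le> d'"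
    by (rule bexI[of _ "enat (card Y')"]) (use Y Y' in auto)
next
  fix d assume "d \<in> {enat (card Y) |Y. Y \<subseteq> X' \<and> indep I' Y}"
  then obtain Y where Y: "d = enat (card Y)" "Y \<subseteq> X'" "indep I' Y" by blast
  obtain Y' where Y': "Y' \<subseteq> X" "indep I Y'" "card Y \<le> card Y'" using assms(6)[OF Y(2,3)] by blast
  show "\<exists>d'\<in>{enat (card Y) |Y. Y \<subseteq> X \<and> indep I Y}. d \<le> d'"
    by (rule bexI[of _ "enat (card Y')"]) (use Y Y' in auto)
qed

lemma exists_max_indep:
  fixes I :: "('v, 'k::field) mpoly set"
  assumes X: "finite X" and I: "ideal I (mpoly_ring X)" and one: "1 \<notin> I"
  obtains Y where "Y \<subseteq> X" "indep I Y" "\<forall>Y'. Y' \<subseteq> X \<longrightarrow> indep I Y' \<longrightarrow> card Y' \<le> card Y"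
proof -
  let ?A = "{Z. Z \<subseteq> X \<and> indep I Z}"
  have fin: "finite ?A" using X by (rule finite_subset[OF _ finite_Pow_iff[THEN iffD2], rotated]) auto
  have ne: "?A \<noteq> {}" using indep_empty[OF I one] by blast
  have "Max (card ` ?A) \<in> card ` ?A" using fin ne by (intro Max_in) auto
  then obtain Z where Z: "Z \<in> ?A" "Max (card ` ?A) = card Z" by (elim imageE)
  have "card Z' \<le> card Z" if "Z' \<in> ?A" for Z'
    unfolding Z(2)[symmetric] using fin that by (intro Max_ge) auto
  then show ?thesis using Z(1) that[of Z] by blast
qed

lemma indep_ext_iff:
  fixes I :: "('v, 'k::field) mpoly set"
  assumes I: "ideal I (mpoly_ring X)" and z: "z \<notin> X" and Y: "Y \<subseteq> insert z X"
  shows "indep (ext z I) Y \<longleftrightarrow> indep I (Y - {z})"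
proof
  assume a: "indep (ext z I) Y"
  show "indep I (Y - {z})"
    using a ext_superset[OF I z] polys_mono[of "Y - {z}" Y] by blast
next
  assume a: "indep I (Y - {z})"
  show "indep (ext z I) Y"
  proof
    fix p assume p: "p \<in> ext z I \<inter> polys Y"
    then have "coeff_in z j p = 0" for j
      using a extD[of p z I j] coeff_in_polys[of p Y z j] by auto
    then have "p = 0" using coeff_in_ex_nonzero[of p z] by auto
    then show "p \<in> {0}" by simp
  qed
qed

lemma krull_dim_ext:
  fixes I :: "('v, 'k::field) mpoly set"
  assumes X: "finite X" and I: "ideal I (mpoly_ring X)" and z: "z \<notin> X" and one: "1 \<notin> I"
  shows "krull_dim (mpoly_ring (insert z X) Quot ext z I) = eSuc (krull_dim (mpoly_ring X Quot I))"
proof -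
  obtain Y where Y: "Y \<subseteq> X" "indep I Y" "\<forall>Y'. Y' \<subseteq> X \<longrightarrow> indep I Y' \<longrightarrow> card Y' \<le> card Y"
    using exists_max_indep[OF X I one] by blast
  have fY: "finite Y" "z \<notin> Y" using Y(1) X z finite_subset by auto
  have "krull_dim (mpoly_ring (insert z X) Quot ext z I) = enat (card (insert z Y))"
  proof (rule krull_dim_eq_card)
    show "ideal (ext z I) (mpoly_ring (insert z X))" by (rule ext_ideal[OF I z])
    show "indep (ext z I) (insert z Y)"
      using indep_ext_iff[OF I z, of "insert z Y"] Y(1,2) fY(2) by auto
    fix Z assume Z: "Z \<subseteq> insert z X" "indep (ext z I) Z"
    then have "indep I (Z - {z})" using indep_ext_iff[OF I z Z(1)] by simp
    moreover have "Z - {z} \<subseteq> X" using Z(1) by auto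
    ultimately have c: "card (Z - {z}) \<le> card Y" using Y(3) by blast
    have "finite Z" using Z(1) X finite_subset by blast
    then have "card Z \<le> Suc (card (Z - {z}))"
      using card_Suc_Diff1[of Z z] by (cases "z \<in> Z") auto
    then show "card Z \<le> card (insert z Y)" using c fY by simp
  qed (use X Y in auto)
  moreover have "krull_dim (mpoly_ring X Quot I) = enat (card Y)"
    by (rule krull_dim_eq_card[OF X I Y(1,2)]) (use Y(3) in blast)
  ultimately show ?thesis using fY by (simp add: eSuc_enat)
qed

lemma associated_primes_mpoly_iff:
  "P \<in> associated_primes (mpoly_ring X) I \<longleftrightarrow>
    primeideal P (mpoly_ring X) \<and> (\<exists>f\<in>polys X. P = {r \<in> polys X. r * f \<in> I})"
  unfolding associated_primes_def by simp

text \<open>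
  Let \<open>Q\<close> be the annihilator of \<open>f\<close> modulo the extended ideal.  Every multiple of \<open>f\<close> outside that ideal has
  the same annihilator, because \<open>Q\<close> is prime.  Take such a multiple \<open>g\<close> whose degree \<open>i\<close> in \<open>z\<close> modulo \<open>I\<close> is
  least.  If \<open>r \<in> K[X]\<close> kills the coefficient of \<open>g\<close> at \<open>i\<close>, then \<open>r g\<close> has smaller degree modulo \<open>I\<close> and so
  vanishes; hence \<open>Q \<inter> K[X]\<close> is the annihilator \<open>P\<close> of this coefficient.  The highest coefficient outside
  \<open>P\<close> of an element \<open>r\<close> of \<open>Q\<close> would kill the coefficient of \<open>g\<close> at \<open>i\<close>, as \<open>r g\<close> vanishes modulo \<open>I\<close>; so all
  coefficients of \<open>r\<close> lie in \<open>P\<close>.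
\<close>

lemma associated_primes_ext:
  fixes I :: "('v, 'k::field) mpoly set"
  assumes I: "ideal I (mpoly_ring X)" and z: "z \<notin> X"
    and A: "Q \<in> associated_primes (mpoly_ring (insert z X)) (ext z I)"
  obtains P where "P \<in> associated_primes (mpoly_ring X) I" "Q = ext z P"
proof -
  note E = ext_ideal[OF I z]
  obtain f where Q: "primeideal Q (mpoly_ring (insert z X))" and f: "f \<in> polys (insert z X)"
    and Qf: "Q = {r \<in> polys (insert z X). r * f \<in> ext z I}"
    using A unfolding associated_primes_mpoly_iff by blast
  define T where "T i \<longleftrightarrow> (\<exists>h\<in>polys (insert z X). coeff_in z i (h * f) \<notin> I \<and> (\<forall>k>i. coeff_in z k (h * f) \<in> I))" for i
  have T: "\<exists>i. T i \<and> coeff_in z i (h * f) \<notin> I"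
    if "h * f \<notin> ext z I" "h \<in> polys (insert z X)" for h
    using ext_top[OF I z that(1)] that(2) unfolding T_def by metis
  have "1 * f \<notin> ext z I" using prime_one[OF Q] f unfolding Qf by auto
  then have ex: "\<exists>i. T i" using T[of 1] by auto
  define i where "i = (LEAST i. T i)"
  have "T i" unfolding i_def using ex by (rule LeastI_ex)
  then obtain h where h: "h \<in> polys (insert z X)" "coeff_in z i (h * f) \<notin> I" "\<forall>k>i. coeff_in z k (h * f) \<in> I"
    unfolding T_def by blast
  have small: "h' * f \<in> ext z I" if h': "h' \<in> polys (insert z X)" "\<And>k. i \<le> k \<Longrightarrow> coeff_in z k (h' * f) \<in> I" for h'
  proof (rule ccontr)
    assume "h' * f \<notin> ext z I"
    then obtain l where "T l" "coeff_in z l (h' * f) \<notin> I" using T[OF _ h'(1)] by blast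
    then show False using h'(2)[of l] Least_le[of T l] unfolding i_def by blast
  qed
  define g where "g = h * f"
  have g: "coeff_in z i g \<notin> I" "\<And>k. i < k \<Longrightarrow> coeff_in z k g \<in> I" "g \<in> polys (insert z X)"
    using h f unfolding g_def by (auto intro: polys_mult)
  have hQ: "h \<notin> Q" using h(2) unfolding Qf by (auto simp: ext_def)
  have Qg: "r \<in> Q \<longleftrightarrow> r * g \<in> ext z I" if "r \<in> polys (insert z X)" for r
  proof -
    have "r * g \<in> ext z I \<longleftrightarrow> r * h \<in> Q"
      unfolding Qf g_def using that h(1) by (auto simp: mult.assoc intro: polys_mult)
    also have "\<dots> \<longleftrightarrow> r \<in> Q"
      using prime_mult[OF Q _ that h(1)] hQ ideal_mult_right[OF prime_ideal[OF Q] h(1)] by blast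
    finally show ?thesis by simp
  qed
  define P where "P = {r \<in> polys X. r * coeff_in z i g \<in> I}"
  have XX: "p \<in> polys (insert z X)" if "p \<in> polys X" for p :: "('v, 'k) mpoly"
    using polys_mono[of X "insert z X"] that by blast
  have PQ: "r \<in> P \<longleftrightarrow> r \<in> Q" if r: "r \<in> polys X" for r
  proof
    assume "r \<in> Q"
    then have "coeff_in z i (r * g) \<in> I" using Qg[OF XX[OF r]] extD[of "r * g" z I i] by blast
    then show "r \<in> P" using r coeff_in_mult_free'[OF r z] by (simp add: P_def)
  next
    assume rP: "r \<in> P"
    have "coeff_in z k (r * h * f) \<in> I" if "i \<le> k" for k
    proof -
      have "coeff_in z k (r * h * f) = r * coeff_in z k g"
        unfolding g_def mult.assoc by (rule coeff_in_mult_free'[OF r z])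
      then show ?thesis
        using that rP g(2)[of k] r by (cases "k = i") (auto simp: P_def intro: ideal_mult[OF I])
    qed
    then have "(r * h) * f \<in> ext z I" using XX[OF r] h(1) by (intro small polys_mult) auto
    then show "r \<in> Q" using Qg[OF XX[OF r]] by (simp add: g_def mult.assoc)
  qed
  have "P = Q \<inter> polys X" using PQ by (auto simp: P_def)
  then have prime: "primeideal P (mpoly_ring X)" using contraction_prime[OF Q, of X] by auto
  have PI: "ideal P (mpoly_ring X)" using prime by (rule prime_ideal)
  have "Q = ext z P"
  proof (intro equalityI subsetI)
    fix r assume rQ: "r \<in> Q"
    then have r: "r \<in> polys (insert z X)" unfolding Qf by blast
    show "r \<in> ext z P"
    proof (rule ccontr)
      assume "r \<notin> ext z P"
      then obtain m where m: "coeff_in z m r \<notin> P" "\<And>k. m < k \<Longrightarrow> coeff_in z k r \<in> P"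
        using ext_top[OF PI z] by metis
      have cX: "coeff_in z k r \<in> polys X" for k using r by (rule coeff_in_polys_insert)
      have "coeff_in z k r * coeff_in z l g \<in> I" if "m < k" for k l
      proof -
        have "coeff_in z k r * g \<in> ext z I" using m(2)[OF that] PQ[OF cX] Qg[OF XX[OF cX]] by blast
        then have "coeff_in z l (coeff_in z k r * g) \<in> I" by (rule extD)
        then show ?thesis by (simp only: coeff_in_mult_free'[OF cX z])
      qed
      moreover have "coeff_in z l r * coeff_in z k g \<in> I" if "i < k" for k l
        using g(2)[OF that] cX by (intro ideal_mult[OF I])
      ultimately have "coeff_in z (m + i) (r * g) \<in> I \<longleftrightarrow> coeff_in z m r * coeff_in z i g \<in> I"
        by (rule coeff_in_mult_top_mod[OF I z])
      moreover have "coeff_in z (m + i) (r * g) \<in> I" using rQ Qg[OF r] by (intro extD) blast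
      ultimately have "coeff_in z m r \<in> P" using cX by (simp add: P_def)
      then show False using m(1) by blast
    qed
  next
    fix r assume r: "r \<in> ext z P"
    have "coeff_in z j r \<in> Q" for j using extD[OF r, of j] \<open>P = Q \<inter> polys X\<close> by blast
    then have "(\<Sum>j\<le>degree_in z r. coeff_in z j r * var z ^ j) \<in> Q"
      by (intro ideal_sum[OF prime_ideal[OF Q]] ideal_mult_right[OF prime_ideal[OF Q]] polys_power polys_var) auto
    then show "r \<in> Q" using expand_in_degree[of r z] by simp
  qed
  moreover have "P \<in> associated_primes (mpoly_ring X) I"
    unfolding associated_primes_mpoly_iff P_def[symmetric] using prime g(3)
    by (auto simp: P_def intro!: bexI[of _ "coeff_in z i g"] coeff_in_polys_insert)
  ultimately show ?thesis using that by blast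
qed

lemma unmixed_ext:
  fixes I :: "('v, 'k::field) mpoly set"
  assumes X: "finite X" and I: "ideal I (mpoly_ring X)" and z: "z \<notin> X" and u: "unmixed (mpoly_ring X) I"
  shows "unmixed (mpoly_ring (insert z X)) (ext z I)"
  unfolding unmixed_def
proof
  fix Q assume "Q \<in> associated_primes (mpoly_ring (insert z X)) (ext z I)"
  then obtain P where P: "P \<in> associated_primes (mpoly_ring X) I" "Q = ext z P"
    using associated_primes_ext[OF I z] by blast
  then obtain f where prime: "primeideal P (mpoly_ring X)" and f: "f \<in> polys X" "P = {r \<in> polys X. r * f \<in> I}"
    unfolding associated_primes_mpoly_iff by blast
  have "1 \<notin> I" using prime_one[OF prime] f ideal_mult[OF I f(1), of 1] by auto
  then show "krull_dim (mpoly_ring (insert z X) Quot ext z I) = krull_dim (mpoly_ring (insert z X) Quot Q)"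
    unfolding P(2) using krull_dim_ext[OF X I z] krull_dim_ext[OF X prime_ideal[OF prime] z prime_one[OF prime]]
      u P(1) unfolding unmixed_def by auto
qed

text \<open>
  The annihilator of every nonzero class modulo a prime \<open>P\<close> is \<open>P\<close> itself, so
  \<open>P\<close> is the only associated prime.
\<close>

lemma unmixed_prime:
  assumes P: "primeideal P (mpoly_ring X)"
  shows "unmixed (mpoly_ring X) P"
  unfolding unmixed_def
proof
  fix Q assume "Q \<in> associated_primes (mpoly_ring X) P"
  then obtain f where Q: "primeideal Q (mpoly_ring X)" "f \<in> polys X" "Q = {r \<in> polys X. r * f \<in> P}"
    unfolding associated_primes_mpoly_iff by blast
  have "f \<notin> P" using prime_one[OF Q(1)] Q(3) by auto
  then have "r * f \<in> P \<longleftrightarrow> r \<in> P" if "r \<in> polys X" for r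
    using prime_mult[OF P _ that Q(2)] ideal_mult_right[OF prime_ideal[OF P] Q(2)] by blast
  then have "Q = P" unfolding Q(3) using ideal_subset[OF prime_ideal[OF P]] by auto
  then show "krull_dim (mpoly_ring X Quot P) = krull_dim (mpoly_ring X Quot Q)" by simp
qed


section \<open>Monomial orders\<close>

lemma monomial_orderD:
  assumes "monomial_order X r"
  shows mo_refl: "s \<in> monomials X \<Longrightarrow> (s, s) \<in> r"
    and mo_antisym: "(s, t) \<in> r \<Longrightarrow> (t, s) \<in> r \<Longrightarrow> s = t"
    and mo_trans: "(s, t) \<in> r \<Longrightarrow> (t, u) \<in> r \<Longrightarrow> (s, u) \<in> r"
    and mo_total: "s \<in> monomials X \<Longrightarrow> t \<in> monomials X \<Longrightarrow> (s, t) \<in> r \<or> (t, s) \<in> r"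
    and mo_sub: "r \<subseteq> monomials X \<times> monomials X"
    and mo_wf: "wf (r - Id)"
    and mo_add: "(s, t) \<in> r \<Longrightarrow> u \<in> monomials X \<Longrightarrow> (s + u, t + u) \<in> r"
  using assms
  unfolding monomial_order_def well_order_on_def linear_order_on_def partial_order_on_def preorder_on_def
    refl_on_def antisym_def trans_def total_on_def
  by (blast, blast, blast, metis, blast, blast, blast)

lemma mo_cancel:
  assumes r: "monomial_order X r" and "s \<in> monomials X" "t \<in> monomials X" "u \<in> monomials X" "(s + u, t + u) \<in> r"
  shows "(s, t) \<in> r"
proof (rule ccontr)
  assume a: "(s, t) \<notin> r"
  then have "(t, s) \<in> r" using mo_total[OF r assms(2,3)] by blast
  then have "(t + u, s + u) \<in> r" using assms(4) by (rule mo_add[OF r])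
  then have "t + u = s + u" using mo_antisym[OF r] assms(5) by blast
  then show False using a mo_refl[OF r assms(2)] by simp
qed

definition lex_order where
  "lex_order A f g r s = {(m, n). m \<in> A \<and> n \<in> A \<and>
    (f m \<noteq> f n \<and> (f m, f n) \<in> r \<or> f m = f n \<and> (g m, g n) \<in> s)}"

lemma well_order_lex_order:
  assumes r: "well_order_on B r" and s: "well_order_on C s"
    and B: "\<And>m. m \<in> A \<Longrightarrow> f m \<in> B" and C: "\<And>m. m \<in> A \<Longrightarrow> g m \<in> C"
    and inj: "\<And>m n. m \<in> A \<Longrightarrow> n \<in> A \<Longrightarrow> f m = f n \<Longrightarrow> g m = g n \<Longrightarrow> m = n"
  shows "well_order_on A (lex_order A f g r s)"
proof -
  have r': "trans r" "antisym r" "total_on B r" "wf (r - Id)"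
    and s': "refl_on C s" "trans s" "antisym s" "total_on C s" "wf (s - Id)"
    using r s unfolding well_order_on_def linear_order_on_def partial_order_on_def preorder_on_def by blast+
  let ?L = "lex_order A f g r s"
  have "?L \<subseteq> A \<times> A" by (auto simp: lex_order_def)
  moreover have "refl_on A ?L" using s'(1) C by (auto simp: lex_order_def refl_on_def)
  moreover have "trans ?L"
  proof (rule transI)
    fix m n l assume mn: "(m, n) \<in> ?L" and nl: "(n, l) \<in> ?L"
    show "(m, l) \<in> ?L"
    proof (cases "f m = f n \<and> f n = f l")
      case True
      then have "(g m, g l) \<in> s" using mn nl transD[OF s'(2)] by (auto simp: lex_order_def)
      then show ?thesis using True mn nl by (auto simp: lex_order_def)
    next
      case False
      have "(f m, f l) \<in> r" using False mn nl transD[OF r'(1), of "f m" "f n" "f l"] by (auto simp: lex_order_def)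
      moreover have "f m \<noteq> f l" using False mn nl antisymD[OF r'(2), of "f m" "f n"] by (auto simp: lex_order_def)
      ultimately show ?thesis using mn nl by (auto simp: lex_order_def)
    qed
  qed
  moreover have "antisym ?L"
    using antisymD[OF r'(2)] antisymD[OF s'(3)] inj by (intro antisymI) (auto simp: lex_order_def)
  moreover have "total_on A ?L"
    unfolding total_on_def
  proof (intro ballI impI)
    fix m n assume mn: "m \<in> A" "n \<in> A" "m \<noteq> n"
    show "(m, n) \<in> ?L \<or> (n, m) \<in> ?L"
    proof (cases "f m = f n")
      case True
      then have "g m \<noteq> g n" using inj mn by blast
      then have "(g m, g n) \<in> s \<or> (g n, g m) \<in> s" using s'(4) C mn unfolding total_on_def by blast
      then show ?thesis using True mn by (auto simp: lex_order_def)
    next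
      case False
      then have "(f m, f n) \<in> r \<or> (f n, f m) \<in> r" using r'(3) B mn unfolding total_on_def by blast
      then show ?thesis using False mn by (auto simp: lex_order_def)
    qed
  qed
  moreover have "wf (?L - Id)"
  proof (rule wf_subset)
    show "wf (inv_image ((r - Id) <*lex*> (s - Id)) (\<lambda>m. (f m, g m)))"
      using r'(4) s'(5) by (intro wf_inv_image wf_lex_prod)
    show "?L - Id \<subseteq> inv_image ((r - Id) <*lex*> (s - Id)) (\<lambda>m. (f m, g m))"
      using inj by (auto simp: lex_order_def inv_image_def)
  qed
  ultimately show ?thesis
    unfolding well_order_on_def linear_order_on_def partial_order_on_def preorder_on_def by blast
qed

definition strip :: "'v \<Rightarrow> ('v \<Rightarrow>\<^sub>0 nat) \<Rightarrow> ('v \<Rightarrow>\<^sub>0 nat)" where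
  "strip z m = m - single z (lookup m z)"

lemma lookup_strip: "lookup (strip z m) v = (if v = z then 0 else lookup m v)"
  by (auto simp: strip_def lookup_minus lookup_single when_def)

lemma strip_add: "strip z (m + n) = strip z m + strip z n"
  by (rule poly_mapping_eqI) (auto simp: lookup_strip lookup_add)

lemma strip_split: "strip z m + single z (lookup m z) = m"
  unfolding strip_def by (rule monomial_split[symmetric])

lemma strip_inj: "strip z m = strip z n \<Longrightarrow> lookup m z = lookup n z \<Longrightarrow> m = n"
  by (metis strip_split)

lemma strip_monomials: "m \<in> monomials (insert z X) \<Longrightarrow> strip z m \<in> monomials X"
  by (auto simp: monomials_iff lookup_strip)

lemma strip_free: "m \<in> monomials X \<Longrightarrow> z \<notin> X \<Longrightarrow> strip z m = m"
  by (rule poly_mapping_eqI) (auto simp: monomials_iff lookup_strip)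

abbreviation nat_order :: "(nat \<times> nat) set" where
  "nat_order \<equiv> {(i, j). i \<le> j}"

lemma well_order_nat: "well_order_on UNIV nat_order"
proof -
  have "nat_order - Id = {(i, j). i < j}" by auto
  then have "wf (nat_order - Id)" by (simp add: wf_less)
  then show ?thesis
    unfolding well_order_on_def linear_order_on_def partial_order_on_def preorder_on_def
    by (auto simp: refl_on_def trans_def antisym_def total_on_def)
qed

text \<open>
  Two extensions of a monomial order to one more variable \<open>z\<close>.  In the first one \<open>z\<close> only breaks ties,
  which preserves compatibility with the other variables; the second one is \<open>z\<close>-compatible.
\<close>

definition order_last :: "'v \<Rightarrow> 'v set \<Rightarrow> (('v \<Rightarrow>\<^sub>0 nat) \<times> ('v \<Rightarrow>\<^sub>0 nat)) set \<Rightarrow> (('v \<Rightarrow>\<^sub>0 nat) \<times> ('v \<Rightarrow>\<^sub>0 nat)) set" where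
  "order_last z X r = lex_order (monomials (insert z X)) (strip z) (\<lambda>m. lookup m z) r nat_order"

definition order_first :: "'v \<Rightarrow> 'v set \<Rightarrow> (('v \<Rightarrow>\<^sub>0 nat) \<times> ('v \<Rightarrow>\<^sub>0 nat)) set \<Rightarrow> (('v \<Rightarrow>\<^sub>0 nat) \<times> ('v \<Rightarrow>\<^sub>0 nat)) set" where
  "order_first z X r = lex_order (monomials (insert z X)) (\<lambda>m. lookup m z) (strip z) nat_order r"

lemma monomial_order_last:
  assumes r: "monomial_order X r" and z: "z \<notin> X"
  shows "monomial_order (insert z X) (order_last z X r)"
  unfolding monomial_order_def
proof (intro conjI allI ballI impI)
  show "well_order_on (monomials (insert z X)) (order_last z X r)"
    unfolding order_last_def
    by (rule well_order_lex_order[of "monomials X", OF _ well_order_nat])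
      (use r in \<open>simp add: monomial_order_def\<close>, erule strip_monomials, simp, rule strip_inj)
  fix s t u assume u: "u \<in> monomials (insert z X)" and st: "(s, t) \<in> order_last z X r"
  then show "(s + u, t + u) \<in> order_last z X r"
    using mo_add[OF r, of "strip z s" "strip z t" "strip z u"] strip_monomials[OF u]
    by (auto simp: order_last_def lex_order_def strip_add lookup_add intro: monomials_add)
qed

lemma monomial_order_first:
  assumes r: "monomial_order X r" and z: "z \<notin> X"
  shows "monomial_order (insert z X) (order_first z X r)"
  unfolding monomial_order_def
proof (intro conjI allI ballI impI)
  show "well_order_on (monomials (insert z X)) (order_first z X r)"
    unfolding order_first_def
    by (rule well_order_lex_order[of _ _ "monomials X", OF well_order_nat])
      (use r in \<open>simp add: monomial_order_def\<close>, simp, erule strip_monomials, rule strip_inj)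
  fix s t u assume u: "u \<in> monomials (insert z X)" and st: "(s, t) \<in> order_first z X r"
  then show "(s + u, t + u) \<in> order_first z X r"
    using mo_add[OF r, of "strip z s" "strip z t" "strip z u"] strip_monomials[OF u]
    by (auto simp: order_first_def lex_order_def strip_add lookup_add intro: monomials_add)
qed

lemma order_last_extends:
  assumes r: "monomial_order X r" and z: "z \<notin> X"
  shows "r \<subseteq> order_last z X r"
proof
  fix p assume p: "p \<in> r"
  obtain s t where st: "p = (s, t)" by (cases p)
  have m: "s \<in> monomials X" "t \<in> monomials X" using mo_sub[OF r] p st by auto
  then have "lookup s z = 0" "lookup t z = 0" using z by (auto simp: monomials_iff)
  then show "p \<in> order_last z X r"
    using p st m strip_free[OF _ z] monomials_mono[of X "insert z X"] by (auto simp: order_last_def lex_order_def)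
qed

lemma order_first_extends:
  assumes r: "monomial_order X r" and z: "z \<notin> X"
  shows "r \<subseteq> order_first z X r"
proof
  fix p assume p: "p \<in> r"
  obtain s t where st: "p = (s, t)" by (cases p)
  have m: "s \<in> monomials X" "t \<in> monomials X" using mo_sub[OF r] p st by auto
  then have "lookup s z = 0" "lookup t z = 0" using z by (auto simp: monomials_iff)
  then show "p \<in> order_first z X r"
    using p st m strip_free[OF _ z] monomials_mono[of X "insert z X"] by (auto simp: order_first_def lex_order_def)
qed

lemma exists_monomial_order:
  assumes "finite X" shows "\<exists>r. monomial_order X r"
  using assms
proof induction
  case empty
  have e: "monomials {} = {0 :: 'a \<Rightarrow>\<^sub>0 nat}" by (auto simp: monomials_def)
  have "monomial_order {} {(0 :: 'a \<Rightarrow>\<^sub>0 nat, 0)}"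
    unfolding monomial_order_def e well_order_on_def linear_order_on_def partial_order_on_def preorder_on_def
    by (auto simp: refl_on_def trans_def antisym_def total_on_def Diff_eq)
  then show ?case by blast
next
  case (insert z X)
  then obtain r where r: "monomial_order X r" by blast
  show ?case using monomial_order_last[OF r] insert.hyps by blast
qed


section \<open>Leading monomials\<close>

lemma lead_monomial_eqI:
  assumes r: "monomial_order X r" and "m \<in> keys f" "\<And>s. s \<in> keys f \<Longrightarrow> (s, m) \<in> r"
  shows "lead_monomial r f = m"
  unfolding lead_monomial_def using assms(2,3) mo_antisym[OF r] by (intro the_equality) blast+

lemma exists_greatest:
  assumes r: "monomial_order X r" and "finite A" "A \<noteq> {}" "A \<subseteq> monomials X"
  shows "\<exists>m\<in>A. \<forall>s\<in>A. (s, m) \<in> r"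
  using assms(2-)
proof (induction rule: finite_ne_induct)
  case (singleton x)
  then show ?case using mo_refl[OF r] by blast
next
  case (insert x F)
  then obtain m where m: "m \<in> F" "\<forall>s\<in>F. (s, m) \<in> r" by blast
  show ?case
  proof (cases "(x, m) \<in> r")
    case True
    then show ?thesis using m by blast
  next
    case False
    then have "(m, x) \<in> r" using mo_total[OF r, of x m] insert.prems m(1) by blast
    then show ?thesis using m mo_trans[OF r] mo_refl[OF r, of x] insert.prems by blast
  qed
qed

lemma lead_monomial:
  assumes r: "monomial_order X r" and f: "f \<in> polys X" "f \<noteq> 0"
  shows lead_monomial_key: "lead_monomial r f \<in> keys f"
    and lead_monomial_greatest: "s \<in> keys f \<Longrightarrow> (s, lead_monomial r f) \<in> r"
proof -
  obtain m where m: "m \<in> keys f" "\<forall>s\<in>keys f. (s, m) \<in> r"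
    using exists_greatest[OF r, of "keys f"] f by (auto simp: polys_def)
  then have "lead_monomial r f = m" using lead_monomial_eqI[OF r] by blast
  then show "lead_monomial r f \<in> keys f" "s \<in> keys f \<Longrightarrow> (s, lead_monomial r f) \<in> r" using m by auto
qed

lemma init_term_extend:
  assumes r: "monomial_order X r" and r': "monomial_order X' r'" "r \<subseteq> r'" and f: "f \<in> polys X"
  shows "init_term r' f = init_term r f"
proof (cases "f = 0")
  case True
  then show ?thesis by (simp add: init_term_def)
next
  case False
  have "lead_monomial r' f = lead_monomial r f"
    using lead_monomial[OF r f False] r'(2) by (intro lead_monomial_eqI[OF r'(1)]) auto
  then show ?thesis by (simp add: init_term_def)
qed

lemma init_term_polys:
  assumes r: "monomial_order X r" and f: "f \<in> polys X"
  shows "init_term r f \<in> polys X"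
proof (cases "f = 0")
  case False
  then show ?thesis unfolding init_term_def
    using lead_monomial_key[OF r f] f by (intro polys_single) (auto simp: polys_def)
qed (simp add: init_term_def)

text \<open>
  Monomials with the same exponent of \<open>z\<close> are compared by \<open>r'\<close> in the same way as their parts in \<open>X\<close> are
  compared by \<open>r\<close>.
\<close>

lemma init_term_coeff_in:
  assumes r: "monomial_order X r" and z: "z \<notin> X"
    and r': "monomial_order (insert z X) r'" "r \<subseteq> r'" and f: "f \<in> polys (insert z X)" "f \<noteq> 0"
  shows "\<exists>j. coeff_in z j f \<noteq> 0 \<and> j = lookup (lead_monomial r' f) z \<and>
    init_term r' f = init_term r (coeff_in z j f) * var z ^ j"
proof -
  define m where "m = lead_monomial r' f"
  define j where "j = lookup m z"
  have m: "m \<in> keys f" "\<And>s. s \<in> keys f \<Longrightarrow> (s, m) \<in> r'"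
    unfolding m_def using lead_monomial[OF r'(1) f] by auto
  have mX: "m \<in> monomials (insert z X)" using m(1) f(1) by (auto simp: polys_def)
  have ms: "strip z m + single z j = m" unfolding j_def by (rule strip_split)
  have l: "lookup (coeff_in z j f) (strip z m) = lookup f m"
    by (simp add: lookup_coeff_in lookup_strip ms)
  then have k: "strip z m \<in> keys (coeff_in z j f)" using m(1) by (simp add: in_keys_iff)
  have "lead_monomial r (coeff_in z j f) = strip z m"
  proof (rule lead_monomial_eqI[OF r k])
    fix s assume s: "s \<in> keys (coeff_in z j f)"
    then have "lookup f (s + single z j) \<noteq> 0" "lookup s z = 0"
      by (auto simp: lookup_coeff_in in_keys_iff split: if_splits)
    then have "(s + single z j, strip z m + single z j) \<in> r'" using m(2) by (simp add: ms in_keys_iff)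
    moreover have sX: "s \<in> monomials X" using s coeff_in_polys_insert[OF f(1), of j] by (auto simp: polys_def)
    ultimately have "(s, strip z m) \<in> r'"
      using strip_monomials[OF mX] monomials_mono[of X "insert z X"]
      by (intro mo_cancel[OF r'(1), of s "strip z m" "single z j"]) (auto intro: monomials_single)
    then show "(s, strip z m) \<in> r"
      using mo_total[OF r sX strip_monomials[OF mX]] r'(2) mo_antisym[OF r'(1), of s "strip z m"] by blast
  qed
  then have "init_term r' f = init_term r (coeff_in z j f) * var z ^ j"
    unfolding init_term_def m_def[symmetric] l by (simp add: l var_power mult_single ms)
  moreover have "coeff_in z j f \<noteq> 0" using k by auto
  ultimately show ?thesis unfolding j_def m_def by blast
qed

text \<open>
  An initial term of the extended ideal is an initial term of \<open>I\<close> times a power of \<open>z\<close>.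
\<close>

lemma groebner_ext:
  assumes I: "ideal I (mpoly_ring X)" and r: "monomial_order X r" and z: "z \<notin> X"
    and r': "monomial_order (insert z X) r'" "r \<subseteq> r'" and B: "groebner_basis X r B I"
  shows "groebner_basis (insert z X) r' B (ext z I)"
proof -
  note gb = B[unfolded groebner_basis_def]
  have BX: "b \<in> polys X" if "b \<in> B" for b using gb ideal_subset[OF I] that by blast
  have tB: "init_term r' ` B = init_term r ` B"
    using init_term_extend[OF r r' BX] by (intro image_cong) auto
  have sB: "init_term r ` B \<subseteq> polys X" using init_term_polys[OF r BX] by auto
  have BI: "B \<subseteq> ext z I - {0}" using gb ext_superset[OF I z] by blast
  have sI: "init_term r' ` (ext z I - {0}) \<subseteq> polys (insert z X)"
    using init_term_polys[OF r'(1)] ext_polys[OF I z] by blast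
  have tI: "init_term r ` (I - {0}) \<subseteq> gen X (init_term r ` B)"
  proof -
    have "init_term r ` (I - {0}) \<subseteq> polys X" using init_term_polys[OF r] ideal_subset[OF I] by blast
    then have "init_term r ` (I - {0}) \<subseteq> gen X (init_term r ` (I - {0}))" by (rule gen_superset)
    then show ?thesis using gb by simp
  qed
  have "init_term r' f \<in> ext z (gen X (init_term r ` B))" if f: "f \<in> ext z I - {0}" for f
  proof -
    obtain j where j: "coeff_in z j f \<noteq> 0" "init_term r' f = init_term r (coeff_in z j f) * var z ^ j"
      using init_term_coeff_in[OF r z r', of f] f ext_polys[OF I z] by blast
    have "init_term r (coeff_in z j f) \<in> gen X (init_term r ` B)" using tI j(1) f extD[of f z I j] by blast
    then show ?thesis unfolding j(2)
      using ext_superset[OF gen_ideal[OF sB] z]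
      by (intro ideal_mult_right[OF ext_ideal[OF gen_ideal[OF sB] z]] polys_power polys_var) auto
  qed
  then have "gen (insert z X) (init_term r' ` (ext z I - {0})) \<subseteq> gen (insert z X) (init_term r' ` B)"
    unfolding tB ext_gen[OF sB z] by (intro gen_least ext_ideal[OF gen_ideal[OF sB] z]) auto
  moreover have "gen (insert z X) (init_term r' ` B) \<subseteq> gen (insert z X) (init_term r' ` (ext z I - {0}))"
    using gen_superset[OF sI] BI by (intro gen_least gen_ideal[OF sI]) blast
  ultimately show ?thesis unfolding groebner_basis_def using gb BI by blast
qed


section \<open>Compatible orders and initial forms\<close>

lemma lookup_init_part:
  "lookup (coeff_in y j f * var y ^ j) m = (if lookup m y = j then lookup f m else 0)"
proof (cases "\<exists>n. m = single y j + n")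
  case True
  then obtain n where n: "m = single y j + n" by blast
  have "lookup (coeff_in y j f * var y ^ j) m = lookup (coeff_in y j f) n"
    unfolding n var_power using lookup_single_mult_add[of "single y j" 1 "coeff_in y j f" n]
    by (simp add: mult.commute)
  then show ?thesis by (simp add: n lookup_coeff_in lookup_add add.commute)
next
  case False
  then have "lookup (coeff_in y j f * var y ^ j) m = 0"
    unfolding var_power using lookup_single_mult_eq_0[of m "single y j" 1 "coeff_in y j f"]
    by (simp add: mult.commute)
  moreover have "lookup m y \<noteq> j"
    using False strip_split[of y m] by (metis add.commute)
  ultimately show ?thesis by simp
qed

lemma coeff_in_nonzero_iff: "coeff_in y j f \<noteq> 0 \<longleftrightarrow> (\<exists>m\<in>keys f. lookup m y = j)"
proof
  assume "coeff_in y j f \<noteq> 0"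
  then obtain m where "lookup (coeff_in y j f) m \<noteq> 0" unfolding poly_mapping_eq_iff fun_eq_iff lookup_zero by blast
  then have "lookup m y = 0" "lookup f (m + single y j) \<noteq> 0"
    unfolding lookup_coeff_in by presburger+
  then show "\<exists>m\<in>keys f. lookup m y = j"
    by (intro bexI[of _ "m + single y j"]) (auto simp: lookup_add in_keys_iff)
next
  assume "\<exists>m\<in>keys f. lookup m y = j"
  then obtain m where m: "m \<in> keys f" "lookup m y = j" by blast
  have "lookup (coeff_in y j f) (strip y m) = lookup f m"
    using m(2) strip_split[of y m] by (simp add: lookup_coeff_in lookup_strip)
  then show "coeff_in y j f \<noteq> 0" using m(1) by (auto simp: in_keys_iff)
qed

lemma lead_monomial_degree:
  assumes r: "monomial_order X r"
    and a: "\<And>s t. s \<in> monomials X \<Longrightarrow> t \<in> monomials X \<Longrightarrow> lookup s y < lookup t y \<Longrightarrow> (s, t) \<in> r"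
    and f: "f \<in> polys X" "f \<noteq> 0"
  shows "lookup (lead_monomial r f) y = degree_in y f"
proof -
  define m where "m = lead_monomial r f"
  have m: "m \<in> keys f" "\<And>s. s \<in> keys f \<Longrightarrow> (s, m) \<in> r"
    unfolding m_def using lead_monomial[OF r f] by auto
  obtain n where n: "n \<in> keys f" "lookup n y = degree_in y f"
    using lead_coeff_in_nonzero[OF f(2), of y] unfolding lead_coeff_in_def coeff_in_nonzero_iff by blast
  have "lookup m y \<le> degree_in y f"
    using m(1) by (intro degree_in_ge) (auto simp: coeff_in_nonzero_iff)
  moreover have "\<not> lookup m y < lookup n y"
  proof
    assume l: "lookup m y < lookup n y"
    then have "(m, n) \<in> r" by (intro a polys_keysD[OF f(1)] m(1) n(1))
    then have "m = n" using m(2)[OF n(1)] mo_antisym[OF r] by blast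
    then show False using l by simp
  qed
  ultimately show ?thesis using n(2) unfolding m_def by simp
qed

text \<open>
  In one direction the condition is tested on the sum of two monomials; in the other, the lead monomial
  of \<open>f\<close> has the largest possible exponent of \<open>y\<close> and so survives in the initial form.
\<close>

lemma compatible_order_iff:
  assumes r: "monomial_order X r"
  shows "compatible_order TYPE('k::field) X y r \<longleftrightarrow>
    (\<forall>s\<in>monomials X. \<forall>t\<in>monomials X. lookup s y < lookup t y \<longrightarrow> (s, t) \<in> r)"
proof
  assume c: "compatible_order TYPE('k::field) X y r"
  show "\<forall>s\<in>monomials X. \<forall>t\<in>monomials X. lookup s y < lookup t y \<longrightarrow> (s, t) \<in> r"
  proof (intro ballI impI)
    fix s t assume st: "s \<in> monomials X" "t \<in> monomials X" "lookup s y < lookup t y"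
    define f :: "('a, 'k) mpoly" where "f = single s 1 + single t 1"
    have ne: "s \<noteq> t" using st(3) by auto
    have lf: "lookup f m = (if m = s \<or> m = t then 1 else 0)" for m
      using ne by (auto simp: f_def lookup_add lookup_single when_def)
    have kf: "keys f = {s, t}" by (rule equalityI; rule subsetI) (simp_all add: in_keys_iff lf split: if_splits)
    have f: "f \<in> polys X" "f \<noteq> 0" using st kf by (auto simp: polys_def)
    have deg: "degree_in y f = lookup t y"
    proof (rule degree_in_eqI)
      show "coeff_in y (lookup t y) f \<noteq> 0" unfolding coeff_in_nonzero_iff kf by auto
      show "coeff_in y i f = 0" if "lookup t y < i" for i
        using coeff_in_nonzero_iff[of y i f] that st(3) unfolding kf by auto
    qed
    have "init_in y f = single t 1"
      by (rule poly_mapping_eqI)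
        (use st(3) ne in \<open>auto simp: init_in_def lead_coeff_in_def deg lookup_init_part lf lookup_single when_def\<close>)
    moreover have "lead_monomial r (single t (1::'k)) = t"
      by (rule lead_monomial_eqI[OF r]) (use mo_refl[OF r st(2)] in auto)
    ultimately have "init_term r f = single t 1"
      using c f(1) unfolding compatible_order_def by (simp add: init_term_def)
    moreover have "lookup f (lead_monomial r f) \<noteq> 0"
      using lead_monomial_key[OF r f] by (simp add: in_keys_iff)
    ultimately have "lead_monomial r f = t"
      unfolding init_term_def by (metis lookup_single_eq lookup_single_not_eq)
    then show "(s, t) \<in> r" using lead_monomial_greatest[OF r f, of s] by (simp add: kf)
  qed
next
  assume a: "\<forall>s\<in>monomials X. \<forall>t\<in>monomials X. lookup s y < lookup t y \<longrightarrow> (s, t) \<in> r"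
  show "compatible_order TYPE('k::field) X y r"
    unfolding compatible_order_def
  proof
    fix f :: "('a, 'k) mpoly" assume "f \<in> carrier (mpoly_ring X)"
    then have f: "f \<in> polys X" by simp
    show "init_term r f = init_term r (init_in y f)"
    proof (cases "f = 0")
      case True
      then show ?thesis by (simp add: init_in_def lead_coeff_in_def)
    next
      case False
      define m where "m = lead_monomial r f"
      have m: "m \<in> keys f" "\<And>s. s \<in> keys f \<Longrightarrow> (s, m) \<in> r"
        unfolding m_def using lead_monomial[OF r f False] by auto
      have deg: "lookup m y = degree_in y f"
        unfolding m_def by (rule lead_monomial_degree[OF r _ f False]) (use a in blast)
      have l: "lookup (init_in y f) s = (if lookup s y = degree_in y f then lookup f s else 0)" for s
        unfolding init_in_def lead_coeff_in_def by (rule lookup_init_part)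
      have "lead_monomial r (init_in y f) = m"
        using m deg by (intro lead_monomial_eqI[OF r]) (auto simp: in_keys_iff l split: if_splits)
      then show ?thesis unfolding init_term_def m_def[symmetric] by (simp add: l deg)
    qed
  qed
qed

lemma compatible_order_last:
  assumes r: "monomial_order X r" and z: "z \<notin> X" and y: "y \<in> X"
    and c: "compatible_order TYPE('k::field) X y r"
  shows "compatible_order TYPE('k::field) (insert z X) y (order_last z X r)"
  unfolding compatible_order_iff[OF monomial_order_last[OF r z]]
proof (intro ballI impI)
  fix s t assume st: "s \<in> monomials (insert z X)" "t \<in> monomials (insert z X)" "lookup s y < lookup t y"
  have "y \<noteq> z" using y z by blast
  then have l: "lookup (strip z s) y < lookup (strip z t) y" using st(3) by (simp add: lookup_strip)
  then have "(strip z s, strip z t) \<in> r"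
    by (intro c[unfolded compatible_order_iff[OF r], rule_format] strip_monomials st)
  then show "(s, t) \<in> order_last z X r" using l st by (auto simp: order_last_def lex_order_def)
qed

lemma compatible_order_first:
  assumes r: "monomial_order X r" and z: "z \<notin> X"
  shows "compatible_order TYPE('k::field) (insert z X) z (order_first z X r)"
  unfolding compatible_order_iff[OF monomial_order_first[OF r z]]
  by (auto simp: order_first_def lex_order_def)


section \<open>Adding a variable preserves geometric vertex decomposability\<close>

lemma coeff_in_init_part:
  assumes "y \<noteq> z"
  shows "coeff_in z j (coeff_in y d f * var y ^ d) = coeff_in y d (coeff_in z j f) * var y ^ d"
  using assms by (intro poly_mapping_eqI)
    (auto simp: lookup_coeff_in lookup_init_part lookup_add lookup_single when_def)

lemma coeff_in_commute:
  assumes "y \<noteq> z"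
  shows "coeff_in y i (coeff_in z j f) = coeff_in z j (coeff_in y i f)"
  using assms by (intro poly_mapping_eqI) (auto simp: lookup_coeff_in lookup_add lookup_single add_ac)

lemma init_in_polys: "f \<in> polys X \<Longrightarrow> y \<in> X \<Longrightarrow> init_in y f \<in> polys X"
  unfolding init_in_def lead_coeff_in_def
  using coeff_in_polys[of f X y] polys_mono[of "X - {y}" X] by (intro polys_mult polys_power polys_var) auto

text \<open>
  Passing to the part of a fixed degree in \<open>y\<close> commutes with taking coefficients in \<open>z\<close>.
\<close>

lemma init_in_ideal_ext:
  fixes I :: "('v, 'k::field) mpoly set"
  assumes I: "ideal I (mpoly_ring X)" and z: "z \<notin> X" and y: "y \<in> X"
  shows "init_in_ideal (insert z X) y (ext z I) = ext z (init_in_ideal X y I)"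
proof -
  have yz: "y \<noteq> z" using y z by blast
  have s: "init_in y ` (I - {0}) \<subseteq> polys X" using init_in_polys[OF _ y] ideal_subset[OF I] by blast
  have s': "init_in y ` (ext z I - {0}) \<subseteq> polys (insert z X)"
    using init_in_polys[of _ "insert z X" y] y ext_polys[OF I z] by blast
  note L = gen_ideal[OF s]
  have "init_in y f \<in> ext z (gen X (init_in y ` (I - {0})))" if f: "f \<in> ext z I" for f
  proof (rule extI)
    fix j
    let ?g = "coeff_in z j f" and ?d = "degree_in y f"
    have g: "?g \<in> I" using f by (rule extD)
    have e: "coeff_in z j (init_in y f) = coeff_in y ?d ?g * var y ^ ?d"
      unfolding init_in_def lead_coeff_in_def by (rule coeff_in_init_part[OF yz])
    show "coeff_in z j (init_in y f) \<in> gen X (init_in y ` (I - {0}))"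
    proof (cases "coeff_in y ?d ?g = 0")
      case True
      then show ?thesis unfolding e using ideal_zero[OF L] by simp
    next
      case False
      have "degree_in y ?g = ?d"
      proof (rule degree_in_eqI[OF False])
        fix i assume "?d < i"
        then have "coeff_in y i f = 0" by (rule degree_in_less)
        then show "coeff_in y i ?g = 0" unfolding coeff_in_commute[OF yz] by simp
      qed
      then have "coeff_in z j (init_in y f) = init_in y ?g"
        unfolding e by (simp add: init_in_def lead_coeff_in_def)
      moreover have "?g \<noteq> 0" using False by auto
      ultimately show ?thesis using gen_superset[OF s] g by auto
    qed
  qed
  then have "init_in_ideal (insert z X) y (ext z I) \<subseteq> ext z (init_in_ideal X y I)"
    unfolding init_in_ideal_def by (intro gen_least ext_ideal[OF L z]) auto
  moreover have "ext z (init_in_ideal X y I) \<subseteq> init_in_ideal (insert z X) y (ext z I)"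
    unfolding init_in_ideal_def ext_gen[OF s z, symmetric]
    using gen_superset[OF s'] ext_superset[OF I z] by (intro gen_least gen_ideal[OF s']) blast
  ultimately show ?thesis by blast
qed

lemma gen_add:
  assumes "S \<subseteq> polys X" "T \<subseteq> polys X"
  shows "gen X S <+>\<^bsub>mpoly_ring X\<^esub> gen X T = gen X (S \<union> T)"
proof (rule gen_eqI[symmetric])
  interpret R: cring "mpoly_ring X :: ('a, 'b) mpoly ring" by (rule cring_mpoly_ring)
  note S = gen_ideal[OF assms(1)] and T = gen_ideal[OF assms(2)]
  have eq: "gen X S <+>\<^bsub>mpoly_ring X\<^esub> gen X T = {p + q | p q. p \<in> gen X S \<and> q \<in> gen X T}"
    unfolding set_add_def' by auto
  show "ideal (gen X S <+>\<^bsub>mpoly_ring X\<^esub> gen X T) (mpoly_ring X)"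
    by (rule R.add_ideals[OF S T])
  show "S \<union> T \<subseteq> gen X S <+>\<^bsub>mpoly_ring X\<^esub> gen X T"
    unfolding eq using gen_superset[OF assms(1)] gen_superset[OF assms(2)] ideal_zero[OF S] ideal_zero[OF T]
    by (auto intro: exI[of _ 0] exI[of _ "_ :: ('a, 'b) mpoly"]) (metis add_0_right add_0_left subsetD)+
  show "gen X S <+>\<^bsub>mpoly_ring X\<^esub> gen X T \<subseteq> J" if J: "ideal J (mpoly_ring X)" "S \<union> T \<subseteq> J" for J
    unfolding eq using gen_least[OF J(1), of S] gen_least[OF J(1), of T] J(2)
    by (auto intro!: ideal_add[OF J(1)])
qed

text \<open>
  The decomposition of \<open>I\<close> is repeated with the same variables and Groebner bases, and with orders
  extended so that \<open>z\<close> only breaks ties; every ideal that occurs is replaced by its extension.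
\<close>

theorem gvd_ext:
  fixes I :: "('v, 'k::field) mpoly set"
  assumes "gvd X I" "finite X" "z \<notin> X"
  shows "gvd (insert z X) (ext z I)"
  using assms
proof (induction rule: gvd.induct)
  case (unit I X)
  have "gen (insert z X) {1} = ext z (gen X {1})" by (rule ext_gen) (use unit in auto)
  then show ?case using unit ext_ideal[of I X z] unmixed_ext[of X I z] by (intro gvd.unit) auto
next
  case (variables I X Y)
  have "gen (insert z X) (var ` Y) = ext z (gen X (var ` Y))"
    by (rule ext_gen) (use variables in \<open>auto intro: polys_var\<close>)
  then show ?case using variables ext_ideal[of I X z] unmixed_ext[of X I z]
    by (intro gvd.variables[of _ _ Y]) auto
next
  case (decompose I X y r B)
  note I = \<open>ideal I (mpoly_ring X)\<close> and z = \<open>z \<notin> X\<close> and y = \<open>y \<in> X\<close> and r = \<open>monomial_order X r\<close>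
  have BI: "B \<subseteq> I - {0}" using \<open>groebner_basis X r B I\<close> by (simp add: groebner_basis_def)
  have lead: "lead_coeff_in y b \<in> polys (X - {y})" if "b \<in> B" for b
    unfolding lead_coeff_in_def using BI ideal_subset[OF I] that by (intro coeff_in_polys) auto
  have ins: "insert z X - {y} = insert z (X - {y})" using y z by auto
  have sC: "lead_coeff_in y ` B \<subseteq> polys X" and sN: "lead_coeff_in y ` {g \<in> B. degree_in y g = 0} \<subseteq> polys X"
    using lead polys_mono[of "X - {y}" X] by auto
  have C: "C_ideal (insert z X) y B = ext z (C_ideal X y B)"
    unfolding C_ideal_def by (rule ext_gen[OF sC z])
  have N: "N_ideal (insert z X) y B = ext z (N_ideal X y B)"
    unfolding N_ideal_def by (rule ext_gen[OF sN z])
  have contr: "contraction (insert z X - {y}) (ext z J) = ext z (contraction (X - {y}) J)"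
    if "ideal J (mpoly_ring X)" for J :: "('v, 'k) mpoly set"
  proof -
    have "p \<in> polys (insert z (X - {y})) \<longleftrightarrow> (\<forall>j. coeff_in z j p \<in> polys (X - {y}))" for p :: "('v, 'k) mpoly"
    proof
      assume a: "\<forall>j. coeff_in z j p \<in> polys (X - {y})"
      have "(\<Sum>j\<le>degree_in z p. coeff_in z j p * var z ^ j) \<in> polys (insert z (X - {y}))"
        using a polys_mono[of "X - {y}" "insert z (X - {y})"]
        by (intro polys_sum polys_mult polys_power polys_var) auto
      then show "p \<in> polys (insert z (X - {y}))" using expand_in_degree[of p z] by simp
    qed (auto intro: coeff_in_polys_insert)
    then show ?thesis unfolding ins by (auto simp: contraction_def ext_def)
  qed
  have sy: "{var y} \<subseteq> polys X" using y by (auto intro: polys_var)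
  have Ny: "N_ideal (insert z X) y B <+>\<^bsub>mpoly_ring (insert z X)\<^esub> gen (insert z X) {var y} =
      ext z (N_ideal X y B <+>\<^bsub>mpoly_ring X\<^esub> gen X {var y})"
  proof -
    have "ext z (N_ideal X y B <+>\<^bsub>mpoly_ring X\<^esub> gen X {var y}) =
        gen (insert z X) (lead_coeff_in y ` {g \<in> B. degree_in y g = 0} \<union> {var y})"
      unfolding N_ideal_def gen_add[OF sN sy] using sN sy z by (intro ext_gen[symmetric]) auto
    also have "\<dots> = N_ideal (insert z X) y B <+>\<^bsub>mpoly_ring (insert z X)\<^esub> gen (insert z X) {var y}"
      unfolding N_ideal_def using sN sy polys_mono[of X "insert z X"] by (intro gen_add[symmetric]) blast+
    finally show ?thesis by simp
  qed
  show ?case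
  proof (rule gvd.decompose)
    show "ideal (ext z I) (mpoly_ring (insert z X))" by (rule ext_ideal[OF I z])
    show "unmixed (mpoly_ring (insert z X)) (ext z I)" 
      by (rule unmixed_ext[OF \<open>finite X\<close> I z \<open>unmixed (mpoly_ring X) I\<close>])
    show "y \<in> insert z X" using y by blast
    show "monomial_order (insert z X) (order_last z X r)" by (rule monomial_order_last[OF r z])
    show "compatible_order TYPE('k) (insert z X) y (order_last z X r)"
      by (rule compatible_order_last[OF r z y \<open>compatible_order TYPE('k) X y r\<close>])
    show "groebner_basis (insert z X) (order_last z X r) B (ext z I)"
      by (rule groebner_ext[OF I r z monomial_order_last[OF r z] order_last_extends[OF r z] \<open>groebner_basis X r B I\<close>])
    show "init_in_ideal (insert z X) y (ext z I) = C_ideal (insert z X) y B \<inter>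
        (N_ideal (insert z X) y B <+>\<^bsub>mpoly_ring (insert z X)\<^esub> gen (insert z X) {var y})"
      unfolding init_in_ideal_ext[OF I z y] Ny C ext_Int[symmetric] decompose.hyps(7) ..
    show "gvd (insert z X - {y}) (contraction (insert z X - {y}) (C_ideal (insert z X) y B))"
      unfolding C contr[OF gen_ideal[OF sC, folded C_ideal_def]] unfolding ins
      using decompose.IH(1) decompose.prems by auto
    show "gvd (insert z X - {y}) (contraction (insert z X - {y}) (N_ideal (insert z X) y B))"
      unfolding N contr[OF gen_ideal[OF sN, folded N_ideal_def]] unfolding ins
      using decompose.IH(2) decompose.prems by auto
  qed
qed


section \<open>Ring homomorphisms induced by maps of monomials\<close>

text \<open>
  The linear extension of a map \<open>\<phi>\<close> of monomials; a ring homomorphism when \<open>\<phi>\<close> is additive.  Both renaming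
  of variables and \<open>edge_hom\<close> have this form.
\<close>

definition push :: "(('v \<Rightarrow>\<^sub>0 nat) \<Rightarrow> ('w \<Rightarrow>\<^sub>0 nat)) \<Rightarrow> ('v, 'k::comm_ring_1) mpoly \<Rightarrow> ('w, 'k) mpoly" where
  "push \<phi> p = (\<Sum>m\<in>keys p. single (\<phi> m) (lookup p m))"

lemma push_zero [simp]: "push \<phi> 0 = 0"
  by (simp add: push_def)

lemma push_single [simp]: "push \<phi> (single m c) = single (\<phi> m) c"
  by (cases "c = 0") (simp_all add: push_def)

lemma push_add: "push \<phi> (p + q) = push \<phi> p + push \<phi> q"
  unfolding push_def by (rule setsum_keys_plus_distrib) (simp_all add: single_add)

lemma push_sum: "push \<phi> (sum f A) = (\<Sum>i\<in>A. push \<phi> (f i))"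
  by (induction A rule: infinite_finite_induct) (auto simp: push_add)

lemma push_uminus: "push \<phi> (- p) = - push \<phi> p"
  using push_add[of \<phi> p "- p"] by (simp add: eq_neg_iff_add_eq_0 add.commute)

lemma push_minus: "push \<phi> (p - q) = push \<phi> p - push \<phi> q"
  using push_add[of \<phi> p "- q"] by (simp add: push_uminus)

lemma push_mult:
  assumes "\<And>m n. \<phi> (m + n) = \<phi> m + \<phi> n"
  shows "push \<phi> (p * q) = push \<phi> p * push \<phi> q"
proof (induction p rule: mpoly_induct)
  case (single m c)
  show ?case
    by (induction q rule: mpoly_induct) (simp_all add: mult_single assms push_add distrib_left)
qed (simp add: push_add distrib_right)

lemma push_one: "\<phi> 0 = 0 \<Longrightarrow> push \<phi> 1 = 1"
  using push_single[of \<phi> 0 1] by simp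

lemma push_comp: "push \<phi> (push \<psi> p) = push (\<phi> \<circ> \<psi>) p"
  by (induction p rule: mpoly_induct) (simp_all add: push_add)

lemma push_id: "(\<And>m. m \<in> keys p \<Longrightarrow> \<phi> m = m) \<Longrightarrow> push \<phi> p = p"
  unfolding push_def by (subst (2) sum_singles[symmetric]) (auto intro: sum.cong)

lemma push_polys: "(\<And>m. m \<in> keys p \<Longrightarrow> \<phi> m \<in> monomials Y) \<Longrightarrow> push \<phi> p \<in> polys Y"
  unfolding push_def by (intro polys_sum polys_single) auto

lemma lookup_push: "lookup (push \<phi> p) n = (\<Sum>m\<in>{m \<in> keys p. \<phi> m = n}. lookup p m)"
  unfolding push_def lookup_sum lookup_single when_def
  by (subst sum.inter_filter[symmetric]) auto


section \<open>Renaming the variables\<close>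

definition ren :: "('v \<Rightarrow> 'w) \<Rightarrow> ('v \<Rightarrow>\<^sub>0 nat) \<Rightarrow> ('w \<Rightarrow>\<^sub>0 nat)" where
  "ren h m = (\<Sum>v\<in>keys m. single (h v) (lookup m v))"

lemma ren_zero [simp]: "ren h 0 = 0"
  by (simp add: ren_def)

lemma ren_single [simp]: "ren h (single v j) = single (h v) j"
  by (cases "j = 0") (simp_all add: ren_def)

lemma ren_add: "ren h (m + n) = ren h m + ren h n"
  unfolding ren_def by (rule setsum_keys_plus_distrib) (simp_all add: single_add)

lemma ren_comp: "ren g (ren h m) = ren (g \<circ> h) m"
  by (induction m rule: mpoly_induct) (simp_all add: ren_add)

lemma ren_id: "(\<And>v. v \<in> keys m \<Longrightarrow> h v = v) \<Longrightarrow> ren h m = m"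
  unfolding ren_def by (subst (2) sum_singles[symmetric]) (auto intro: sum.cong)

lemma ren_monomials: "m \<in> monomials X \<Longrightarrow> ren h m \<in> monomials (h ` X)"
  unfolding ren_def by (auto simp: monomials_iff lookup_sum lookup_single when_def in_keys_iff intro!: sum.neutral)

abbreviation rename :: "('v \<Rightarrow> 'w) \<Rightarrow> ('v, 'k::comm_ring_1) mpoly \<Rightarrow> ('w, 'k) mpoly" where
  "rename h \<equiv> push (ren h)"

lemma rename_mult: "rename h (p * q) = rename h p * rename h q"
  by (rule push_mult) (rule ren_add)

lemma rename_one: "rename h 1 = 1"
  by (rule push_one) simp

lemma rename_var: "rename h (var v) = var (h v)"
  by (simp add: var_def)

lemma rename_power: "rename h (p ^ n) = rename h p ^ n"
  by (induction n) (simp_all add: rename_one rename_mult)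

lemma rename_polys: "p \<in> polys X \<Longrightarrow> rename h p \<in> polys (h ` X)"
  by (intro push_polys ren_monomials) (rule polys_keysD)

text \<open>
  An injection \<open>h\<close> of the variables is accompanied by a left inverse \<open>g\<close>, so that a renaming is undone by
  a renaming.  As a constant, the condition can be passed to rules without higher-order unification.
\<close>

definition inverse_on :: "'v set \<Rightarrow> ('v \<Rightarrow> 'w) \<Rightarrow> ('w \<Rightarrow> 'v) \<Rightarrow> bool" where
  "inverse_on X h g \<longleftrightarrow> (\<forall>v\<in>X. g (h v) = v)"

lemma inverse_onD: "inverse_on X h g \<Longrightarrow> v \<in> X \<Longrightarrow> g (h v) = v"
  and inverse_on_subset: "inverse_on X h g \<Longrightarrow> Y \<subseteq> X \<Longrightarrow> inverse_on Y h g"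
  and inverse_on_sym: "inverse_on X h g \<Longrightarrow> inverse_on (h ` X) g h"
  by (auto simp: inverse_on_def)

lemma inverse_on_inj: "inverse_on X h g \<Longrightarrow> inj_on h X"
  by (rule inj_on_inverseI[where g = g]) (rule inverse_onD)

context
  fixes X :: "'v set" and h :: "'v \<Rightarrow> 'w" and g :: "'w \<Rightarrow> 'v"
  assumes gh: "inverse_on X h g"
begin

lemma ren_inverse: "m \<in> monomials X \<Longrightarrow> ren g (ren h m) = m"
  unfolding ren_comp by (rule ren_id) (use inverse_onD[OF gh] in \<open>auto simp: monomials_def\<close>)

lemma rename_inverse: "p \<in> polys X \<Longrightarrow> rename g (rename h p) = p"
  unfolding push_comp by (rule push_id) (auto intro: ren_inverse polys_keysD)

lemma ren_inverse': "m \<in> monomials (h ` X) \<Longrightarrow> ren h (ren g m) = m"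
  unfolding ren_comp by (rule ren_id) (use inverse_onD[OF gh] in \<open>auto simp: monomials_def\<close>)

lemma rename_inverse': "p \<in> polys (h ` X) \<Longrightarrow> rename h (rename g p) = p"
  unfolding push_comp by (rule push_id) (auto intro: ren_inverse' polys_keysD)

lemma image_inverse: "Y \<subseteq> X \<Longrightarrow> g ` h ` Y = Y"
  using inverse_onD[OF gh] by (force simp: image_iff)

lemma rename_inj:
  assumes "p \<in> polys X" "q \<in> polys X" "rename h p = rename h q" shows "p = q"
  by (metis rename_inverse[OF assms(1)] rename_inverse[OF assms(2)] assms(3))

lemma rename_mem_iff:
  assumes "I \<subseteq> polys X" "p \<in> polys X"
  shows "rename h p \<in> rename h ` I \<longleftrightarrow> p \<in> I"
  using rename_inj[OF assms(2)] assms(1) by blast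

lemma rename_polys_iff:
  assumes "p \<in> polys X" "Y \<subseteq> X"
  shows "rename h p \<in> polys (h ` Y) \<longleftrightarrow> p \<in> polys Y"
  using rename_polys[of "rename h p" "h ` Y" g] rename_polys[of p Y h] rename_inverse[OF assms(1)]
    image_inverse[OF assms(2)] by auto

lemma rename_polys_image: "rename h ` polys X = polys (h ` X)"
proof
  show "polys (h ` X) \<subseteq> rename h ` polys X"
  proof
    fix p assume p: "p \<in> polys (h ` X)"
    have "rename g p \<in> polys X" using rename_polys[OF p, of g] image_inverse[of X] by simp
    then show "p \<in> rename h ` polys X" using rename_inverse'[OF p] by force
  qed
qed (auto intro: rename_polys)

lemma rename_ideal:
  assumes I: "ideal I (mpoly_ring X)"
  shows "ideal (rename h ` I) (mpoly_ring (h ` X))"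
  unfolding ideal_mpoly_iff
proof (intro conjI ballI)
  show "rename h ` I \<subseteq> polys (h ` X)" using ideal_subset[OF I] rename_polys by blast
  show "0 \<in> rename h ` I" using ideal_zero[OF I] push_zero by force
  show "p + q \<in> rename h ` I" if "p \<in> rename h ` I" "q \<in> rename h ` I" for p q
    using that ideal_add[OF I] by (auto simp: push_add[symmetric])
  show "p * q \<in> rename h ` I" if p: "p \<in> polys (h ` X)" and q: "q \<in> rename h ` I" for p q
  proof -
    obtain p' where "p = rename h p'" "p' \<in> polys X" using p rename_polys_image by blast
    then show ?thesis using q ideal_mult[OF I] by (auto simp: rename_mult[symmetric])
  qed
qed

lemma rename_ideal_preimage:
  assumes J: "ideal J (mpoly_ring (h ` X))"
  shows "ideal {p \<in> polys X. rename h p \<in> J} (mpoly_ring X)"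
  unfolding ideal_mpoly_iff
  by (auto simp: push_add rename_mult ideal_zero[OF J] intro: ideal_add[OF J] ideal_mult[OF J rename_polys]
      polys_add polys_mult)

lemma rename_gen:
  assumes S: "S \<subseteq> polys X"
  shows "gen (h ` X) (rename h ` S) = rename h ` gen X S"
proof (rule gen_eqI)
  show "ideal (rename h ` gen X S) (mpoly_ring (h ` X))" by (rule rename_ideal[OF gen_ideal[OF S]])
  show "rename h ` S \<subseteq> rename h ` gen X S" using gen_superset[OF S] by blast
  fix J assume J: "ideal J (mpoly_ring (h ` X))" "rename h ` S \<subseteq> J"
  have "gen X S \<subseteq> {p \<in> polys X. rename h p \<in> J}"
    using J(2) S by (intro gen_least rename_ideal_preimage[OF J(1)]) auto
  then show "rename h ` gen X S \<subseteq> J" by blast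
qed

lemma rename_indep:
  assumes I: "ideal I (mpoly_ring X)" and Y: "Y \<subseteq> X" "indep I Y"
  shows "indep (rename h ` I) (h ` Y)"
proof
  fix q assume "q \<in> rename h ` I \<inter> polys (h ` Y)"
  then obtain p where p: "p \<in> I" "q = rename h p" "rename h p \<in> polys (h ` Y)" by blast
  then have "p \<in> polys Y" using rename_polys_iff[OF _ Y(1)] ideal_subset[OF I] by blast
  then show "q \<in> {0}" using p Y(2) by auto
qed

lemma rename_prime:
  fixes P :: "('v, 'k::comm_ring_1) mpoly set"
  assumes P: "primeideal P (mpoly_ring X)"
  shows "primeideal (rename h ` P) (mpoly_ring (h ` X))"
  unfolding primeideal_mpoly_iff
proof (intro conjI ballI impI)
  note PX = ideal_subset[OF prime_ideal[OF P]]
  show "ideal (rename h ` P) (mpoly_ring (h ` X))" by (rule rename_ideal[OF prime_ideal[OF P]])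
  show "1 \<notin> rename h ` P" using rename_mem_iff[OF PX, of 1] prime_one[OF P] by (simp add: rename_one)
  fix p q :: "('w, 'k) mpoly" assume pq: "p \<in> polys (h ` X)" "q \<in> polys (h ` X)" "p * q \<in> rename h ` P"
  obtain p' q' :: "('v, 'k) mpoly" where p': "p = rename h p'" "p' \<in> polys X" "q = rename h q'" "q' \<in> polys X"
    using pq(1,2) unfolding rename_polys_image[symmetric] by blast
  have "p' * q' \<in> P" using pq(3) rename_mem_iff[OF PX, of "p' * q'"] p' by (simp add: rename_mult polys_mult)
  then have "p' \<in> P \<or> q' \<in> P" by (rule prime_mult[OF P _ p'(2,4)])
  then show "p \<in> rename h ` P \<or> q \<in> rename h ` P" unfolding p'(1,3) by blast
qed

end

text \<open>The pair \<open>(h, g)\<close> is symmetric between \<open>X\<close> and \<open>h ` X\<close>.\<close>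

context
  fixes X :: "'v set" and h :: "'v \<Rightarrow> 'w" and g :: "'w \<Rightarrow> 'v"
  assumes gh: "inverse_on X h g" and X: "finite X"
begin

private lemma hg: "inverse_on (h ` X) g h"
  by (rule inverse_on_sym[OF gh])

private lemma ghX: "g ` h ` X = X"
  using image_inverse[OF gh order_refl] .

lemma rename_forth: "J \<subseteq> polys X \<Longrightarrow> rename g ` rename h ` J = J"
  using rename_inverse[OF gh] by (force simp: image_iff)

lemma krull_dim_rename:
  fixes I :: "('v, 'k::field) mpoly set"
  assumes I: "ideal I (mpoly_ring X)"
  shows "krull_dim (mpoly_ring (h ` X) Quot rename h ` I) = krull_dim (mpoly_ring X Quot I)"
proof (rule krull_dim_cong)
  have inj: "inj_on h X" by (rule inverse_on_inj[OF gh])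
  show I': "ideal (rename h ` I) (mpoly_ring (h ` X))" by (rule rename_ideal[OF gh I])
  fix Y assume Y: "Y \<subseteq> X" "indep I Y"
  have "card Y \<le> card (h ` Y)" using Y(1) inj by (metis card_image inj_on_subset order_refl)
  then show "\<exists>Y'\<subseteq>h ` X. indep (rename h ` I) Y' \<and> card Y \<le> card Y'"
    using rename_indep[OF gh I Y] Y(1) by (intro exI[of _ "h ` Y"]) auto
next
  have inj: "inj_on g (h ` X)" by (rule inverse_on_inj[OF hg])
  fix Y assume Y: "Y \<subseteq> h ` X" "indep (rename h ` I) Y"
  have "card Y \<le> card (g ` Y)" using Y(1) inj by (metis card_image inj_on_subset order_refl)
  moreover have "indep (rename g ` rename h ` I) (g ` Y)"
    using rename_indep[OF hg _ Y] rename_ideal[OF gh I] by simp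
  moreover have "g ` Y \<subseteq> X" using Y(1) ghX by blast
  ultimately show "\<exists>Y'\<subseteq>X. indep I Y' \<and> card Y \<le> card Y'"
    unfolding rename_forth[OF ideal_subset[OF I]] by (intro exI[of _ "g ` Y"]) auto
qed (use X I in auto)

lemma unmixed_rename:
  fixes I :: "('v, 'k::field) mpoly set"
  assumes I: "ideal I (mpoly_ring X)" and u: "unmixed (mpoly_ring X) I"
  shows "unmixed (mpoly_ring (h ` X)) (rename h ` I)"
  unfolding unmixed_def
proof
  fix Q assume "Q \<in> associated_primes (mpoly_ring (h ` X)) (rename h ` I)"
  then obtain f where Q: "primeideal Q (mpoly_ring (h ` X))" "f \<in> polys (h ` X)"
    "Q = {r \<in> polys (h ` X). r * f \<in> rename h ` I}" unfolding associated_primes_mpoly_iff by blast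
  obtain f' where f': "f = rename h f'" "f' \<in> polys X" using Q(2) rename_polys_image[OF gh] by blast
  let ?P = "{r \<in> polys X. r * f' \<in> I}"
  have mem: "rename h r \<in> Q \<longleftrightarrow> r \<in> ?P" if "r \<in> polys X" for r
    using rename_mem_iff[OF gh ideal_subset[OF I] polys_mult[OF that f'(2)]] that rename_polys[OF that, of h]
    unfolding Q(3) f'(1) by (simp add: rename_mult)
  have QP: "Q = rename h ` ?P"
  proof (intro equalityI subsetI)
    fix q assume q: "q \<in> Q"
    then have "q \<in> polys (h ` X)" unfolding Q(3) by blast
    then obtain r where r: "q = rename h r" "r \<in> polys X" using rename_polys_image[OF gh] by blast
    then show "q \<in> rename h ` ?P" using mem[OF r(2)] q by blast
  qed (use mem in auto)
  have "primeideal (rename g ` Q) (mpoly_ring (g ` h ` X))" by (rule rename_prime[OF hg Q(1)])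
  then have P: "primeideal ?P (mpoly_ring X)"
    unfolding QP using rename_forth[of ?P] ghX by auto
  then have "?P \<in> associated_primes (mpoly_ring X) I"
    unfolding associated_primes_mpoly_iff using f'(2) by blast
  then have "krull_dim (mpoly_ring X Quot I) = krull_dim (mpoly_ring X Quot ?P)"
    using u unfolding unmixed_def by blast
  then show "krull_dim (mpoly_ring (h ` X) Quot rename h ` I) = krull_dim (mpoly_ring (h ` X) Quot Q)"
    unfolding QP krull_dim_rename[OF I] krull_dim_rename[OF prime_ideal[OF P]] .
qed

end

context
  fixes X :: "'v set" and h :: "'v \<Rightarrow> 'w" and g :: "'w \<Rightarrow> 'v"
  assumes gh: "inverse_on X h g"
begin

lemma lookup_ren:
  assumes m: "m \<in> monomials X" and v: "v \<in> X"
  shows "lookup (ren h m) (h v) = lookup m v"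
proof -
  have "lookup (ren h m) (h v) = (\<Sum>w\<in>keys m. if w = v then lookup m v else 0)"
    unfolding ren_def lookup_sum lookup_single when_def
  proof (intro sum.cong refl)
    fix w assume "w \<in> keys m"
    then have "w \<in> X" using m by (auto simp: monomials_def)
    then have "h w = h v \<longleftrightarrow> w = v" using inverse_onD[OF gh] v by metis
    then show "(if h w = h v then lookup m w else 0) = (if w = v then lookup m v else 0)" by auto
  qed
  then show ?thesis by (simp add: in_keys_iff)
qed

lemma coeff_in_rename:
  assumes p: "p \<in> polys X" and y: "y \<in> X"
  shows "coeff_in (h y) j (rename h p) = rename h (coeff_in y j p)"
proof -
  have "coeff_in (h y) j (rename h (single m c)) = rename h (coeff_in y j (single m c))"
    if m: "m \<in> monomials X" for m and c
  proof -
    have "ren h m = ren h (strip y m) + single (h y) (lookup m y)"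
      by (subst strip_split[of y m, symmetric]) (simp add: ren_add)
    then have "ren h m - single (h y) (lookup m y) = ren h (strip y m)" by simp
    then show ?thesis using lookup_ren[OF m y] by (auto simp: coeff_in_single strip_def)
  qed
  then have "coeff_in (h y) j (rename h (\<Sum>m\<in>keys p. single m (lookup p m))) =
      rename h (coeff_in y j (\<Sum>m\<in>keys p. single m (lookup p m)))"
    using polys_keysD[OF p] unfolding push_sum coeff_in_sum by (intro sum.cong) auto
  then show ?thesis by (simp add: sum_singles)
qed

lemma rename_eq_0_iff: "p \<in> polys X \<Longrightarrow> rename h p = 0 \<longleftrightarrow> p = 0"
  using rename_inverse[OF gh, of p] by auto

lemma degree_in_rename:
  assumes p: "p \<in> polys X" and y: "y \<in> X"
  shows "degree_in (h y) (rename h p) = degree_in y p"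
proof -
  have "coeff_in y j p \<in> polys X" for j
    using coeff_in_polys[OF p, of y j] polys_mono[of "X - {y}" X] by blast
  then have "rename h (coeff_in y j p) = 0 \<longleftrightarrow> coeff_in y j p = 0" for j by (rule rename_eq_0_iff)
  then show ?thesis unfolding degree_in_def coeff_in_rename[OF p y] by simp
qed

lemma lead_coeff_in_rename:
  assumes p: "p \<in> polys X" and y: "y \<in> X"
  shows "lead_coeff_in (h y) (rename h p) = rename h (lead_coeff_in y p)"
  unfolding lead_coeff_in_def degree_in_rename[OF assms] coeff_in_rename[OF assms] ..

lemma init_in_rename:
  assumes p: "p \<in> polys X" and y: "y \<in> X"
  shows "init_in (h y) (rename h p) = rename h (init_in y p)"
  unfolding init_in_def lead_coeff_in_rename[OF assms] degree_in_rename[OF assms]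
  by (simp add: rename_mult rename_power rename_var)

text \<open>
  The transport of \<open>r\<close> along the renaming.  The constant second component makes it an instance of
  \<open>lex_order\<close>, which is known to be a well-order.
\<close>

definition ren_order :: "(('v \<Rightarrow>\<^sub>0 nat) \<times> ('v \<Rightarrow>\<^sub>0 nat)) set \<Rightarrow> (('w \<Rightarrow>\<^sub>0 nat) \<times> ('w \<Rightarrow>\<^sub>0 nat)) set" where
  "ren_order r = lex_order (monomials (h ` X)) (ren g) (\<lambda>_. 0) r nat_order"

lemma ren_g_monomials: "m \<in> monomials (h ` X) \<Longrightarrow> ren g m \<in> monomials X"
  using ren_monomials[of m "h ` X" g] image_inverse[OF gh order_refl] by simp

lemma ren_order_iff:
  assumes r: "monomial_order X r"
  shows "(m, n) \<in> ren_order r \<longleftrightarrow> m \<in> monomials (h ` X) \<and> n \<in> monomials (h ` X) \<and> (ren g m, ren g n) \<in> r"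
  using mo_refl[OF r ren_g_monomials[of m]] by (auto simp: ren_order_def lex_order_def)

lemma monomial_order_rename:
  assumes r: "monomial_order X r"
  shows "monomial_order (h ` X) (ren_order r)"
  unfolding monomial_order_def
proof (intro conjI allI ballI impI)
  have inj: "m = n" if "m \<in> monomials (h ` X)" "n \<in> monomials (h ` X)" "ren g m = ren g n" for m n
    using ren_inverse'[OF gh that(1)] ren_inverse'[OF gh that(2)] that(3) by metis
  show "well_order_on (monomials (h ` X)) (ren_order r)"
    unfolding ren_order_def
    by (rule well_order_lex_order[of "monomials X", OF _ well_order_nat])
      (use r in \<open>simp add: monomial_order_def\<close>, erule ren_g_monomials, simp, erule (2) inj)
  fix s t u assume "u \<in> monomials (h ` X)" "(s, t) \<in> ren_order r"
  then show "(s + u, t + u) \<in> ren_order r"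
    using mo_add[OF r, of "ren g s" "ren g t" "ren g u"] ren_g_monomials[of u]
    unfolding ren_order_iff[OF r] by (auto simp: ren_add intro: monomials_add)
qed

lemma lookup_rename:
  assumes f: "f \<in> polys X" and m: "m \<in> monomials X"
  shows "lookup (rename h f) (ren h m) = lookup f m"
proof -
  have "n = m" if "n \<in> keys f" "ren h n = ren h m" for n
    using ren_inverse[OF gh polys_keysD[OF f that(1)]] ren_inverse[OF gh m] that(2) by metis
  then have "{n \<in> keys f. ren h n = ren h m} = (if m \<in> keys f then {m} else {})" by auto
  then show ?thesis by (simp add: lookup_push in_keys_iff)
qed

lemma keys_rename:
  assumes f: "f \<in> polys X"
  shows "keys (rename h f) = ren h ` keys f"
proof
  show "keys (rename h f) \<subseteq> ren h ` keys f"
  proof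
    fix n assume "n \<in> keys (rename h f)"
    then have "(\<Sum>m\<in>{m \<in> keys f. ren h m = n}. lookup f m) \<noteq> 0" by (simp add: in_keys_iff lookup_push)
    then have "{m \<in> keys f. ren h m = n} \<noteq> {}" by (metis (no_types, lifting) sum.empty)
    then show "n \<in> ren h ` keys f" by blast
  qed
  show "ren h ` keys f \<subseteq> keys (rename h f)"
    using lookup_rename[OF f polys_keysD[OF f]] by (auto simp: in_keys_iff)
qed

lemma init_term_rename:
  assumes r: "monomial_order X r" and f: "f \<in> polys X"
  shows "init_term (ren_order r) (rename h f) = rename h (init_term r f)"
proof (cases "f = 0")
  case True
  then show ?thesis by (simp add: init_term_def)
next
  case False
  let ?m = "lead_monomial r f"
  have m: "?m \<in> keys f" by (rule lead_monomial_key[OF r f False])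
  have mX: "n \<in> monomials X" if "n \<in> keys f" for n using polys_keysD[OF f that] .
  have "lead_monomial (ren_order r) (rename h f) = ren h ?m"
  proof (rule lead_monomial_eqI[OF monomial_order_rename[OF r]])
    show "ren h ?m \<in> keys (rename h f)" using m by (simp add: keys_rename[OF f])
    fix s assume "s \<in> keys (rename h f)"
    then obtain n where n: "s = ren h n" "n \<in> keys f" unfolding keys_rename[OF f] by blast
    then show "(s, ren h ?m) \<in> ren_order r"
      unfolding ren_order_iff[OF r] using lead_monomial_greatest[OF r f False n(2)]
      by (simp add: ren_inverse[OF gh] mX m ren_monomials)
  qed
  then show ?thesis unfolding init_term_def by (simp add: lookup_rename[OF f mX[OF m]])
qed

lemma groebner_rename:
  fixes I :: "('v, 'k::comm_ring_1) mpoly set"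
  assumes I: "ideal I (mpoly_ring X)" and r: "monomial_order X r" and B: "groebner_basis X r B I"
  shows "groebner_basis (h ` X) (ren_order r) (rename h ` B) (rename h ` I)"
proof -
  note gb = B[unfolded groebner_basis_def]
  have IX: "I \<subseteq> polys X" by (rule ideal_subset[OF I])
  have im: "init_term (ren_order r) ` rename h ` S = rename h ` init_term r ` S" if "S \<subseteq> polys X" for S :: "('v, 'k) mpoly set"
    unfolding image_image using init_term_rename[OF r] that by (intro image_cong) auto
  have s: "init_term r ` S \<subseteq> polys X" if "S \<subseteq> polys X" for S :: "('v, 'k) mpoly set"
    using that init_term_polys[OF r] by blast
  have ne: "rename h ` (I - {0}) = rename h ` I - {0}" using rename_eq_0_iff IX by auto
  have BX: "B \<subseteq> polys X" and IX': "I - {0} \<subseteq> polys X" using gb IX by auto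
  have "gen (h ` X) (init_term (ren_order r) ` rename h ` B) =
      gen (h ` X) (init_term (ren_order r) ` (rename h ` I - {0}))"
    unfolding ne[symmetric] im[OF BX] im[OF IX'] rename_gen[OF gh s[OF BX]] rename_gen[OF gh s[OF IX']]
    using gb by simp
  moreover have "rename h ` B \<subseteq> rename h ` I - {0}" unfolding ne[symmetric] using gb by blast
  ultimately show ?thesis unfolding groebner_basis_def using gb by blast
qed

lemma compatible_order_rename:
  assumes r: "monomial_order X r" and y: "y \<in> X" and c: "compatible_order TYPE('k::field) X y r"
  shows "compatible_order TYPE('k::field) (h ` X) (h y) (ren_order r)"
  unfolding compatible_order_iff[OF monomial_order_rename[OF r]]
proof (intro ballI impI)
  fix s t assume st: "s \<in> monomials (h ` X)" "t \<in> monomials (h ` X)" "lookup s (h y) < lookup t (h y)"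
  have "lookup (ren g m) y = lookup m (h y)" if "m \<in> monomials (h ` X)" for m
    using lookup_ren[OF ren_g_monomials[OF that] y] ren_inverse'[OF gh that] by simp
  then have "(ren g s, ren g t) \<in> r" using st ren_g_monomials c unfolding compatible_order_iff[OF r] by simp
  then show "(s, t) \<in> ren_order r" using st by (simp add: ren_order_iff[OF r])
qed

lemma contraction_rename:
  assumes J: "J \<subseteq> polys X" and Y: "Y \<subseteq> X"
  shows "contraction (h ` Y) (rename h ` J) = rename h ` contraction Y J"
  using rename_polys_iff[OF gh _ Y] J unfolding contraction_def by auto

end

text \<open>
  Renaming is an isomorphism of polynomial rings that maps monomials to monomials, and it carries every
  ingredient of a decomposition along.
\<close>

theorem gvd_rename:
  fixes I :: "('v, 'k::field) mpoly set" and h :: "'v \<Rightarrow> 'w"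
  assumes "gvd X I" "finite X" "inverse_on X h g"
  shows "gvd (h ` X) (rename h ` I)"
  using assms
proof (induction rule: gvd.induct)
  case (unit I X)
  note gh = unit.prems(2)
  have "gen (h ` X) {1} = rename h ` gen X {1 :: ('v, 'k) mpoly}"
    using rename_gen[OF gh, of "{1}"] by (simp add: rename_one)
  then show ?case
    using rename_ideal[OF gh unit.hyps(1)] unmixed_rename[OF gh unit.prems(1) unit.hyps(1,2)] unit.hyps(3)
    by (intro gvd.unit) simp_all
next
  case (variables I X Y)
  note gh = variables.prems(2)
  have "var ` Y \<subseteq> (polys X :: ('v, 'k) mpoly set)" using variables.hyps(3) by (auto intro: polys_var)
  then have "gen (h ` X) (var ` h ` Y) = rename h ` gen X (var ` Y :: ('v, 'k) mpoly set)"
    using rename_gen[OF gh, of "var ` Y"] by (simp add: image_image rename_var)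
  then show ?case
    using rename_ideal[OF gh variables.hyps(1)] unmixed_rename[OF gh variables.prems(1) variables.hyps(1,2)]
      variables.hyps(3,4) by (intro gvd.variables[of _ _ "h ` Y"]) auto
next
  case (decompose I X y r B)
  note I = \<open>ideal I (mpoly_ring X)\<close> and y = \<open>y \<in> X\<close> and r = \<open>monomial_order X r\<close>
    and gh = decompose.prems(2) and X = \<open>finite X\<close>
  have BX: "B \<subseteq> polys X" using \<open>groebner_basis X r B I\<close> ideal_subset[OF I] by (auto simp: groebner_basis_def)
  have ins: "h ` X - {h y} = h ` (X - {y})" using inverse_onD[OF gh] y by (auto simp: image_iff) metis
  have lead: "lead_coeff_in (h y) ` rename h ` S = rename h ` lead_coeff_in y ` S" if "S \<subseteq> B" for S
    unfolding image_image using lead_coeff_in_rename[OF gh _ y] BX that by (intro image_cong) auto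
  have lX: "lead_coeff_in y ` S \<subseteq> polys X" if "S \<subseteq> B" for S
    using that BX coeff_in_polys[of _ X y] polys_mono[of "X - {y}" X] unfolding lead_coeff_in_def by blast
  let ?B0 = "{b \<in> B. degree_in y b = 0}"
  have B0: "{b \<in> rename h ` B. degree_in (h y) b = 0} = rename h ` ?B0"
  proof -
    have "degree_in (h y) (rename h b) = degree_in y b" if "b \<in> B" for b
      by (rule degree_in_rename[OF gh _ y]) (use BX that in blast)
    then show ?thesis by auto
  qed
  have C: "C_ideal (h ` X) (h y) (rename h ` B) = rename h ` C_ideal X y B"
    unfolding C_ideal_def lead[OF order_refl] by (rule rename_gen[OF gh lX[OF order_refl]])
  have N: "N_ideal (h ` X) (h y) (rename h ` B) = rename h ` N_ideal X y B"
    unfolding N_ideal_def B0 using lead[of ?B0] rename_gen[OF gh lX[of ?B0]] by simp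
  have CX: "C_ideal X y B \<subseteq> polys X" and NX: "N_ideal X y B \<subseteq> polys X"
    unfolding C_ideal_def N_ideal_def by (intro ideal_subset[OF gen_ideal] lX; blast)+
  have sy: "{var y :: ('v, 'k) mpoly} \<subseteq> polys X" using y by (auto intro: polys_var)
  have sy': "{var (h y) :: ('w, 'k) mpoly} \<subseteq> polys (h ` X)" using y by (auto intro: polys_var)
  have lX0: "lead_coeff_in y ` ?B0 \<subseteq> polys X" by (rule lX) blast
  have Ny: "N_ideal (h ` X) (h y) (rename h ` B) <+>\<^bsub>mpoly_ring (h ` X)\<^esub> gen (h ` X) {var (h y)} =
      rename h ` (N_ideal X y B <+>\<^bsub>mpoly_ring X\<^esub> gen X {var y})"
  proof -
    have "rename h ` lead_coeff_in y ` ?B0 \<subseteq> polys (h ` X)" using lX0 rename_polys by blast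
    moreover have "lead_coeff_in (h y) ` rename h ` ?B0 = rename h ` lead_coeff_in y ` ?B0" by (rule lead) blast
    ultimately have "N_ideal (h ` X) (h y) (rename h ` B) <+>\<^bsub>mpoly_ring (h ` X)\<^esub> gen (h ` X) {var (h y)} =
        gen (h ` X) (rename h ` lead_coeff_in y ` ?B0 \<union> {var (h y)})"
      unfolding N_ideal_def B0 by (simp only: gen_add[OF _ sy'])
    also have "\<dots> = gen (h ` X) (rename h ` (lead_coeff_in y ` ?B0 \<union> {var y}))"
      by (simp add: image_Un rename_var)
    also have "\<dots> = rename h ` (N_ideal X y B <+>\<^bsub>mpoly_ring X\<^esub> gen X {var y})"
      unfolding N_ideal_def gen_add[OF lX0 sy] using lX0 sy by (intro rename_gen[OF gh]) blast
    finally show ?thesis .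
  qed
  have init: "init_in_ideal (h ` X) (h y) (rename h ` I) = rename h ` init_in_ideal X y I"
  proof -
    have "rename h ` I - {0} = rename h ` (I - {0})"
      using rename_eq_0_iff[OF gh] ideal_subset[OF I] by auto
    moreover have "init_in (h y) ` rename h ` (I - {0}) = rename h ` init_in y ` (I - {0})"
      unfolding image_image using init_in_rename[OF gh _ y] ideal_subset[OF I] by (intro image_cong) auto
    moreover have "init_in y ` (I - {0}) \<subseteq> polys X"
      using init_in_polys[OF _ y] ideal_subset[OF I] by blast
    ultimately show ?thesis unfolding init_in_ideal_def using rename_gen[OF gh] by simp
  qed
  have Int: "rename h ` (S \<inter> T) = rename h ` S \<inter> rename h ` T" if "S \<subseteq> polys X" "T \<subseteq> polys X"
    for S T :: "('v, 'k) mpoly set"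
    using rename_mem_iff[OF gh that(2)] that by blast
  have NyX: "N_ideal X y B <+>\<^bsub>mpoly_ring X\<^esub> gen X {var y} \<subseteq> polys X"
    unfolding N_ideal_def gen_add[OF lX0 sy] by (rule ideal_subset[OF gen_ideal]) (use lX0 sy in blast)
  show ?case
  proof (rule gvd.decompose)
    show "ideal (rename h ` I) (mpoly_ring (h ` X))" by (rule rename_ideal[OF gh I])
    show "unmixed (mpoly_ring (h ` X)) (rename h ` I)"
      by (rule unmixed_rename[OF gh X I \<open>unmixed (mpoly_ring X) I\<close>])
    show "h y \<in> h ` X" using y by blast
    show "monomial_order (h ` X) (ren_order X h g r)" by (rule monomial_order_rename[OF gh r])
    show "compatible_order TYPE('k) (h ` X) (h y) (ren_order X h g r)"
      by (rule compatible_order_rename[OF gh r y \<open>compatible_order TYPE('k) X y r\<close>])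
    show "groebner_basis (h ` X) (ren_order X h g r) (rename h ` B) (rename h ` I)"
      by (rule groebner_rename[OF gh I r \<open>groebner_basis X r B I\<close>])
    show "init_in_ideal (h ` X) (h y) (rename h ` I) = C_ideal (h ` X) (h y) (rename h ` B) \<inter>
        (N_ideal (h ` X) (h y) (rename h ` B) <+>\<^bsub>mpoly_ring (h ` X)\<^esub> gen (h ` X) {var (h y)})"
      unfolding init C Ny Int[OF CX NyX, symmetric] decompose.hyps(7) ..
    show "gvd (h ` X - {h y}) (contraction (h ` X - {h y}) (C_ideal (h ` X) (h y) (rename h ` B)))"
      unfolding ins C contraction_rename[OF gh CX Diff_subset]
      using decompose.IH(1) X inverse_on_subset[OF gh Diff_subset] by simp
    show "gvd (h ` X - {h y}) (contraction (h ` X - {h y}) (N_ideal (h ` X) (h y) (rename h ` B)))"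
      unfolding ins N contraction_rename[OF gh NX Diff_subset]
      using decompose.IH(2) X inverse_on_subset[OF gh Diff_subset] by simp
  qed
qed


section \<open>Groebner bases generate\<close>

text \<open>
  The polynomials with all monomials divisible by some element of \<open>S\<close> form an ideal.
\<close>

lemma gen_monomials_keys:
  assumes T: "T \<subseteq> polys X" and S: "\<And>t k. t \<in> T \<Longrightarrow> k \<in> keys t \<Longrightarrow> \<exists>m\<in>S. \<exists>n. k = m + n"
    and p: "p \<in> gen X T" and k: "k \<in> keys p"
  shows "\<exists>m\<in>S. \<exists>n. k = m + n"
proof -
  let ?J = "{p \<in> polys X. \<forall>k\<in>keys p. \<exists>m\<in>S. \<exists>n. k = m + n}"
  have "ideal ?J (mpoly_ring X)"
    unfolding ideal_mpoly_iff
  proof (intro conjI ballI)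
    show "p + q \<in> ?J" if "p \<in> ?J" "q \<in> ?J" for p q
      using that Poly_Mapping.keys_add[of p q] by (auto intro: polys_add)
    show "p * q \<in> ?J" if p: "p \<in> polys X" and q: "q \<in> ?J" for p q
    proof -
      have "\<exists>m\<in>S. \<exists>n. k = m + n" if kpq: "k \<in> keys (p * q)" for k
      proof -
        obtain a b where ab: "k = a + b" "b \<in> keys q" using keys_mult[of p q] kpq by blast
        then obtain m n where "m \<in> S" "b = m + n" using q by blast
        then show ?thesis using ab(1) by (intro bexI[of _ m] exI[of _ "a + n"]) (auto simp: ac_simps)
      qed
      then show ?thesis using p q by (auto intro: polys_mult)
    qed
  qed auto
  then have "gen X T \<subseteq> ?J" using S T by (intro gen_least) auto
  then show ?thesis using p k by blast
qed

lemma keys_init_term: "keys (init_term r f) \<subseteq> {lead_monomial r f}"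
  by (auto simp: init_term_def)

text \<open>
  The division algorithm: a suitable multiple of an element of \<open>B\<close> cancels the initial term of \<open>f\<close>, and the
  order is well-founded.
\<close>

theorem groebner_generates:
  fixes I :: "('v, 'k::field) mpoly set"
  assumes I: "ideal I (mpoly_ring X)" and r: "monomial_order X r" and B: "groebner_basis X r B I"
  shows "gen X B = I"
proof
  note gb = B[unfolded groebner_basis_def]
  have BX: "B \<subseteq> polys X" using gb ideal_subset[OF I] by blast
  have tB: "init_term r ` B \<subseteq> polys X" using init_term_polys[OF r] BX by blast
  have tI: "init_term r ` (I - {0}) \<subseteq> polys X" using init_term_polys[OF r] ideal_subset[OF I] by blast
  show "gen X B \<subseteq> I" using gb by (intro gen_least[OF I]) blast
  note G = gen_ideal[OF BX]
  have main: "f \<in> I \<longrightarrow> f \<noteq> 0 \<longrightarrow> lead_monomial r f = m \<longrightarrow> f \<in> gen X B" for f m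
  proof (induction m arbitrary: f rule: wf_induct[OF mo_wf[OF r]])
    case (1 m)
    show ?case
    proof (intro impI)
      assume f: "f \<in> I" "f \<noteq> 0" and m: "lead_monomial r f = m"
      have fX: "f \<in> polys X" using f ideal_subset[OF I] by blast
      have mf: "m \<in> keys f" "\<And>s. s \<in> keys f \<Longrightarrow> (s, m) \<in> r" using lead_monomial[OF r fX f(2)] m by auto
      have mX: "m \<in> monomials X" using polys_keysD[OF fX mf(1)] .
      have "init_term r f \<in> gen X (init_term r ` (I - {0}))" using f gen_superset[OF tI] by blast
      then have a1: "init_term r f \<in> gen X (init_term r ` B)" using gb by simp
      have a2: "m \<in> keys (init_term r f)" using mf(1) m by (simp add: init_term_def in_keys_iff)
      have a3: "\<exists>l\<in>lead_monomial r ` B. \<exists>n. k = l + n" if tk: "t \<in> init_term r ` B" "k \<in> keys t" for t k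
      proof -
        obtain b where "b \<in> B" "t = init_term r b" using tk(1) by blast
        then have "k = lead_monomial r b + 0" "b \<in> B" using tk(2) keys_init_term[of r b] by auto
        then show ?thesis by blast
      qed
      have "\<exists>l\<in>lead_monomial r ` B. \<exists>n. m = l + n"
        by (rule gen_monomials_keys[OF tB a3 a1 a2])
      then obtain b n where b: "b \<in> B" "m = lead_monomial r b + n" by blast
      have bX: "b \<in> polys X" "b \<noteq> 0" using b gb BX by auto
      let ?l = "lead_monomial r b"
      have lb: "?l \<in> keys b" "\<And>s. s \<in> keys b \<Longrightarrow> (s, ?l) \<in> r" using lead_monomial[OF r bX] by auto
      have nX: "n \<in> monomials X" using mX b(2) monomials_addD by blast
      define t where "t = single n (lookup f m / lookup b ?l)"
      define f' where "f' = f - t * b"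
      have tX: "t \<in> polys X" unfolding t_def by (rule polys_single[OF nX])
      have f'I: "f' \<in> I" unfolding f'_def using b(1) gb by (intro ideal_minus[OF I] f(1) ideal_mult[OF I tX]) blast
      have f'X: "f' \<in> polys X" using f'I ideal_subset[OF I] by blast
      have lm: "lookup f' m = 0"
      proof -
        have "lookup (t * b) m = lookup f m / lookup b ?l * lookup b ?l"
          unfolding t_def b(2) using lookup_single_mult_add[of n _ b ?l] by (simp add: add.commute)
        then show ?thesis using lb(1) by (simp add: f'_def lookup_minus in_keys_iff)
      qed
      have "f' \<in> gen X B"
      proof (cases "f' = 0")
        case True
        then show ?thesis using ideal_zero[OF G] by simp
      next
        case False
        let ?m' = "lead_monomial r f'"
        have m': "?m' \<in> keys f'" by (rule lead_monomial_key[OF r f'X False])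
        have "(?m', m) \<in> r"
        proof (cases "?m' \<in> keys f")
          case True
          then show ?thesis by (rule mf(2))
        next
          case False
          then have "?m' \<in> keys (t * b)" using m' by (auto simp: f'_def lookup_minus in_keys_iff)
          then obtain s where s: "?m' = n + s" "s \<in> keys b" unfolding t_def by (rule keys_single_mult)
          then have "(s + n, ?l + n) \<in> r" by (intro mo_add[OF r] lb(2) nX)
          then show ?thesis using s(1) b(2) by (simp add: add.commute)
        qed
        moreover have "?m' \<noteq> m" using m' lm by (auto simp: in_keys_iff)
        ultimately show ?thesis using 1 f'I False by blast
      qed
      moreover have "t * b \<in> gen X B" using gen_superset[OF BX] b(1) by (intro ideal_mult[OF G tX]) blast
      ultimately show "f \<in> gen X B" using ideal_add[OF G, of f' "t * b"] by (simp add: f'_def)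
    qed
  qed
  then show "I \<subseteq> gen X B" using ideal_zero[OF G] by blast
qed

lemma gvd_unmixed: "gvd X I \<Longrightarrow> unmixed (mpoly_ring X) I"
  by (cases rule: gvd.cases) simp_all

lemma init_term_one:
  assumes "monomial_order X r" shows "init_term r (1 :: ('v, 'k::field) mpoly) = 1"
proof -
  have "lead_monomial r (1 :: ('v, 'k) mpoly) = 0"
    by (rule lead_monomial_eqI[OF assms]) (auto intro: mo_refl[OF assms])
  then show ?thesis by (simp add: init_term_def)
qed

lemma groebner_unit:
  fixes B :: "('v, 'k::field) mpoly set"
  assumes r: "monomial_order X r" and B: "finite B" "B \<subseteq> polys X - {0}" "1 \<in> B"
  shows "groebner_basis X r B (polys X)"
proof -
  have "gen X (init_term r ` S) = polys X" if "1 \<in> S" "S \<subseteq> polys X" for S :: "('v, 'k) mpoly set"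
  proof -
    have s: "init_term r ` S \<subseteq> polys X" using init_term_polys[OF r] that(2) by blast
    have "1 \<in> init_term r ` S" using that(1) init_term_one[OF r] by (metis image_eqI)
    then show ?thesis using ideal_eq_polys_iff[OF gen_ideal[OF s]] gen_superset[OF s] by blast
  qed
  from this[of B] this[of "polys X - {0}"] show ?thesis
    unfolding groebner_basis_def using B by auto
qed

text \<open>
  In the last case of the definition a Groebner basis is part of the data; an ideal generated by
  variables has these variables as a Groebner basis for any order.
\<close>

lemma gvd_groebner:
  fixes I :: "('v, 'k::field) mpoly set"
  assumes "gvd X I" and X: "finite X"
  shows "\<exists>r B. monomial_order X r \<and> groebner_basis X r B I"
  using assms(1)
proof (cases rule: gvd.cases)
  case unit
  obtain r where r: "monomial_order X r" using exists_monomial_order[OF X] by blast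
  have "I = polys X" using ideal_eq_polys_iff[OF unit(1)] gen_superset[of "{1}" X] unit(3) by auto
  then show ?thesis using r groebner_unit[OF r, of "{1}"] by auto
next
  case (variables Y)
  obtain r where r: "monomial_order X r" using exists_monomial_order[OF X] by blast
  let ?V = "var ` Y :: ('v, 'k) mpoly set"
  have V: "?V \<subseteq> polys X" using variables(3) by (auto intro: polys_var)
  have kv: "keys (var v :: ('v, 'k) mpoly) = {single v 1}" for v by (simp add: var_def)
  have iv: "init_term r (var v :: ('v, 'k) mpoly) = var v" if "v \<in> X" for v
  proof -
    have "lead_monomial r (var v :: ('v, 'k) mpoly) = single v 1"
      by (rule lead_monomial_eqI[OF r]) (use kv mo_refl[OF r monomials_single[OF that]] in auto)
    then show ?thesis by (simp add: init_term_def var_def)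
  qed
  have tV: "init_term r ` ?V = ?V" using iv variables(3) by (force simp: image_iff)
  have "(var v :: ('v, 'k) mpoly) \<noteq> 0" for v using kv[of v] by auto
  then have VI: "?V \<subseteq> I - {0}" using gen_superset[OF V] variables(4) by auto
  have tI: "init_term r ` (I - {0}) \<subseteq> polys X"
    using init_term_polys[OF r] ideal_subset[OF variables(1)] by blast
  have "init_term r f \<in> gen X ?V" if f: "f \<in> I - {0}" for f
  proof -
    have fX: "f \<in> polys X" using f ideal_subset[OF variables(1)] by blast
    let ?m = "lead_monomial r f"
    have m: "?m \<in> keys f" using lead_monomial_key[OF r fX] f by blast
    have a3: "\<exists>l\<in>(\<lambda>v. single v 1) ` Y. \<exists>n. k = l + n" if tk: "t \<in> ?V" "k \<in> keys t" for t k
    proof -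
      obtain v where "v \<in> Y" "t = var v" using tk(1) by blast
      then have "k = single v 1 + 0" "v \<in> Y" using tk(2) kv by auto
      then show ?thesis by blast
    qed
    have fV: "f \<in> gen X ?V" using f variables(4) by blast
    have "\<exists>l\<in>(\<lambda>v. single v 1) ` Y. \<exists>n. ?m = l + n"
      by (rule gen_monomials_keys[OF V a3 fV m])
    then obtain v n where v: "v \<in> Y" "?m = single v 1 + n" by blast
    have "n \<in> monomials X" using polys_keysD[OF fX m] v(2) monomials_addD by metis
    then have n: "single n (lookup f ?m) \<in> polys X" by (rule polys_single)
    have "init_term r f = single n (lookup f ?m) * var v"
      unfolding init_term_def var_def by (simp add: mult_single v(2) add.commute)
    then show ?thesis using ideal_mult[OF gen_ideal[OF V] n] gen_superset[OF V] v(1) by auto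
  qed
  then have "gen X (init_term r ` (I - {0})) \<subseteq> gen X ?V" by (intro gen_least gen_ideal[OF V]) auto
  moreover have "gen X ?V \<subseteq> gen X (init_term r ` (I - {0}))"
    using gen_superset[OF tI] VI tV by (intro gen_least gen_ideal[OF tI]) blast
  moreover have "finite ?V" using X variables(3) finite_subset by blast
  ultimately have "groebner_basis X r ?V I" unfolding groebner_basis_def tV using VI by blast
  then show ?thesis using r by blast
next
  case (decompose y r B)
  then show ?thesis by blast
qed


section \<open>One geometric vertex decomposition\<close>

lemma gen_insert_gen:
  assumes S: "S \<subseteq> polys X" and g: "g \<in> polys X"
  shows "gen X (insert g (gen X S)) = gen X (insert g S)"
proof
  have 1: "insert g S \<subseteq> polys X" and 2: "insert g (gen X S) \<subseteq> polys X"
    using S g ideal_subset[OF gen_ideal[OF S]] by auto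
  have "gen X S \<subseteq> gen X (insert g S)" using gen_superset[OF 1] by (intro gen_least gen_ideal[OF 1]) auto
  then show "gen X (insert g (gen X S)) \<subseteq> gen X (insert g S)"
    using gen_superset[OF 1] by (intro gen_least gen_ideal[OF 1]) auto
  show "gen X (insert g S) \<subseteq> gen X (insert g (gen X S))"
    using gen_superset[OF 2] gen_superset[OF S] by (intro gen_least gen_ideal[OF 2]) auto
qed

text \<open>
  The ideal \<open>J\<close> of \<open>K[X, y]\<close>, generated by a prime ideal \<open>I\<close> of \<open>K[X]\<close> and one polynomial \<open>g\<close> that is linear in
  \<open>y\<close>, is decomposed at \<open>y\<close>; the ideal \<open>C\<close> of \<open>K[X]\<close> collects the lead coefficients.
\<close>

context
  fixes X :: "'v set" and y :: 'v and I :: "('v, 'k::field) mpoly set" and q s :: "('v, 'k) mpoly"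
  assumes I: "primeideal I (mpoly_ring X)" and y: "y \<notin> X"
    and q: "q \<in> polys X" "q \<notin> I" and s: "s \<in> polys X"
begin

private abbreviation "g \<equiv> var y * q + s"
private abbreviation "J \<equiv> gen (insert y X) (insert g I)"
private abbreviation "C \<equiv> gen X (insert q I)"

private lemmas II = prime_ideal[OF I]

private lemma polysD: "p \<in> polys X \<Longrightarrow> p \<in> polys (insert y X)"
  using polys_mono[of X "insert y X"] by blast

private lemma y_polys: "var y \<in> polys (insert y X)"
  by (rule polys_var) simp

private lemma g_polys: "g \<in> polys (insert y X)"
  by (intro polys_add polys_mult y_polys polysD q s)

private lemma CX: "insert q I \<subseteq> polys X"
  using q ideal_subset[OF II] by blast

private lemma IC: "I \<subseteq> C" and qC: "q \<in> C"
  using gen_superset[OF CX] by auto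

lemma gen_step_eq: "J = gen (insert y X) (insert g (ext y I))"
proof -
  have "ext y I = gen (insert y X) I" using ext_gen[OF ideal_subset[OF II] y] gen_self[OF II] by simp
  moreover have "I \<subseteq> polys (insert y X)" using ideal_subset[OF II] polysD by blast
  ultimately show ?thesis using gen_insert_gen[OF _ g_polys, of I] by simp
qed

lemma gen_step_mem_iff: "f \<in> J \<longleftrightarrow> (\<exists>a\<in>ext y I. \<exists>h\<in>polys (insert y X). f = a + h * g)"
  unfolding gen_step_eq by (rule gen_insert_mem_iff[OF ext_ideal[OF II y] g_polys])

private lemma J_gens: "insert g I \<subseteq> polys (insert y X)"
  using g_polys ideal_subset[OF II] polysD by auto

private lemmas JI = gen_ideal[OF J_gens]

private lemma coeff_g: "coeff_in y 1 g = q" "degree_in y g = 1" "lead_coeff_in y g = q"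
proof -
  have c: "coeff_in y j g = (if j = 1 then q else 0) + (if j = 0 then s else 0)" for j
    using coeff_in_mult_var[of y j q 1] coeff_in_free[OF q(1) y] coeff_in_free[OF s y, of j]
    by (auto simp: coeff_in_add mult.commute)
  show c1: "coeff_in y 1 g = q" unfolding c by simp
  have q0: "q \<noteq> 0" using q(2) ideal_zero[OF II] by auto
  show "degree_in y g = 1" by (rule degree_in_eqI) (use q0 in \<open>simp_all only: c, simp_all\<close>)
  then show "lead_coeff_in y g = q" by (simp only: lead_coeff_in_def c1)
qed

private lemma q_nonzero: "q \<noteq> 0"
  using q(2) ideal_zero[OF II] by auto

private lemma coeff_mult_g: "coeff_in y (Suc k) (h * g) = coeff_in y k h * q + coeff_in y (Suc k) h * s"
proof -
  have "h * g = (h * q) * var y ^ 1 + h * s" by (simp add: algebra_simps)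
  then have "coeff_in y (Suc k) (h * g) = coeff_in y (Suc k) ((h * q) * var y ^ 1) + coeff_in y (Suc k) (h * s)"
    by (simp only: coeff_in_add)
  also have "coeff_in y (Suc k) ((h * q) * var y ^ 1) = coeff_in y k h * q"
    unfolding coeff_in_mult_var using coeff_in_mult_free[OF q(1) y, of k h] by simp
  also have "coeff_in y (Suc k) (h * s) = coeff_in y (Suc k) h * s" by (rule coeff_in_mult_free[OF s y])
  finally show ?thesis .
qed

text \<open>
  Write \<open>f = a + h g\<close> with \<open>a\<close> in the extension of \<open>I\<close>, and let \<open>e\<close> be the degree of \<open>h\<close> in \<open>y\<close> modulo \<open>I\<close>.
  Modulo \<open>I\<close>, the coefficient of \<open>f\<close> at \<open>e + 1\<close> is the product of \<open>q\<close> and a coefficient of \<open>h\<close>, hence not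
  zero because \<open>I\<close> is prime, and the coefficients beyond it vanish.  So the lead coefficient of
  \<open>f\<close> is in \<open>C\<close>, and \<open>f\<close> has positive degree, unless all of its coefficients are in \<open>I\<close>.
\<close>

lemma lead_coeff_step:
  assumes f: "f \<in> J"
  shows "coeff_in y (degree_in y f) f \<in> C" "degree_in y f = 0 \<Longrightarrow> coeff_in y 0 f \<in> I"
proof -
  obtain a h where a: "a \<in> ext y I" and h: "h \<in> polys (insert y X)" and fa: "f = a + h * g"
    using f gen_step_mem_iff by blast
  have "coeff_in y (degree_in y f) f \<in> C \<and> (degree_in y f = 0 \<longrightarrow> coeff_in y 0 f \<in> I)"
  proof (cases "h \<in> ext y I")
    case True
    then have "f \<in> ext y I" unfolding fa
      by (intro ideal_add[OF ext_ideal[OF II y]] a ideal_mult_right[OF ext_ideal[OF II y] g_polys])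
    then show ?thesis using extD[of f y I] IC by blast
  next
    case False
    then obtain e where e: "coeff_in y e h \<notin> I" "\<And>k. e < k \<Longrightarrow> coeff_in y k h \<in> I"
      using ext_top[OF II y] by metis
    have hX: "coeff_in y k h \<in> polys X" for k using h by (rule coeff_in_polys_insert)
    have fc: "coeff_in y (Suc k) f = coeff_in y k h * q + (coeff_in y (Suc k) a + coeff_in y (Suc k) h * s)" for k
      unfolding fa coeff_in_add coeff_mult_g by simp
    have rest: "coeff_in y (Suc k) a + coeff_in y (Suc k) h * s \<in> I" if "e \<le> k" for k
      using that by (intro ideal_add[OF II] ideal_mult_right[OF II s] extD[OF a] e(2)) simp
    have "coeff_in y e h * q \<notin> I" using prime_mult[OF I _ hX q(1)] e(1) q(2) by blast
    then have "coeff_in y (Suc e) f \<notin> I" unfolding fc using ideal_add_cancel[OF II rest[of e]] by blast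
    then have "coeff_in y (Suc e) f \<noteq> 0" using ideal_zero[OF II] by metis
    then have D: "Suc e \<le> degree_in y f" by (rule degree_in_ge)
    then obtain k where k: "degree_in y f = Suc k" "e \<le> k" by (cases "degree_in y f") auto
    have "coeff_in y k h * q \<in> C" by (intro ideal_mult[OF gen_ideal[OF CX]] hX qC)
    then have "coeff_in y (Suc k) f \<in> C" unfolding fc
      by (rule ideal_add[OF gen_ideal[OF CX] _ subsetD[OF IC rest[OF k(2)]]])
    then show ?thesis using k(1) by simp
  qed
  then show "coeff_in y (degree_in y f) f \<in> C" "degree_in y f = 0 \<Longrightarrow> coeff_in y 0 f \<in> I" by auto
qed

text \<open>
  The order compares exponents of \<open>y\<close> first, so the initial term of \<open>f \<in> J\<close> is that of its lead coefficient
  in \<open>y\<close> times a power of \<open>y\<close>.  By \<open>lead_coeff_step\<close> the lead coefficient is covered by \<open>B\<close>, or by \<open>q\<close>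
  if the power of \<open>y\<close> is positive, and then the initial term of \<open>g\<close> can be used.
\<close>

lemma groebner_step:
  assumes r: "monomial_order X r" and B: "groebner_basis X r B I"
    and Bq: "groebner_basis X r (insert q B) C"
  shows "groebner_basis (insert y X) (order_first y X r) (insert g B) J"
proof -
  let ?X = "insert y X" and ?r = "order_first y X r"
  note r' = monomial_order_first[OF r y] and ex = order_first_extends[OF r y]
  note gb = B[unfolded groebner_basis_def] and gq = Bq[unfolded groebner_basis_def]
  have BI: "B \<subseteq> I - {0}" using gb by blast
  have g0: "g \<noteq> 0" using coeff_g(1) q_nonzero by auto
  have BJ: "insert g B \<subseteq> J - {0}" using BI gen_superset[OF J_gens] g0 by auto
  have BX: "b \<in> polys X" if "b \<in> B" for b using that BI ideal_subset[OF II] by blast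
  have JX: "J \<subseteq> polys ?X" by (rule ideal_subset[OF JI])
  have tJ: "init_term ?r ` (J - {0}) \<subseteq> polys ?X" using init_term_polys[OF r'] JX by blast
  have tB: "init_term ?r ` insert g B \<subseteq> polys ?X" using tJ BJ by blast
  define M where "M = gen ?X (init_term ?r ` insert g B)"
  note L = gen_ideal[OF tB, folded M_def] and LS = gen_superset[OF tB, folded M_def]
  have lead: "init_term ?r f = init_term r (coeff_in y (degree_in y f) f) * var y ^ degree_in y f
      \<and> coeff_in y (degree_in y f) f \<noteq> 0" if f: "f \<in> polys ?X" "f \<noteq> 0" for f :: "('v, 'k) mpoly"
  proof -
    have "lookup (lead_monomial ?r f) y = degree_in y f"
      by (rule lead_monomial_degree[OF r' _ f]) (auto simp: order_first_def lex_order_def)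
    then show ?thesis using init_term_coeff_in[OF r y r' ex f] by auto
  qed
  have BL: "init_term r b \<in> M" if "b \<in> B" for b
    using LS init_term_extend[OF r r' ex BX[OF that]] that by auto
  have gL: "init_term r q * var y \<in> M"
    using LS lead[OF g_polys g0] coeff_g by auto
  have inI: "init_term r p \<in> M" if "p \<in> I - {0}" for p
  proof -
    have tX: "init_term r ` (I - {0}) \<subseteq> polys X" using init_term_polys[OF r] ideal_subset[OF II] by blast
    have "gen X (init_term r ` B) \<subseteq> M \<inter> polys X"
      using BL init_term_polys[OF r BX] by (intro gen_least contraction_ideal[OF L]) auto
    then show ?thesis using gb gen_superset[OF tX] that by blast
  qed
  have inC: "init_term r p * var y ^ Suc k \<in> M" if p: "p \<in> C - {0}" for p k
  proof -
    let ?K = "{p \<in> polys X. p * var y \<in> M}"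
    have "ideal ?K (mpoly_ring X)"
      unfolding ideal_mpoly_iff
    proof (intro conjI ballI)
      show "p + p' \<in> ?K" if "p \<in> ?K" "p' \<in> ?K" for p p'
        using that by (auto simp: distrib_right intro: polys_add ideal_add[OF L])
      show "p * p' \<in> ?K" if "p \<in> polys X" "p' \<in> ?K" for p p'
        using that polysD by (auto simp: mult.assoc intro: polys_mult ideal_mult[OF L])
    qed (use ideal_zero[OF L] in auto)
    moreover have "init_term r ` insert q B \<subseteq> ?K"
      using gL BL init_term_polys[OF r BX] init_term_polys[OF r q(1)] ideal_mult_right[OF L y_polys] by auto
    ultimately have le: "gen X (init_term r ` insert q B) \<subseteq> ?K" by (rule gen_least)
    have tC: "init_term r ` (C - {0}) \<subseteq> polys X"
      using init_term_polys[OF r] ideal_subset[OF gen_ideal[OF CX]] by blast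
    have "init_term r p \<in> gen X (init_term r ` (C - {0}))" using gen_superset[OF tC] p by blast
    then have "init_term r p \<in> gen X (init_term r ` insert q B)" using gq by simp
    then have "init_term r p * var y \<in> M" using le by blast
    then have "var y ^ k * (init_term r p * var y) \<in> M"
      by (rule ideal_mult[OF L polys_power[OF y_polys]])
    then show ?thesis by (simp add: mult_ac)
  qed
  have "init_term ?r f \<in> M" if f: "f \<in> J - {0}" for f
  proof -
    have fX: "f \<in> polys ?X" "f \<noteq> 0" using f JX by auto
    show ?thesis
    proof (cases "degree_in y f")
      case 0
      then show ?thesis using lead[OF fX] inI[of "coeff_in y 0 f"] lead_coeff_step(2)[of f] f by auto
    next
      case (Suc k)
      then show ?thesis using lead[OF fX] inC[of "coeff_in y (Suc k) f" k] lead_coeff_step(1)[of f] f by auto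
    qed
  qed
  then have "gen ?X (init_term ?r ` (J - {0})) \<subseteq> M" by (intro gen_least L) auto
  moreover have "M \<subseteq> gen ?X (init_term ?r ` (J - {0}))"
    unfolding M_def using gen_superset[OF tJ] BJ by (intro gen_least gen_ideal[OF tJ]) blast
  ultimately show ?thesis unfolding groebner_basis_def M_def using gb BJ by blast
qed

private lemma sum_split_mem:
  assumes L: "ideal L (mpoly_ring (insert y X))" and f: "coeff_in y 0 f \<in> I" "\<And>j. coeff_in y j f \<in> C"
    and IL: "I \<subseteq> L" and qL: "q * var y \<in> L"
  shows "f \<in> L"
proof -
  have "coeff_in y j f * var y ^ j \<in> L" for j
  proof (cases j)
    case 0
    then show ?thesis using f(1) IL by auto
  next
    case (Suc k)
    obtain a h where a: "a \<in> I" "h \<in> polys X" "coeff_in y j f = a + h * q"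
      using f(2)[of j] gen_insert_mem_iff[OF II q(1)] by blast
    have "coeff_in y j f * var y ^ j = var y ^ j * a + (h * var y ^ k) * (q * var y)"
      unfolding a(3) by (simp add: Suc algebra_simps)
    also have "\<dots> \<in> L"
      by (rule ideal_add[OF L ideal_mult[OF L _ subsetD[OF IL a(1)]] ideal_mult[OF L _ qL]])
        (intro polys_mult polys_power y_polys polysD a(2))+
    finally show ?thesis .
  qed
  then have "(\<Sum>j\<le>degree_in y f. coeff_in y j f * var y ^ j) \<in> L" by (intro ideal_sum[OF L])
  then show ?thesis using expand_in_degree[of f y] by simp
qed

text \<open>
  The inclusion from right to left splits \<open>f\<close> into its terms in \<open>y\<close>: the constant one lies in \<open>I\<close>, and the
  others in the ideal generated by \<open>I\<close> and \<open>q y\<close>, the initial form of \<open>g\<close>.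
\<close>

lemma init_in_step:
  "init_in_ideal (insert y X) y J = {f \<in> ext y C. coeff_in y 0 f \<in> I}"
proof
  let ?M = "{f \<in> ext y C. coeff_in y 0 f \<in> I}"
  note E = ext_ideal[OF gen_ideal[OF CX] y]
  have M: "ideal ?M (mpoly_ring (insert y X))"
    unfolding ideal_mpoly_iff
  proof (intro conjI ballI)
    show "?M \<subseteq> polys (insert y X)" using ideal_subset[OF E] by blast
    show "p + p' \<in> ?M" if "p \<in> ?M" "p' \<in> ?M" for p p'
      using that by (auto simp: coeff_in_add intro: ideal_add[OF E] ideal_add[OF II])
    show "p * p' \<in> ?M" if "p \<in> polys (insert y X)" "p' \<in> ?M" for p p'
      using that by (auto simp: coeff_in_mult intro: ideal_mult[OF E] ideal_mult[OF II] coeff_in_polys_insert)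
  qed (use ideal_zero[OF E] ideal_zero[OF II] in auto)
  have sJ: "init_in y ` (J - {0}) \<subseteq> polys (insert y X)"
    using init_in_polys[of _ "insert y X" y] ideal_subset[OF JI] by blast
  have "init_in y f \<in> ?M" if f: "f \<in> J" for f
  proof -
    let ?D = "degree_in y f"
    have fX: "f \<in> polys (insert y X)" using f ideal_subset[OF JI] by blast
    have c: "coeff_in y j (init_in y f) = (if j = ?D then coeff_in y ?D f else 0)" for j
      unfolding init_in_def lead_coeff_in_def coeff_in_mult_var
      using coeff_in_free[OF coeff_in_polys_insert[OF fX] y] by auto
    show ?thesis using lead_coeff_step[OF f] ideal_zero[OF gen_ideal[OF CX]] ideal_zero[OF II]
      by (auto simp: ext_def c)
  qed
  then show "init_in_ideal (insert y X) y J \<subseteq> ?M"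
    unfolding init_in_ideal_def by (intro gen_least M) auto
  note L = gen_ideal[OF sJ]
  have "I \<subseteq> gen (insert y X) (init_in y ` (J - {0}))"
  proof
    fix a assume a: "a \<in> I"
    have "init_in y a = a" if "a \<noteq> 0"
    proof -
      have c: "coeff_in y j a = (if j = 0 then a else 0)" for j
        using coeff_in_free[OF _ y] a ideal_subset[OF II] by blast
      have "degree_in y a = 0" by (rule degree_in_eqI) (use that c in auto)
      then show ?thesis by (simp add: init_in_def lead_coeff_in_def c)
    qed
    moreover have "a \<in> J" using gen_superset[OF J_gens] a by blast
    ultimately show "a \<in> gen (insert y X) (init_in y ` (J - {0}))"
      using gen_superset[OF sJ] ideal_zero[OF L] by (cases "a = 0") auto
  qed
  note IL = this
  have qL: "q * var y \<in> gen (insert y X) (init_in y ` (J - {0}))"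
  proof -
    have "g \<in> J - {0}" using gen_superset[OF J_gens] coeff_g(1) q_nonzero by auto
    then have "init_in y g \<in> gen (insert y X) (init_in y ` (J - {0}))" using gen_superset[OF sJ] by blast
    then show ?thesis by (simp only: init_in_def coeff_g power_one_right)
  qed
  have "f \<in> gen (insert y X) (init_in y ` (J - {0}))" if f: "f \<in> ?M" for f
  proof (rule sum_split_mem[OF L _ _ IL qL])
    show "coeff_in y 0 f \<in> I" using f by blast
    have "f \<in> ext y C" using f by blast
    then show "coeff_in y j f \<in> C" for j by (rule extD)
  qed
  then show "?M \<subseteq> init_in_ideal (insert y X) y J"
    unfolding init_in_ideal_def by blast
qed

text \<open>
  Here \<open>C\<^sub>y\<^sub>,\<^sub>J\<close> and \<open>N\<^sub>y\<^sub>,\<^sub>J\<close> are the extensions of \<open>C\<close> and \<open>I\<close>, so contracting them to \<open>K[X]\<close> gives back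
  \<open>C\<close> and \<open>I\<close>.
\<close>

theorem gvd_step:
  assumes gI: "gvd X I" and gC: "gvd X C" and u: "unmixed (mpoly_ring (insert y X)) J"
    and r: "monomial_order X r" and B: "groebner_basis X r B I" "groebner_basis X r (insert q B) C"
  shows "gvd (insert y X) J"
proof -
  let ?X = "insert y X"
  have BI: "B \<subseteq> I - {0}" using B(1) by (simp add: groebner_basis_def)
  have BX: "B \<subseteq> polys X" using BI ideal_subset[OF II] by blast
  have Bd: "degree_in y b = 0" "lead_coeff_in y b = b" if "b \<in> B" for b
  proof -
    have c: "coeff_in y j b = (if j = 0 then b else 0)" for j
      using coeff_in_free[OF _ y] that BX by blast
    show "degree_in y b = 0" by (rule degree_in_eqI) (use that BI c in auto)
    then show "lead_coeff_in y b = b" by (simp add: lead_coeff_in_def c)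
  qed
  have lB: "lead_coeff_in y ` B = B" using Bd(2) by auto
  have lgB: "lead_coeff_in y ` insert g B = insert q B" using lB coeff_g(3) by simp
  have C: "C_ideal ?X y (insert g B) = ext y C"
  proof -
    have "insert q B \<subseteq> polys X" using BX q by blast
    from ext_gen[OF this y] show ?thesis
      unfolding C_ideal_def lgB groebner_generates[OF gen_ideal[OF CX] r B(2)] .
  qed
  have "{b \<in> insert g B. degree_in y b = 0} = B" using Bd(1) coeff_g(2) by auto
  then have N: "N_ideal ?X y (insert g B) = ext y I"
    unfolding N_ideal_def using lB ext_gen[OF BX y] groebner_generates[OF II r B(1)] by simp
  have IX: "I \<subseteq> polys ?X" using ideal_subset[OF II] polysD by blast
  have Ny: "ext y I <+>\<^bsub>mpoly_ring ?X\<^esub> gen ?X {var y} = {f \<in> polys ?X. coeff_in y 0 f \<in> I}"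
  proof -
    have e: "ext y I = gen ?X I" using ext_gen[OF ideal_subset[OF II] y] gen_self[OF II] by simp
    have "ext y I <+>\<^bsub>mpoly_ring ?X\<^esub> gen ?X {var y} = gen ?X (insert (var y) (ext y I))"
      unfolding e using gen_add[OF IX, of "{var y}"] gen_insert_gen[OF IX y_polys] y_polys by simp
    also have "\<dots> = {f \<in> polys ?X. coeff_in y 0 f \<in> I}"
    proof (intro equalityI subsetI)
      fix f assume "f \<in> gen ?X (insert (var y) (ext y I))"
      then obtain a h where a: "a \<in> ext y I" "h \<in> polys ?X" "f = a + h * var y"
        using gen_insert_mem_iff[OF ext_ideal[OF II y] y_polys] by blast
      have "coeff_in y 0 f = coeff_in y 0 a"
        unfolding a(3) coeff_in_add using coeff_in_mult_var[of y 0 h 1] by simp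
      moreover have "f \<in> polys ?X" unfolding a(3)
        using a ext_polys[OF II y] y_polys by (auto intro: polys_add polys_mult)
      ultimately show "f \<in> {f \<in> polys ?X. coeff_in y 0 f \<in> I}" using extD[OF a(1)] by simp
    next
      fix f assume f: "f \<in> {f \<in> polys ?X. coeff_in y 0 f \<in> I}"
      have sub: "insert (var y) (ext y I) \<subseteq> polys ?X" using y_polys ext_polys[OF II y] by blast
      note V = gen_ideal[OF sub]
      have "coeff_in y j f * var y ^ j \<in> gen ?X (insert (var y) (ext y I))" for j
      proof (cases j)
        case 0
        then show ?thesis using f gen_superset[OF sub] ext_superset[OF II y] by auto
      next
        case (Suc k)
        have "coeff_in y j f * var y ^ j = (coeff_in y j f * var y ^ k) * var y"
          by (simp add: Suc mult_ac)
        also have "\<dots> \<in> gen ?X (insert (var y) (ext y I))"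
          using f gen_superset[OF sub] by (intro ideal_mult[OF V] polys_mult polys_power y_polys polysD coeff_in_polys_insert) auto
        finally show ?thesis .
      qed
      then have "(\<Sum>j\<le>degree_in y f. coeff_in y j f * var y ^ j) \<in> gen ?X (insert (var y) (ext y I))"
        by (intro ideal_sum[OF V])
      then show "f \<in> gen ?X (insert (var y) (ext y I))" using expand_in_degree[of f y] by simp
    qed
    finally show ?thesis .
  qed
  have Xy: "?X - {y} = X" using y by simp
  show ?thesis
  proof (rule gvd.decompose)
    show "ideal J (mpoly_ring ?X)" by (rule JI)
    show "unmixed (mpoly_ring ?X) J" by (rule u)
    show "y \<in> ?X" by simp
    show "monomial_order ?X (order_first y X r)" by (rule monomial_order_first[OF r y])
    show "compatible_order TYPE('k) ?X y (order_first y X r)" by (rule compatible_order_first[OF r y])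
    show "groebner_basis ?X (order_first y X r) (insert g B) J" by (rule groebner_step[OF r B])
    show "init_in_ideal ?X y J = C_ideal ?X y (insert g B) \<inter> (N_ideal ?X y (insert g B) <+>\<^bsub>mpoly_ring ?X\<^esub> gen ?X {var y})"
      unfolding C N Ny init_in_step using ext_polys[OF gen_ideal[OF CX] y] by blast
    show "gvd (?X - {y}) (contraction (?X - {y}) (C_ideal ?X y (insert g B)))"
      unfolding C Xy contraction_def using ext_contraction[OF gen_ideal[OF CX] y] gC by simp
    show "gvd (?X - {y}) (contraction (?X - {y}) (N_ideal ?X y (insert g B)))"
      unfolding N Xy contraction_def using ext_contraction[OF II y] gI by simp
  qed
qed

end


section \<open>Unmixedness of a prime ideal plus a product of new variables\<close>

lemma krull_dim_ge:
  fixes I :: "('v, 'k::field) mpoly set"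
  assumes "finite X" "ideal I (mpoly_ring X)" "Y \<subseteq> X" "indep I Y"
  shows "enat (card Y) \<le> krull_dim (mpoly_ring X Quot I)"
  unfolding krull_dim_affine[OF assms(1,2)] by (rule Sup_upper) (use assms in blast)

lemma krull_dim_le:
  fixes I :: "('v, 'k::field) mpoly set"
  assumes "finite X" "ideal I (mpoly_ring X)" "\<And>Y. Y \<subseteq> X \<Longrightarrow> indep I Y \<Longrightarrow> enat (card Y) \<le> d"
  shows "krull_dim (mpoly_ring X Quot I) \<le> d"
  unfolding krull_dim_affine[OF assms(1,2)] by (rule Sup_least) (use assms(3) in blast)

text \<open>
  The product of a witness against \<open>A\<close> and one against \<open>B\<close> is a witness against the intersection.
\<close>

lemma indep_Int:
  fixes A B :: "('v, 'k::idom) mpoly set"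
  assumes A: "ideal A (mpoly_ring X)" and B: "ideal B (mpoly_ring X)" and Y: "Y \<subseteq> X" "indep (A \<inter> B) Y"
  shows "indep A Y \<or> indep B Y"
proof (rule ccontr)
  assume "\<not> ?thesis"
  then obtain p q where p: "p \<in> A" "p \<in> polys Y" "p \<noteq> 0" and q: "q \<in> B" "q \<in> polys Y" "q \<noteq> 0" by blast
  have "p * q \<in> A \<inter> B"
    using ideal_mult_right[OF A, of q p] ideal_mult[OF B, of p q] p q polys_mono[OF Y(1)] by blast
  then show False using Y(2) polys_mult[OF p(2) q(2)] p(3) q(3) mpoly_mult_eq_0_iff[of p q] by blast
qed

lemma prime_Int:
  assumes P: "primeideal (A \<inter> B) (mpoly_ring X)" and A: "ideal A (mpoly_ring X)" and B: "ideal B (mpoly_ring X)"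
  shows "A \<inter> B = A \<or> A \<inter> B = B"
proof (rule ccontr)
  assume "\<not> ?thesis"
  then obtain p q where p: "p \<in> A" "p \<notin> B" and q: "q \<in> B" "q \<notin> A" by blast
  have pq: "p \<in> polys X" "q \<in> polys X" using p q ideal_subset[OF A] ideal_subset[OF B] by auto
  have "p * q \<in> A \<inter> B" using ideal_mult_right[OF A pq(2) p(1)] ideal_mult[OF B pq(1) q(1)] by blast
  then show False using prime_mult[OF P _ pq] p q by blast
qed

lemma colon_ideal:
  assumes I: "ideal I (mpoly_ring X)" and f: "f \<in> polys X"
  shows "ideal {r \<in> polys X. r * f \<in> I} (mpoly_ring X)"
  unfolding ideal_mpoly_iff
proof (intro conjI ballI)
  show "p + q \<in> {r \<in> polys X. r * f \<in> I}" if "p \<in> {r \<in> polys X. r * f \<in> I}" "q \<in> {r \<in> polys X. r * f \<in> I}" for p q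
    using that ideal_add[OF I] by (auto simp: distrib_right intro: polys_add)
  show "p * q \<in> {r \<in> polys X. r * f \<in> I}" if "p \<in> polys X" "q \<in> {r \<in> polys X. r * f \<in> I}" for p q
    using that ideal_mult[OF I, of p "q * f"] by (auto simp: mult.assoc intro: polys_mult)
qed (use ideal_zero[OF I] in auto)

text \<open>
  In \<open>h y q\<close> every power of \<open>y\<close> that occurs is positive and has a multiple of \<open>q\<close> as its coefficient.  The
  right-hand side is the intersection of the extension of \<open>I + \<langle>q\<rangle>\<close> with \<open>I + \<langle>y\<rangle>\<close>.
\<close>

lemma gen_mult_var_mem_iff:
  fixes I :: "('v, 'k::field) mpoly set"
  assumes I: "primeideal I (mpoly_ring X)" and y: "y \<notin> X" and q: "q \<in> polys X" "q \<notin> I"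
  shows "f \<in> gen (insert y X) (insert (var y * q) I) \<longleftrightarrow>
    f \<in> ext y (gen X (insert q I)) \<and> coeff_in y 0 f \<in> I"
proof -
  note II = prime_ideal[OF I]
  let ?X = "insert y X" and ?C = "gen X (insert q I)"
  have CX: "insert q I \<subseteq> polys X" using q ideal_subset[OF II] by blast
  note C = gen_ideal[OF CX] and sup = gen_superset[OF CX]
  have eq: "gen ?X (insert (var y * q) I) = gen ?X (insert (var y * q) (ext y I))"
    using gen_step_eq[OF I y q polys_zero] by simp
  have yq: "var y * q \<in> polys ?X" using q polys_mono[of X ?X] by (intro polys_mult polys_var) auto
  have cm: "coeff_in y 0 (h * (var y * q)) = 0" "coeff_in y (Suc k) (h * (var y * q)) = coeff_in y k h * q" for h k
  proof -
    have "h * (var y * q) = (h * q) * var y ^ 1" by simp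
    then show "coeff_in y 0 (h * (var y * q)) = 0" "coeff_in y (Suc k) (h * (var y * q)) = coeff_in y k h * q"
      unfolding coeff_in_mult_var using coeff_in_mult_free[OF q(1) y, of k h]
      by (simp_all only: coeff_in_mult_var) simp_all
  qed
  note mem = gen_insert_mem_iff[OF ext_ideal[OF II y] yq]
  show ?thesis
  proof
    assume "f \<in> gen ?X (insert (var y * q) I)"
    then obtain a h where a: "a \<in> ext y I" "h \<in> polys ?X" "f = a + h * (var y * q)" unfolding eq mem by blast
    have "coeff_in y j f \<in> ?C" for j
    proof -
      have "coeff_in y j a \<in> ?C" using extD[OF a(1)] sup by blast
      moreover have "coeff_in y j (h * (var y * q)) \<in> ?C"
        using sup coeff_in_polys_insert[OF a(2)] ideal_zero[OF C]
        by (cases j) (auto simp: cm intro: ideal_mult[OF C])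
      ultimately show ?thesis unfolding a(3) coeff_in_add by (rule ideal_add[OF C])
    qed
    moreover have "coeff_in y 0 f \<in> I" using extD[OF a(1), of 0] by (simp add: a(3) coeff_in_add cm)
    ultimately show "f \<in> ext y ?C \<and> coeff_in y 0 f \<in> I" by (auto simp: ext_def)
  next
    assume f: "f \<in> ext y ?C \<and> coeff_in y 0 f \<in> I"
    have sJ: "insert (var y * q) (ext y I) \<subseteq> polys ?X" using yq ext_polys[OF II y] by blast
    note J = gen_ideal[OF sJ]
    have "coeff_in y j f * var y ^ j \<in> gen ?X (insert (var y * q) (ext y I))" for j
    proof (cases j)
      case 0
      then show ?thesis using f ext_superset[OF II y] gen_superset[OF sJ] by auto
    next
      case (Suc k)
      have "coeff_in y j f \<in> ?C" using f extD[of f y ?C j] by blast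
      then obtain a h where a: "a \<in> I" "h \<in> polys X" "coeff_in y j f = a + h * q"
        using gen_insert_mem_iff[OF II q(1)] by blast
      have aE: "a \<in> ext y I" using a(1) ext_superset[OF II y] by blast
      have yk: "var y ^ i \<in> (polys ?X :: ('v, 'k) mpoly set)" for i by (intro polys_power polys_var) simp
      have "var y ^ j * a \<in> ext y I" by (rule ideal_mult[OF ext_ideal[OF II y] yk aE])
      moreover have "h * var y ^ k \<in> polys ?X" using a(2) polys_mono[of X ?X] yk by (intro polys_mult) auto
      moreover have "coeff_in y j f * var y ^ j = var y ^ j * a + (h * var y ^ k) * (var y * q)"
        unfolding a(3) by (simp add: Suc algebra_simps)
      ultimately show ?thesis unfolding mem by blast
    qed
    then have "(\<Sum>j\<le>degree_in y f. coeff_in y j f * var y ^ j) \<in> gen ?X (insert (var y * q) (ext y I))"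
      by (intro ideal_sum[OF J])
    then show "f \<in> gen ?X (insert (var y * q) I)" unfolding eq using expand_in_degree[of f y] by simp
  qed
qed

text \<open>
  The ideal \<open>J = I + \<langle>y q\<rangle>\<close> is the intersection of the extension \<open>E\<close> of \<open>I + \<langle>q\<rangle>\<close> with the prime
  \<open>L = I + \<langle>y\<rangle>\<close>.  A prime annihilator modulo \<open>J\<close> is the intersection of the annihilators modulo \<open>E\<close> and \<open>L\<close>,
  hence equal to one of them: it is an associated prime of \<open>E\<close>, which is unmixed, or \<open>L\<close>.  The hypothesis
  \<open>dim\<close> says that \<open>E\<close> has the same dimension as \<open>L\<close>, unless \<open>E\<close> is the unit ideal and contributes nothing.
\<close>

lemma unmixed_mult_var:
  fixes I :: "('v, 'k::field) mpoly set"
  assumes X: "finite X" and I: "primeideal I (mpoly_ring X)" and y: "y \<notin> X" and q: "q \<in> polys X" "q \<notin> I"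
    and u: "unmixed (mpoly_ring X) (gen X (insert q I))"
    and dim: "1 \<in> gen X (insert q I) \<or>
      krull_dim (mpoly_ring X Quot I) = eSuc (krull_dim (mpoly_ring X Quot gen X (insert q I)))"
  shows "unmixed (mpoly_ring (insert y X)) (gen (insert y X) (insert (var y * q) I))"
    and "krull_dim (mpoly_ring (insert y X) Quot gen (insert y X) (insert (var y * q) I)) =
      krull_dim (mpoly_ring X Quot I)"
proof -
  note II = prime_ideal[OF I]
  let ?X = "insert y X"
  define C where "C = gen X (insert q I)"
  define J where "J = gen ?X (insert (var y * q) I)"
  define L where "L = {f \<in> polys ?X. coeff_in y 0 f \<in> I}"
  have CX: "insert q I \<subseteq> polys X" using q ideal_subset[OF II] by blast
  have C: "ideal C (mpoly_ring X)" unfolding C_def by (rule gen_ideal[OF CX])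
  note E = ext_ideal[OF C y]
  have X': "finite ?X" using X by simp
  have JE: "J = ext y C \<inter> L"
    unfolding J_def L_def C_def using gen_mult_var_mem_iff[OF I y q] ext_polys[OF gen_ideal[OF CX] y] by blast
  have L: "primeideal L (mpoly_ring ?X)"
    unfolding primeideal_mpoly_iff
  proof (intro conjI ballI impI)
    show "ideal L (mpoly_ring ?X)"
      unfolding ideal_mpoly_iff
    proof (intro conjI ballI)
      show "p + r \<in> L" if "p \<in> L" "r \<in> L" for p r
        using that by (auto simp: L_def coeff_in_add intro: polys_add ideal_add[OF II])
      show "p * r \<in> L" if "p \<in> polys ?X" "r \<in> L" for p r
        using that by (auto simp: L_def coeff_in_mult intro: polys_mult ideal_mult[OF II] coeff_in_polys_insert)
    qed (use ideal_zero[OF II] in \<open>auto simp: L_def\<close>)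
    have "coeff_in y 0 (1 :: ('v, 'k) mpoly) = 1" using coeff_in_free[of 1 X y 0] y by simp
    then show "1 \<notin> L" using prime_one[OF I] by (simp add: L_def)
    fix p r assume pr: "p \<in> polys ?X" "r \<in> polys ?X" "p * r \<in> L"
    then have "coeff_in y 0 p * coeff_in y 0 r \<in> I" by (simp add: L_def coeff_in_mult)
    then have "coeff_in y 0 p \<in> I \<or> coeff_in y 0 r \<in> I"
      by (rule prime_mult[OF I _ coeff_in_polys_insert[OF pr(1)] coeff_in_polys_insert[OF pr(2)]])
    then show "p \<in> L \<or> r \<in> L" using pr by (auto simp: L_def)
  qed
  note LI = prime_ideal[OF L]
  have IL: "I \<subseteq> L"
  proof
    fix f assume f: "f \<in> I"
    then have "f \<in> polys X" using ideal_subset[OF II] by blast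
    then show "f \<in> L" unfolding L_def using f coeff_in_free[of f X y 0] y polys_mono[of X ?X] by auto
  qed
  have indepL: "indep L Y \<longleftrightarrow> y \<notin> Y \<and> indep I Y" if Y: "Y \<subseteq> ?X" for Y
  proof
    assume a: "indep L Y"
    have "y \<notin> Y"
    proof
      assume "y \<in> Y"
      have "coeff_in y 0 (var y :: ('v, 'k) mpoly) = 0" by (simp add: var_def coeff_in_single)
      then have "var y \<in> L \<inter> (polys Y :: ('v, 'k) mpoly set)"
        using \<open>y \<in> Y\<close> ideal_zero[OF II] by (auto simp: L_def intro: polys_var)
      then have "(var y :: ('v, 'k) mpoly) = 0" using a by blast
      then have "lookup (var y :: ('v, 'k) mpoly) (single y 1) = 0" by simp
      then show False by (simp add: var_def)
    qed
    then show "y \<notin> Y \<and> indep I Y" using a IL by blast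
  next
    assume a: "y \<notin> Y \<and> indep I Y"
    show "indep L Y"
    proof
      fix f assume f: "f \<in> L \<inter> polys Y"
      then have "coeff_in y 0 f = f" using a coeff_in_free[of f Y y 0] by simp
      then show "f \<in> {0}" using f a by (auto simp: L_def)
    qed
  qed
  have J: "ideal J (mpoly_ring ?X)"
    unfolding J_def using q polys_mono[of X ?X] ideal_subset[OF II]
    by (intro gen_ideal) (auto intro!: polys_mult polys_var)
  have dL: "krull_dim (mpoly_ring ?X Quot L) = krull_dim (mpoly_ring X Quot I)"
  proof (rule krull_dim_cong[OF X' LI X II])
    show "\<exists>Y'\<subseteq>X. indep I Y' \<and> card Y \<le> card Y'" if "Y \<subseteq> ?X" "indep L Y" for Y
      using that indepL[OF that(1)] by (intro exI[of _ Y]) auto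
    show "\<exists>Y'\<subseteq>?X. indep L Y' \<and> card Y \<le> card Y'" if "Y \<subseteq> X" "indep I Y" for Y
      using that indepL[of Y] y by (intro exI[of _ Y]) auto
  qed
  have dE: "krull_dim (mpoly_ring ?X Quot ext y C) = krull_dim (mpoly_ring X Quot I)" if "1 \<notin> C"
    using krull_dim_ext[OF X C y that] dim that unfolding C_def[symmetric] by simp
  have dJ: "krull_dim (mpoly_ring ?X Quot J) = krull_dim (mpoly_ring X Quot I)"
  proof (rule antisym)
    show "krull_dim (mpoly_ring ?X Quot J) \<le> krull_dim (mpoly_ring X Quot I)"
    proof (rule krull_dim_le[OF X' J])
      fix Y assume Y: "Y \<subseteq> ?X" "indep J Y"
      from indep_Int[OF E LI Y(1) Y(2)[unfolded JE]]
      show "enat (card Y) \<le> krull_dim (mpoly_ring X Quot I)"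
      proof
        assume a: "indep (ext y C) Y"
        have "1 \<notin> C"
        proof
          assume "1 \<in> C"
          then have "1 \<in> ext y C \<inter> polys Y" using ext_one[OF C y] by simp
          then show False using a by fastforce
        qed
        then show ?thesis using krull_dim_ge[OF X' E Y(1) a] dE by simp
      next
        assume "indep L Y"
        then show ?thesis using krull_dim_ge[OF X' LI Y(1)] dL by simp
      qed
    qed
    show "krull_dim (mpoly_ring X Quot I) \<le> krull_dim (mpoly_ring ?X Quot J)"
    proof (rule krull_dim_le[OF X II])
      fix Y assume Y: "Y \<subseteq> X" "indep I Y"
      then have Y': "Y \<subseteq> ?X" and "indep L Y" using indepL[of Y] y by auto
      then have "indep J Y" unfolding JE by blast
      then show "enat (card Y) \<le> krull_dim (mpoly_ring ?X Quot J)" by (rule krull_dim_ge[OF X' J Y'])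
    qed
  qed
  have "krull_dim (mpoly_ring ?X Quot J) = krull_dim (mpoly_ring ?X Quot Q)"
    if QJ: "Q \<in> associated_primes (mpoly_ring ?X) J" for Q
  proof -
    obtain f where Q: "primeideal Q (mpoly_ring ?X)" "f \<in> polys ?X" "Q = {r \<in> polys ?X. r * f \<in> J}"
      using QJ unfolding associated_primes_mpoly_iff by blast
    let ?A = "{r \<in> polys ?X. r * f \<in> ext y C}" and ?B = "{r \<in> polys ?X. r * f \<in> L}"
    have QAB: "Q = ?A \<inter> ?B" unfolding Q(3) JE by blast
    from prime_Int[OF Q(1)[unfolded QAB] colon_ideal[OF E Q(2)] colon_ideal[OF LI Q(2)]]
    show ?thesis
    proof
      assume "?A \<inter> ?B = ?A"
      then have QA: "Q = ?A" using QAB by simp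
      have "1 \<notin> ?A" using prime_one[OF Q(1)] QA by simp
      then have "1 \<notin> C" using ext_one[OF C y] ideal_mult_right[OF E Q(2), of 1] by auto
      moreover have "Q \<in> associated_primes (mpoly_ring ?X) (ext y C)"
        unfolding associated_primes_mpoly_iff using Q(1,2) QA by blast
      then have "krull_dim (mpoly_ring ?X Quot ext y C) = krull_dim (mpoly_ring ?X Quot Q)"
        using unmixed_ext[OF X C y] u unfolding unmixed_def C_def[symmetric] by blast
      ultimately show ?thesis using dE dJ by simp
    next
      assume "?A \<inter> ?B = ?B"
      then have QB: "Q = ?B" using QAB by simp
      have "Q \<in> associated_primes (mpoly_ring ?X) L"
        unfolding associated_primes_mpoly_iff using Q(1,2) QB by blast
      then show ?thesis using unmixed_prime[OF L] dL dJ unfolding unmixed_def by metis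
    qed
  qed
  then show "unmixed (mpoly_ring ?X) (gen ?X (insert (var y * q) I))"
    unfolding unmixed_def J_def[symmetric] by blast
  show "krull_dim (mpoly_ring ?X Quot gen ?X (insert (var y * q) I)) = krull_dim (mpoly_ring X Quot I)"
    using dJ unfolding J_def .
qed


section \<open>Adding new variables one at a time\<close>

text \<open>
  What \<open>gvd_step\<close> asks of \<open>I\<close> and \<open>q\<close>, together with the relation of dimensions from which
  \<open>unmixed_mult_var\<close> concludes that \<open>I + \<langle>y q\<rangle>\<close> is unmixed.  The unit ideal has to be exempted, for its
  quotient ring has dimension 0 by convention; it occurs for \<open>q = 1\<close>, where the induction starts.
\<close>

definition decomposable_with :: "'v set \<Rightarrow> ('v, 'k::field) mpoly set \<Rightarrow> ('v, 'k) mpoly \<Rightarrow> bool" where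
  "decomposable_with X I q \<longleftrightarrow> finite X \<and> primeideal I (mpoly_ring X) \<and> gvd X I \<and>
    q \<in> polys X \<and> q \<notin> I \<and> gvd X (gen X (insert q I)) \<and>
    (\<exists>r B. monomial_order X r \<and> groebner_basis X r B I \<and>
       groebner_basis X r (insert q B) (gen X (insert q I))) \<and>
    (1 \<in> gen X (insert q I) \<or>
      krull_dim (mpoly_ring X Quot I) = eSuc (krull_dim (mpoly_ring X Quot gen X (insert q I))))"

lemma decomposable_with_one:
  fixes I :: "('v, 'k::field) mpoly set"
  assumes X: "finite X" and I: "primeideal I (mpoly_ring X)" and g: "gvd X I"
  shows "decomposable_with X I 1"
proof -
  note II = prime_ideal[OF I]
  have s: "insert 1 I \<subseteq> polys X" and s1: "{1 :: ('v, 'k) mpoly} \<subseteq> polys X" using ideal_subset[OF II] by auto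
  have U: "gen X (insert 1 I) = polys X"
    using ideal_eq_polys_iff[OF gen_ideal[OF s]] gen_superset[OF s] by blast
  have U1: "gen X {1 :: ('v, 'k) mpoly} = polys X"
    using ideal_eq_polys_iff[OF gen_ideal[OF s1]] gen_superset[OF s1] by blast
  have U': "ideal (polys X :: ('v, 'k) mpoly set) (mpoly_ring X)" using gen_ideal[OF s] U by simp
  have "gvd X (polys X :: ('v, 'k) mpoly set)"
  proof (rule gvd.unit[OF U' _ U1[symmetric]])
    show "unmixed (mpoly_ring X) (polys X :: ('v, 'k) mpoly set)"
      unfolding unmixed_def
    proof
      fix Q :: "('v, 'k) mpoly set" assume "Q \<in> associated_primes (mpoly_ring X) (polys X)"
      then obtain f where "primeideal Q (mpoly_ring X)" "f \<in> polys X" "Q = {r \<in> polys X. r * f \<in> polys X}"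
        unfolding associated_primes_mpoly_iff by blast
      then have "1 \<notin> Q" "1 \<in> Q" using prime_one[of Q X] by auto
      then have False by blast
      then show "krull_dim (mpoly_ring X Quot polys X) = krull_dim (mpoly_ring X Quot Q)" ..
    qed
  qed
  moreover obtain r B where r: "monomial_order X r" and B: "groebner_basis X r B I"
    using gvd_groebner[OF g X] by blast
  moreover have "groebner_basis X r (insert 1 B) (polys X)"
    using B ideal_subset[OF II] by (intro groebner_unit[OF r]) (auto simp: groebner_basis_def)
  ultimately show ?thesis
    unfolding decomposable_with_def U using X I g prime_one[OF I] by auto
qed

text \<open>
  A new variable may be adjoined as a mere variable or as a further factor of \<open>q\<close>.
\<close>

lemma decomposable_with_ext:
  fixes I :: "('v, 'k::field) mpoly set"
  assumes d: "decomposable_with X I q" and z: "z \<notin> X"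
  shows "decomposable_with (insert z X) (ext z I) q"
    and "decomposable_with (insert z X) (ext z I) (var z * q)"
proof -
  let ?X = "insert z X" and ?C = "gen X (insert q I)"
  obtain r B where X: "finite X" and I: "primeideal I (mpoly_ring X)" and g: "gvd X I" and q: "q \<in> polys X" "q \<notin> I"
    and gC: "gvd X ?C" and r: "monomial_order X r" and B: "groebner_basis X r B I" "groebner_basis X r (insert q B) ?C"
    and dim: "1 \<in> ?C \<or> krull_dim (mpoly_ring X Quot I) = eSuc (krull_dim (mpoly_ring X Quot ?C))"
    using d unfolding decomposable_with_def by blast
  note II = prime_ideal[OF I]
  have CX: "insert q I \<subseteq> polys X" using q ideal_subset[OF II] by blast
  note C = gen_ideal[OF CX]
  have X': "finite ?X" using X by simp
  note r' = monomial_order_first[OF r z] and ex = order_first_extends[OF r z]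
  have B': "groebner_basis ?X (order_first z X r) B (ext z I)" by (rule groebner_ext[OF II r z r' ex B(1)])
  have qX: "q \<in> polys ?X" using q polys_mono[of X ?X] by blast
  have yX: "var z \<in> (polys ?X :: ('v, 'k) mpoly set)" by (rule polys_var) simp
  have eI: "ext z I = gen ?X I" using ext_gen[OF ideal_subset[OF II] z] gen_self[OF II] by simp
  have IX: "I \<subseteq> polys ?X" using ideal_subset[OF II] polys_mono[of X ?X] by blast
  have gE: "gvd ?X (ext z I)" by (rule gvd_ext[OF g X z])
  have P: "primeideal (ext z I) (mpoly_ring ?X)" by (rule ext_prime[OF I z])
  have "1 \<notin> I" by (rule prime_one[OF I])
  note dI = krull_dim_ext[OF X II z this]
  have Cz: "gen ?X (insert q (ext z I)) = ext z ?C"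
    unfolding eI gen_insert_gen[OF IX qX] by (rule ext_gen[OF CX z])
  have dimC: "1 \<in> ext z ?C \<or> krull_dim (mpoly_ring ?X Quot ext z I) = eSuc (krull_dim (mpoly_ring ?X Quot ext z ?C))"
  proof (cases "1 \<in> ?C")
    case True
    then show ?thesis using ext_one[OF C z] by simp
  next
    case False
    then show ?thesis using dim krull_dim_ext[OF X C z False] dI by simp
  qed
  have "groebner_basis ?X (order_first z X r) (insert q B) (ext z ?C)" by (rule groebner_ext[OF C r z r' ex B(2)])
  then show "decomposable_with ?X (ext z I) q"
    unfolding decomposable_with_def Cz
    using X' P gE qX q ext_free[OF II z q(1)] gvd_ext[OF gC X z] r' B' dimC by blast
  let ?J = "gen ?X (insert (var z * q) I)"
  have Jz: "gen ?X (insert (var z * q) (ext z I)) = ?J"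
    using gen_step_eq[OF I z q polys_zero] by simp
  note u = unmixed_mult_var[OF X I z q gvd_unmixed[OF gC] dim]
  have gJ: "gvd ?X ?J" using gvd_step[OF I z q polys_zero g gC _ r B] u(1) by simp
  have BJ: "groebner_basis ?X (order_first z X r) (insert (var z * q) B) ?J"
    using groebner_step[OF I z q polys_zero r B] by simp
  have "coeff_in z 1 (var z * q) = q"
    using coeff_in_mult_var[of z 1 q 1] coeff_in_free[OF q(1) z, of 0] by (simp add: mult.commute)
  then have nI: "var z * q \<notin> ext z I" using q(2) extD[of "var z * q" z I 1] by auto
  show "decomposable_with ?X (ext z I) (var z * q)"
    unfolding decomposable_with_def Jz
    using X' P gE polys_mult[OF yX qX] nI gJ r' B' BJ u(2) dI by auto
qed

lemma decomposable_with_product: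
  fixes I :: "('v, 'k::field) mpoly set"
  assumes X: "finite X" and I: "primeideal I (mpoly_ring X)" and g: "gvd X I"
    and E: "finite E" "E \<inter> X = {}" and F: "finite F" "F \<inter> (X \<union> E) = {}"
  shows "decomposable_with (X \<union> E \<union> F) (gen (X \<union> E \<union> F) I) (\<Prod>e\<in>E. var e)"
proof -
  have sub: "I \<subseteq> polys Y" if "X \<subseteq> Y" for Y
    using ideal_subset[OF prime_ideal[OF I]] polys_mono[OF that] by blast
  have EX: "decomposable_with (X \<union> E) (gen (X \<union> E) I) (\<Prod>e\<in>E. var e)"
    using E
  proof (induction E)
    case empty
    then show ?case using decomposable_with_one[OF X I g] gen_self[OF prime_ideal[OF I]] by simp
  next
    case (insert e E)
    then have "decomposable_with (insert e (X \<union> E)) (ext e (gen (X \<union> E) I)) (var e * (\<Prod>e\<in>E. var e))"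
      by (intro decomposable_with_ext) auto
    moreover have "ext e (gen (X \<union> E) I) = gen (insert e (X \<union> E)) I"
      using insert.prems insert.hyps by (intro ext_gen[symmetric] sub) auto
    ultimately show ?case using insert.hyps by simp
  qed
  show ?thesis
    using F
  proof (induction F)
    case empty
    then show ?case using EX by simp
  next
    case (insert e F)
    then have "decomposable_with (insert e (X \<union> E \<union> F)) (ext e (gen (X \<union> E \<union> F) I)) (\<Prod>e\<in>E. var e)"
      by (intro decomposable_with_ext) auto
    moreover have "ext e (gen (X \<union> E \<union> F) I) = gen (insert e (X \<union> E \<union> F)) I"
      using insert.prems insert.hyps by (intro ext_gen[symmetric] sub) auto
    ultimately show ?case by simp
  qed
qed

text \<open>
  The variables in \<open>E\<close> are the factors of \<open>q\<close>; those in \<open>F\<close> are further ones that \<open>s\<close> may involve.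
\<close>

theorem gvd_add_binomial:
  fixes I :: "('v, 'k::field) mpoly set"
  assumes X: "finite X" and I: "primeideal I (mpoly_ring X)" and g: "gvd X I"
    and E: "finite E" "E \<inter> X = {}" and F: "finite F" "F \<inter> (X \<union> E) = {}" and y: "y \<notin> X \<union> E \<union> F"
    and s: "s \<in> polys (X \<union> E \<union> F)"
    and J: "J = gen (insert y (X \<union> E \<union> F)) (insert (var y * (\<Prod>e\<in>E. var e) + s) I)"
    and P: "primeideal J (mpoly_ring (insert y (X \<union> E \<union> F)))"
  shows "gvd (insert y (X \<union> E \<union> F)) J"
proof -
  let ?X = "X \<union> E \<union> F" and ?q = "\<Prod>e\<in>E. var e :: ('v, 'k) mpoly"
  let ?I = "gen ?X I"
  obtain r B where d: "finite ?X" "primeideal ?I (mpoly_ring ?X)" "gvd ?X ?I" "?q \<in> polys ?X" "?q \<notin> ?I"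
    "gvd ?X (gen ?X (insert ?q ?I))" "monomial_order ?X r" "groebner_basis ?X r B ?I"
    "groebner_basis ?X r (insert ?q B) (gen ?X (insert ?q ?I))"
    using decomposable_with_product[OF X I g E F] unfolding decomposable_with_def by blast
  have IX: "I \<subseteq> polys ?X" and IX': "I \<subseteq> polys (insert y ?X)"
    using ideal_subset[OF prime_ideal[OF I]] polys_mono[of X ?X] polys_mono[of X "insert y ?X"] by blast+
  have gX: "var y * ?q + s \<in> polys (insert y ?X)"
    using s d(4) polys_mono[of ?X "insert y ?X"] by (intro polys_add polys_mult polys_var) auto
  have "gen (insert y ?X) (insert (var y * ?q + s) ?I) = gen (insert y ?X) (insert (var y * ?q + s) (ext y ?I))"
    by (rule gen_step_eq[OF d(2) y d(4,5) s])
  also have "ext y ?I = gen (insert y ?X) I" by (rule ext_gen[OF IX y, symmetric])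
  also have "gen (insert y ?X) (insert (var y * ?q + s) \<dots>) = J" unfolding J by (rule gen_insert_gen[OF IX' gX])
  finally have eq: "gen (insert y ?X) (insert (var y * ?q + s) ?I) = J" .
  from gvd_step[OF d(2) y d(4,5) s d(3,6) _ d(7-9), unfolded eq, OF unmixed_prime[OF P]]
  show ?thesis .
qed


section \<open>Toric ideals of edge sets\<close>

text \<open>
  The map of monomials behind \<open>edge_hom\<close>.  For a monomial read as a multigraph, the exponent of a vertex
  in the result is its degree.
\<close>

definition vertex_degrees :: "('a set \<Rightarrow>\<^sub>0 nat) \<Rightarrow> ('a \<Rightarrow>\<^sub>0 nat)" where
  "vertex_degrees m = (\<Sum>e\<in>keys m. \<Sum>v\<in>e. single v (lookup m e))"

lemma vertex_degrees_add: "vertex_degrees (m + n) = vertex_degrees m + vertex_degrees n"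
  unfolding vertex_degrees_def
  by (rule setsum_keys_plus_distrib) (simp_all add: single_add sum.distrib)

lemma vertex_degrees_zero [simp]: "vertex_degrees 0 = 0"
  by (simp add: vertex_degrees_def)

lemma vertex_degrees_single: "vertex_degrees (single e j) = (\<Sum>v\<in>e. single v j)"
  by (cases "j = 0") (simp_all add: vertex_degrees_def)

lemma vertex_degrees_sum: "vertex_degrees (sum f A) = (\<Sum>i\<in>A. vertex_degrees (f i))"
  by (induction A rule: infinite_finite_induct) (simp_all add: vertex_degrees_add)

lemma monomials_sum: "(\<And>i. i \<in> A \<Longrightarrow> g i \<in> monomials X) \<Longrightarrow> sum g A \<in> monomials X"
  by (induction A rule: infinite_finite_induct) (auto intro: monomials_add)

lemma prod_single: "(\<Prod>i\<in>A. single (g i) 1) = single (sum g A) (1 :: 'k::comm_ring_1)"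
  by (induction A rule: infinite_finite_induct) (simp_all add: mult_single)

lemma single_one_power: "single m (1 :: 'k::comm_ring_1) ^ j = single (\<Sum>i<j. m) 1" for m :: "'v \<Rightarrow>\<^sub>0 nat"
  by (induction j) (simp_all add: mult_single add.commute)

lemma edge_hom_eq_push: "edge_hom p = push vertex_degrees p"
  unfolding edge_hom_def push_def
proof (intro sum.cong refl)
  fix m assume "m \<in> keys p"
  have "(\<Prod>v\<in>e. var v) ^ lookup m e = (single (\<Sum>v\<in>e. single v (lookup m e)) 1 :: ('a, 'b) mpoly)" for e
  proof -
    have "(\<Prod>v\<in>e. var v) ^ lookup m e = (\<Prod>v\<in>e. var v ^ lookup m e :: ('a, 'b) mpoly)"
      by (rule prod_power_distrib)
    then show ?thesis by (simp add: var_power prod_single)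
  qed
  then show "const (lookup p m) * (\<Prod>e\<in>keys m. (\<Prod>v\<in>e. var v) ^ lookup m e) = single (vertex_degrees m) (lookup p m)"
    by (simp add: prod_single const_def mult_single vertex_degrees_def)
qed

text \<open>
  The toric ideal depends on the edges only.
\<close>

definition toric_kernel :: "'a set set \<Rightarrow> ('a set, 'k::comm_ring_1) mpoly set" where
  "toric_kernel X = {p \<in> polys X. push vertex_degrees p = 0}"

lemma toric_ideal_eq: "toric_ideal G = toric_kernel (edges G)"
  unfolding toric_ideal_def a_kernel_def' toric_kernel_def by (simp add: edge_hom_eq_push)

lemma push_vertex_degrees_mult: "push vertex_degrees (p * q) = push vertex_degrees p * push vertex_degrees q"
  by (rule push_mult) (rule vertex_degrees_add)

lemma toric_kernel_prime: "primeideal (toric_kernel X :: ('a set, 'k::field) mpoly set) (mpoly_ring X)"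
  unfolding primeideal_mpoly_iff ideal_mpoly_iff
proof (intro conjI ballI impI)
  show "1 \<notin> (toric_kernel X :: ('a set, 'k) mpoly set)"
    by (simp add: toric_kernel_def push_one)
qed (auto simp: toric_kernel_def push_add push_vertex_degrees_mult mpoly_mult_eq_0_iff intro: polys_add polys_mult)

lemma toric_kernel_mono: "X \<subseteq> Y \<Longrightarrow> toric_kernel X \<subseteq> toric_kernel Y"
  using polys_mono[of X Y] by (auto simp: toric_kernel_def)

text \<open>
  An injection of the vertices commutes with \<open>vertex_degrees\<close> and is injective on \<open>K[V]\<close>.
\<close>

lemma toric_kernel_rename:
  fixes g :: "'a \<Rightarrow> 'b"
  assumes g: "inj_on g V" and X: "\<And>e. e \<in> X \<Longrightarrow> e \<subseteq> V"
  shows "toric_kernel ((`) g ` X) = (rename ((`) g) ` toric_kernel X :: ('b set, 'k::field) mpoly set)"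
proof -
  let ?g = "(`) g" and ?g' = "(`) (inv_into V g)"
  have inv: "inverse_on X ?g ?g'"
    unfolding inverse_on_def
  proof
    fix e assume "e \<in> X"
    then have "e \<subseteq> V" by (rule X)
    then show "inv_into V g ` g ` e = e" using g by (rule inv_into_image_cancel[rotated])
  qed
  have vd: "vertex_degrees (ren ?g m) = ren g (vertex_degrees m)" if "m \<in> monomials X" for m
  proof -
    have "vertex_degrees (ren ?g m) = (\<Sum>e\<in>keys m. vertex_degrees (single (g ` e) (lookup m e)))"
      unfolding ren_def by (rule vertex_degrees_sum)
    also have "\<dots> = (\<Sum>e\<in>keys m. ren g (\<Sum>v\<in>e. single v (lookup m e)))"
    proof (intro sum.cong refl)
      fix e assume "e \<in> keys m"
      then have "inj_on g e" using that X g by (auto simp: monomials_def intro: inj_on_subset)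
      moreover have "ren g (\<Sum>v\<in>A. single v j) = (\<Sum>v\<in>A. single (g v) j)" for A and j :: nat
        by (induction A rule: infinite_finite_induct) (simp_all add: ren_add)
      ultimately show "vertex_degrees (single (g ` e) (lookup m e)) = ren g (\<Sum>v\<in>e. single v (lookup m e))"
        by (simp add: vertex_degrees_single sum.reindex)
    qed
    also have "\<dots> = ren g (vertex_degrees m)"
    proof -
      have "ren g (sum F A) = (\<Sum>i\<in>A. ren g (F i))" for F :: "'a set \<Rightarrow> _" and A
        by (induction A rule: infinite_finite_induct) (simp_all add: ren_add)
      then show ?thesis unfolding vertex_degrees_def by simp
    qed
    finally show ?thesis .
  qed
  have V: "vertex_degrees m \<in> monomials V" if "m \<in> monomials X" for m
    unfolding vertex_degrees_def
    by (intro monomials_sum monomials_single) (use that X in \<open>auto simp: monomials_def\<close>)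
  have mem: "push vertex_degrees (rename ?g p) = 0 \<longleftrightarrow> push vertex_degrees p = 0"
    if p: "p \<in> polys X" for p :: "('a set, 'k) mpoly"
  proof -
    have "push vertex_degrees (rename ?g p) = push (vertex_degrees \<circ> ren ?g) p" by (rule push_comp)
    also have "\<dots> = push (ren g \<circ> vertex_degrees) p"
      unfolding push_def using vd polys_keysD[OF p] by (intro sum.cong) auto
    also have "\<dots> = rename g (push vertex_degrees p)" by (rule push_comp[symmetric])
    finally have e: "push vertex_degrees (rename ?g p) = rename g (push vertex_degrees p)" .
    have "push vertex_degrees p \<in> polys V" by (intro push_polys V polys_keysD[OF p])
    moreover have "inverse_on V g (inv_into V g)" using g by (simp add: inverse_on_def)
    ultimately show ?thesis unfolding e by (intro rename_eq_0_iff)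
  qed
  show ?thesis
  proof (intro equalityI subsetI)
    fix q :: "('b set, 'k) mpoly" assume q: "q \<in> toric_kernel (?g ` X)"
    then have "q \<in> rename ?g ` polys X" unfolding rename_polys_image[OF inv] by (simp add: toric_kernel_def)
    then obtain p where p: "q = rename ?g p" "p \<in> polys X" by blast
    then show "q \<in> rename ?g ` toric_kernel X" using q mem[OF p(2)] by (simp add: toric_kernel_def)
  next
    fix q :: "('b set, 'k) mpoly" assume "q \<in> rename ?g ` toric_kernel X"
    then obtain p where p: "q = rename ?g p" "p \<in> polys X" "push vertex_degrees p = 0"
      by (auto simp: toric_kernel_def)
    then show "q \<in> toric_kernel (?g ` X)" using mem[OF p(2)] rename_polys[OF p(2), of ?g] by (simp add: toric_kernel_def)
  qed
qed

text \<open>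
  The coefficients of \<open>p\<close> over one fibre of \<open>\<phi>\<close> add up to zero.  So each monomial of \<open>p\<close> shares its fibre
  with a second one, and subtracting a multiple of their difference removes the first.
\<close>

lemma push_kernel_subset:
  fixes J :: "('v, 'k::field) mpoly set"
  assumes J: "ideal J (mpoly_ring X)"
    and d: "\<And>m m'. m \<in> monomials X \<Longrightarrow> m' \<in> monomials X \<Longrightarrow> \<phi> m = \<phi> m' \<Longrightarrow> single m 1 - single m' 1 \<in> J"
  shows "p \<in> polys X \<Longrightarrow> push \<phi> p = 0 \<Longrightarrow> p \<in> J"
proof (induction "card (keys p)" arbitrary: p rule: less_induct)
  case less
  show ?case
  proof (cases "p = 0")
    case True
    then show ?thesis using ideal_zero[OF J] by simp
  next
    case False
    then obtain m where m: "m \<in> keys p" by fastforce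
    have "(\<Sum>n\<in>{n \<in> keys p. \<phi> n = \<phi> m}. lookup p n) = 0"
      using lookup_push[of \<phi> p "\<phi> m"] less.prems(2) by simp
    then have "lookup p m + (\<Sum>n\<in>{n \<in> keys p. \<phi> n = \<phi> m} - {m}. lookup p n) = 0"
      using m by (subst (asm) sum.remove[of _ m]) auto
    moreover have "lookup p m \<noteq> 0" using m by (simp add: in_keys_iff)
    ultimately have "{n \<in> keys p. \<phi> n = \<phi> m} - {m} \<noteq> {}" by (metis add.right_neutral sum.empty)
    then obtain m' where m': "m' \<in> keys p" "\<phi> m' = \<phi> m" "m' \<noteq> m" by blast
    define c where "c = lookup p m"
    define p' where "p' = p - single 0 c * (single m 1 - single m' 1)"
    have sd: "single 0 c * (single m 1 - single m' 1) = single m c - single m' c"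
      by (simp add: right_diff_distrib mult_single)
    have mX: "m \<in> monomials X" "m' \<in> monomials X" using polys_keysD[OF less.prems(1)] m m'(1) by auto
    have l: "lookup p' n = (if n = m then 0 else if n = m' then lookup p m' + c else lookup p n)" for n
      unfolding p'_def sd using m'(3) by (auto simp: lookup_minus lookup_single when_def c_def)
    have "keys p' \<subseteq> keys p - {m}" using m'(1) by (auto simp: in_keys_iff l split: if_splits)
    then have "card (keys p') < card (keys p)"
      using m by (metis card_Diff1_less card_mono finite_Diff finite_keys le_less_trans)
    moreover have "p' \<in> polys X" unfolding p'_def sd using mX by (intro polys_minus polys_single less.prems)
    moreover have "push \<phi> p' = 0" unfolding p'_def sd push_minus by (simp add: less.prems(2) m'(2))
    ultimately have "p' \<in> J" by (rule less.hyps)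
    moreover have "single 0 c * (single m 1 - single m' 1) \<in> J"
      using d[OF mX] m'(2) by (intro ideal_mult[OF J polys_single]) auto
    ultimately have "p' + single 0 c * (single m 1 - single m' 1) \<in> J" by (rule ideal_add[OF J])
    then show ?thesis by (simp add: p'_def)
  qed
qed

definition restr :: "'v set \<Rightarrow> ('v \<Rightarrow>\<^sub>0 nat) \<Rightarrow> ('v \<Rightarrow>\<^sub>0 nat)" where
  "restr S m = (\<Sum>v\<in>keys m \<inter> S. single v (lookup m v))"

lemma lookup_restr: "lookup (restr S m) v = (if v \<in> S then lookup m v else 0)"
proof -
  have "lookup (restr S m) v = (\<Sum>u\<in>keys m \<inter> S. if u = v then lookup m v else 0)"
    unfolding restr_def lookup_sum lookup_single when_def by (intro sum.cong) auto
  then show ?thesis by (simp add: in_keys_iff)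
qed

lemma power_diff_mem:
  assumes J: "ideal J (mpoly_ring X)" and "a \<in> polys X" "b \<in> polys X" "a - b \<in> J"
  shows "a ^ n - b ^ n \<in> J"
proof (induction n)
  case (Suc n)
  have "a ^ Suc n - b ^ Suc n = a * (a ^ n - b ^ n) + b ^ n * (a - b)" by (simp add: algebra_simps)
  then show ?case using assms Suc by (simp add: ideal_add ideal_mult polys_power)
qed (use ideal_zero[OF J] in simp)


section \<open>The toric ideal after gluing an even cycle\<close>

definition cycle_edge :: "(nat \<Rightarrow> 'a) \<Rightarrow> nat \<Rightarrow> nat \<Rightarrow> 'a set" where
  "cycle_edge w k i = {w i, w (Suc i mod (2 * k))}"

text \<open>
  The set \<open>X\<close> consists of the edges of the given graph, and \<open>w 0, \<dots>, w (2 k - 1)\<close> are the vertices of the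
  cycle in cyclic order, of which only \<open>w 0\<close> and \<open>w 1\<close> are old.  The edges \<open>A i\<close> and \<open>B i\<close> are those in odd
  and in even position; \<open>B 0\<close> is the edge of the gluing.
\<close>

context
  fixes X :: "'a set set" and w :: "nat \<Rightarrow> 'a" and k :: nat
  assumes k: "k \<ge> 2" and w: "inj_on w {..<2 * k}"
    and X: "finite X" "\<And>e. e \<in> X \<Longrightarrow> finite e"
    and new: "\<And>e j. e \<in> X \<Longrightarrow> 2 \<le> j \<Longrightarrow> j < 2 * k \<Longrightarrow> w j \<notin> e"
    and e0: "{w 0, w 1} \<in> X"
begin

private abbreviation "f \<equiv> cycle_edge w k"
private abbreviation "A \<equiv> \<lambda>i. f (Suc (2 * i))"
private abbreviation "B \<equiv> \<lambda>i. f (2 * i)"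
private abbreviation "E \<equiv> X \<union> f ` {..<2 * k}"

private lemma w_eq_iff: "i < 2 * k \<Longrightarrow> j < 2 * k \<Longrightarrow> w i = w j \<longleftrightarrow> i = j"
  using w by (auto simp: inj_on_def)

private lemma suc_mod: "i < 2 * k \<Longrightarrow> Suc i mod (2 * k) = (if Suc i = 2 * k then 0 else Suc i)"
  by auto

private lemma suc_mod_less: "Suc i mod (2 * k) < 2 * k"
  using k by simp

private lemma mem_f_iff: "i < 2 * k \<Longrightarrow> j < 2 * k \<Longrightarrow> w j \<in> f i \<longleftrightarrow> j = i \<or> j = Suc i mod (2 * k)"
  unfolding cycle_edge_def using w_eq_iff suc_mod_less by auto

private lemma f_eq_iff:
  assumes "i < 2 * k" "j < 2 * k" shows "f i = f j \<longleftrightarrow> i = j"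
proof
  assume eq: "f i = f j"
  have "w i \<in> f j" "w j \<in> f i" using eq[symmetric] by (auto simp: cycle_edge_def)
  then have "(i = j \<or> i = Suc j mod (2 * k)) \<and> (j = i \<or> j = Suc i mod (2 * k))"
    using mem_f_iff assms by blast
  then show "i = j" using suc_mod[OF assms(1)] suc_mod[OF assms(2)] k by (auto split: if_splits)
qed simp

private lemma f_notin_X: "1 \<le> i \<Longrightarrow> i < 2 * k \<Longrightarrow> f i \<notin> X"
proof
  assume i: "1 \<le> i" "i < 2 * k" "f i \<in> X"
  show False
  proof (cases "i = 1")
    case True
    then have "w 2 \<in> f i" using mem_f_iff[of i 2] i k suc_mod[of i] by auto
    then show False using new[OF i(3), of 2] k by auto
  next
    case False
    then show False using new[OF i(3), of i] i by (auto simp: cycle_edge_def)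
  qed
qed

private lemma f0: "f 0 = {w 0, w 1}"
  using suc_mod[of 0] k by (simp add: cycle_edge_def)

private lemma finE: "finite E"
  using X by simp

private lemma finite_edge: "e \<in> E \<Longrightarrow> finite e"
  using X by (auto simp: cycle_edge_def)

private lemma AB_less: "i < k \<Longrightarrow> Suc (2 * i) < 2 * k" "i < k \<Longrightarrow> 2 * i < 2 * k"
  by auto

private definition odd_monomial :: "nat \<Rightarrow> 'a set \<Rightarrow>\<^sub>0 nat" where
  "odd_monomial d = (\<Sum>i<k. single (A i) d)"

private definition even_monomial :: "nat \<Rightarrow> 'a set \<Rightarrow>\<^sub>0 nat" where
  "even_monomial d = (\<Sum>i<k. single (B i) d)"

text \<open>
  The odd edges cover every vertex of the cycle once, and so do the even ones.
\<close>

private lemma odd_even_degrees: "vertex_degrees (odd_monomial d) = vertex_degrees (even_monomial d)"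
proof -
  define s where "s i = single (w (i mod (2 * k))) d" for i
  have e: "vertex_degrees (single (f i) d) = s i + s (Suc i)" if "i < 2 * k" for i
  proof -
    have "w i \<noteq> w (Suc i mod (2 * k))"
      using w_eq_iff[OF that suc_mod_less, of i] suc_mod[OF that] k by (auto split: if_splits)
    then show ?thesis unfolding vertex_degrees_single s_def cycle_edge_def using that by simp
  qed
  have "s (2 * k) = s 0" by (simp add: s_def)
  then have "(\<Sum>i<k. s (Suc (Suc (2 * i)))) = (\<Sum>i<k. s (2 * i))"
    using sum.lessThan_Suc_shift[of "\<lambda>i. s (2 * i)" k] by (simp add: add.commute)
  moreover have "vertex_degrees (odd_monomial d) = (\<Sum>i<k. s (Suc (2 * i)) + s (Suc (Suc (2 * i))))"
    unfolding odd_monomial_def vertex_degrees_sum by (intro sum.cong refl e AB_less) simp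
  moreover have "vertex_degrees (even_monomial d) = (\<Sum>i<k. s (2 * i) + s (Suc (2 * i)))"
    unfolding even_monomial_def vertex_degrees_sum by (intro sum.cong refl e AB_less) simp
  ultimately show ?thesis by (simp add: sum.distrib add.commute)
qed

private lemma lookup_odd:
  "i < k \<Longrightarrow> lookup (odd_monomial d) (A i) = d" "i < k \<Longrightarrow> lookup (odd_monomial d) (B i) = 0"
  "e \<in> X \<Longrightarrow> lookup (odd_monomial d) e = 0"
proof -
  assume i: "i < k"
  have "lookup (odd_monomial d) (A i) = (\<Sum>j<k. if j = i then d else 0)"
    unfolding odd_monomial_def lookup_sum lookup_single when_def
    using i by (intro sum.cong refl) (auto simp: f_eq_iff)
  then show "lookup (odd_monomial d) (A i) = d" using i by simp
  show "lookup (odd_monomial d) (B i) = 0"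
    unfolding odd_monomial_def lookup_sum lookup_single when_def
    using i by (intro sum.neutral ballI) (auto simp: f_eq_iff, presburger)
next
  assume "e \<in> X"
  then show "lookup (odd_monomial d) e = 0"
    unfolding odd_monomial_def lookup_sum lookup_single when_def
    using f_notin_X AB_less by (intro sum.neutral ballI) auto
qed

private lemma lookup_even:
  "i < k \<Longrightarrow> lookup (even_monomial d) (B i) = d" "i < k \<Longrightarrow> lookup (even_monomial d) (A i) = 0"
proof -
  assume i: "i < k"
  have "lookup (even_monomial d) (B i) = (\<Sum>j<k. if j = i then d else 0)"
    unfolding even_monomial_def lookup_sum lookup_single when_def
    using i by (intro sum.cong refl) (auto simp: f_eq_iff)
  then show "lookup (even_monomial d) (B i) = d" using i by simp
  show "lookup (even_monomial d) (A i) = 0"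
    unfolding even_monomial_def lookup_sum lookup_single when_def
    using i by (intro sum.neutral ballI) (auto simp: f_eq_iff, presburger)
qed

private lemma odd_monomials: "odd_monomial d \<in> monomials E" "even_monomial d \<in> monomials E"
  unfolding odd_monomial_def even_monomial_def
  by (intro monomials_sum monomials_single; simp)+

text \<open>The vertex \<open>w (j + 1)\<close> is new, so no edges other than the two neighbouring ones of the cycle contain it.\<close>

private lemma degree_new_vertex:
  assumes m: "m \<in> monomials E" and j: "2 \<le> Suc j" "Suc j < 2 * k"
  shows "lookup (vertex_degrees m) (w (Suc j)) = lookup m (f j) + lookup m (f (Suc j))"
proof -
  have "lookup (vertex_degrees m) (w (Suc j)) = (\<Sum>e\<in>keys m. if w (Suc j) \<in> e then lookup m e else 0)"
    unfolding vertex_degrees_def lookup_sum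
  proof (intro sum.cong refl)
    fix e assume "e \<in> keys m"
    then have "finite e" using m finite_edge by (auto simp: monomials_def)
    then show "(\<Sum>v\<in>e. lookup (single v (lookup m e)) (w (Suc j))) = (if w (Suc j) \<in> e then lookup m e else 0)"
      by (simp add: lookup_single when_def)
  qed
  also have "\<dots> = (\<Sum>e\<in>E. if w (Suc j) \<in> e then lookup m e else 0)"
    using m by (intro sum.mono_neutral_left finE) (auto simp: monomials_def in_keys_iff)
  also have "\<dots> = (\<Sum>e\<in>{f j, f (Suc j)}. if w (Suc j) \<in> e then lookup m e else 0)"
  proof (rule sum.mono_neutral_right[OF finE])
    show "{f j, f (Suc j)} \<subseteq> E" using j by auto
    show "\<forall>e\<in>E - {f j, f (Suc j)}. (if w (Suc j) \<in> e then lookup m e else 0) = 0"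
    proof
      fix e assume e: "e \<in> E - {f j, f (Suc j)}"
      have "w (Suc j) \<notin> e"
      proof (cases "e \<in> X")
        case True
        then show ?thesis using new j by blast
      next
        case False
        then obtain i where i: "i < 2 * k" "e = f i" using e by blast
        then have "i \<noteq> j" "i \<noteq> Suc j" using e by auto
        then show ?thesis using mem_f_iff[OF i(1) j(2)] suc_mod[OF i(1)] i(2) by auto
      qed
      then show "(if w (Suc j) \<in> e then lookup m e else 0) = 0" by simp
    qed
  qed
  also have "\<dots> = lookup m (f j) + lookup m (f (Suc j))"
  proof -
    have "f j \<noteq> f (Suc j)" using f_eq_iff[of j "Suc j"] j by simp
    moreover have "w (Suc j) \<in> f j" "w (Suc j) \<in> f (Suc j)"
      using mem_f_iff[of j "Suc j"] mem_f_iff[of "Suc j" "Suc j"] suc_mod[of j] j by auto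
    ultimately show ?thesis by simp
  qed
  finally show ?thesis .
qed

text \<open>
  The sum of the exponents of two consecutive cycle edges is the degree of the vertex between them, so
  an excess \<open>d\<close> at \<open>f 1\<close> is followed by a deficit \<open>d\<close> at \<open>f 2\<close>, and so on.
\<close>

private lemma alternate:
  assumes m: "m \<in> monomials E" "m' \<in> monomials E" and eq: "vertex_degrees m = vertex_degrees m'"
    and d: "lookup m (f 1) = lookup m' (f 1) + d"
  shows "i < k \<Longrightarrow> lookup m (A i) = lookup m' (A i) + d"
    and "1 \<le> i \<Longrightarrow> i < k \<Longrightarrow> lookup m' (B i) = lookup m (B i) + d"
proof -
  have step: "lookup m (f j) + lookup m (f (Suc j)) = lookup m' (f j) + lookup m' (f (Suc j))"
    if "1 \<le> j" "Suc j < 2 * k" for j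
    using degree_new_vertex[OF m(1), of j] degree_new_vertex[OF m(2), of j] that eq by simp
  have odd: "i < k \<longrightarrow> lookup m (A i) = lookup m' (A i) + d" for i
  proof (induction i)
    case 0
    then show ?case using d by simp
  next
    case (Suc i)
    show ?case
    proof
      assume i: "Suc i < k"
      then have "lookup m (A i) = lookup m' (A i) + d" using Suc by simp
      moreover note step[of "Suc (2 * i)"] step[of "Suc (Suc (2 * i))"]
      ultimately show "lookup m (A (Suc i)) = lookup m' (A (Suc i)) + d" using i by simp
    qed
  qed
  then show "i < k \<Longrightarrow> lookup m (A i) = lookup m' (A i) + d" by blast
  assume i: "1 \<le> i" "i < k"
  then obtain j where j: "i = Suc j" by (cases i) auto
  show "lookup m' (B i) = lookup m (B i) + d"
    using odd[of j] step[of "Suc (2 * j)"] i unfolding j by simp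
qed

private abbreviation binomial :: "('a set, 'k::field) mpoly" where
  "binomial \<equiv> (\<Prod>i<k. var (A i)) - (\<Prod>i<k. var (B i))"

private lemma prods: "(\<Prod>i<k. var (A i)) = (single (odd_monomial 1) 1 :: ('a set, 'k::field) mpoly)"
  "(\<Prod>i<k. var (B i)) = (single (even_monomial 1) 1 :: ('a set, 'k::field) mpoly)"
  unfolding var_def odd_monomial_def even_monomial_def by (rule prod_single)+

private lemma power_prods: "(single (odd_monomial 1) 1 :: ('a set, 'k::field) mpoly) ^ d = single (odd_monomial d) 1"
  "(single (even_monomial 1) 1 :: ('a set, 'k::field) mpoly) ^ d = single (even_monomial d) 1"
proof -
  have "(\<Sum>j<d. \<Sum>i<k. single (h i) 1) = (\<Sum>i<k. single (h i) d)" for h :: "nat \<Rightarrow> 'a set"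
  proof -
    have "(\<Sum>j<d. single e (1::nat)) = single e d" for e :: "'a set"
      by (induction d) (simp_all add: single_add[symmetric] add.commute)
    then show ?thesis by (subst sum.swap) simp
  qed
  then show "(single (odd_monomial 1) 1 :: ('a set, 'k::field) mpoly) ^ d = single (odd_monomial d) 1"
    "(single (even_monomial 1) 1 :: ('a set, 'k::field) mpoly) ^ d = single (even_monomial d) 1"
    unfolding single_one_power odd_monomial_def even_monomial_def by simp_all
qed

private lemma binomial_mem: "(binomial :: ('a set, 'k::field) mpoly) \<in> toric_kernel E"
  unfolding prods toric_kernel_def
  using odd_monomials odd_even_degrees[of 1] by (auto simp: push_minus intro!: polys_minus polys_single)

text \<open>
  Modulo the binomial, the excess of \<open>m\<close> on the odd edges can be moved to the even ones.  After that the
  monomials differ on \<open>X\<close> only, by an element of the toric ideal of \<open>X\<close>.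
\<close>

private lemma monomial_difference_mem:
  fixes J :: "('a set, 'k::field) mpoly set"
  assumes J: "ideal J (mpoly_ring E)" and sub: "insert binomial (toric_kernel X) \<subseteq> J"
    and m: "m \<in> monomials E" "m' \<in> monomials E" and eq: "vertex_degrees m = vertex_degrees m'"
    and le: "lookup m' (f 1) \<le> lookup m (f 1)"
  shows "single m 1 - single m' 1 \<in> J"
proof -
  define d where "d = lookup m (f 1) - lookup m' (f 1)"
  have d: "lookup m (f 1) = lookup m' (f 1) + d" using le by (simp add: d_def)
  note alt = alternate[OF m eq d]
  \<comment> \<open>trade \<open>d\<close> copies of the odd edges of the cycle for the even ones\<close>
  define m1 where "m1 = m - odd_monomial d"
  define m2 where "m2 = m1 + even_monomial d"
  have cases_E: "(\<exists>i<k. e = A i) \<or> (\<exists>i. 1 \<le> i \<and> i < k \<and> e = B i)" if e: "e \<in> E" "e \<notin> X" for e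
  proof -
    obtain i where i: "i < 2 * k" "e = f i" using e by blast
    have "i \<noteq> 0"
    proof
      assume "i = 0"
      then have "e = {w 0, w 1}" using i(2) f0 by simp
      then show False using e(2) e0 by simp
    qed
    show ?thesis
    proof (cases "even i")
      case True
      then obtain j where "i = 2 * j" by blast
      then have "1 \<le> j" "j < k" "e = B j" using i \<open>i \<noteq> 0\<close> by auto
      then show ?thesis by blast
    next
      case False
      then obtain j where "i = Suc (2 * j)" by (metis oddE Suc_eq_plus1)
      then have "j < k" "e = A j" using i by auto
      then show ?thesis by blast
    qed
  qed
  have m_eq: "m = m1 + odd_monomial d"
  proof (rule poly_mapping_eqI)
    fix e
    have "lookup (odd_monomial d) e \<le> lookup m e"
    proof (cases "e \<in> E")
      case True
      show ?thesis
      proof (cases "e \<in> X")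
        case True
        then show ?thesis by (simp add: lookup_odd)
      next
        case False
        then show ?thesis using cases_E[OF True] alt by (auto simp: lookup_odd)
      qed
    next
      case False
      then show ?thesis using odd_monomials(1)[of d] by (simp add: monomials_iff)
    qed
    then show "lookup m e = lookup (m1 + odd_monomial d) e" by (simp add: m1_def lookup_add lookup_minus)
  qed
  have m1: "m1 \<in> monomials E" using m(1) monomials_addD unfolding m_eq by blast
  have m2: "m2 \<in> monomials E" unfolding m2_def using m1 odd_monomials(2) by (rule monomials_add)
  have oE: "single (odd_monomial 1) 1 \<in> (polys E :: ('a set, 'k) mpoly set)"
    "single (even_monomial 1) 1 \<in> (polys E :: ('a set, 'k) mpoly set)"
    using odd_monomials by (auto intro: polys_single)
  have "single (odd_monomial 1) 1 - single (even_monomial 1) 1 \<in> J" using sub unfolding prods by blast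
  then have "single (odd_monomial d) 1 - single (even_monomial d) 1 \<in> J"
    using power_diff_mem[OF J oE, of d] unfolding power_prods by blast
  then have "single m1 1 * (single (odd_monomial d) 1 - single (even_monomial d) 1) \<in> J"
    by (intro ideal_mult[OF J] polys_single m1)
  then have 1: "single m 1 - single m2 1 \<in> J"
    by (subst m_eq) (simp add: m2_def right_diff_distrib mult_single)
  \<comment> \<open>now the two monomials agree on all new edges\<close>
  have agree: "lookup m2 e = lookup m' e" if "e \<notin> X" for e
  proof (cases "e \<in> E")
    case True
    have m1l: "lookup m1 e = lookup m e - lookup (odd_monomial d) e" for e by (simp add: m1_def lookup_minus)
    show ?thesis using cases_E[OF True that] alt
      by (auto simp: m2_def lookup_add m1l lookup_odd lookup_even)
  next
    case False
    then show ?thesis using m2 m(2) by (simp add: monomials_iff)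
  qed
  define t where "t = restr (- X) m'"
  define x2 where "x2 = restr X m2"
  define x' where "x' = restr X m'"
  have m2_eq: "m2 = t + x2" and m'_eq: "m' = t + x'"
    unfolding t_def x2_def x'_def by (rule poly_mapping_eqI; auto simp: lookup_add lookup_restr agree)+
  have tE: "t \<in> monomials E" using m(2) monomials_addD unfolding m'_eq by blast
  have xX: "x2 \<in> monomials X" "x' \<in> monomials X" unfolding x2_def x'_def by (auto simp: monomials_iff lookup_restr)
  have "vertex_degrees m2 = vertex_degrees m'"
    unfolding m2_def vertex_degrees_add odd_even_degrees[symmetric] eq[symmetric]
    by (subst m_eq) (simp add: vertex_degrees_add)
  then have "vertex_degrees x2 = vertex_degrees x'" unfolding m2_eq m'_eq vertex_degrees_add by simp
  then have "single x2 1 - single x' 1 \<in> (toric_kernel X :: ('a set, 'k) mpoly set)"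
    using xX by (auto simp: toric_kernel_def push_minus intro!: polys_minus polys_single)
  then have "single t 1 * (single x2 1 - single x' 1) \<in> J"
    using sub by (intro ideal_mult[OF J] polys_single tE) blast
  then have 2: "single m2 1 - single m' 1 \<in> J"
    unfolding m2_eq m'_eq by (simp add: right_diff_distrib mult_single)
  show ?thesis using ideal_add[OF J 1 2] by simp
qed

theorem toric_kernel_add_cycle:
  "(toric_kernel E :: ('a set, 'k::field) mpoly set) = gen E (insert binomial (toric_kernel X))"
proof
  have XE: "(toric_kernel X :: ('a set, 'k) mpoly set) \<subseteq> toric_kernel E" by (rule toric_kernel_mono) blast
  note T = prime_ideal[OF toric_kernel_prime[of E, where 'k = 'k]]
  have sub: "insert binomial (toric_kernel X) \<subseteq> (polys E :: ('a set, 'k) mpoly set)"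
    using binomial_mem XE ideal_subset[OF T] by blast
  show "gen E (insert binomial (toric_kernel X)) \<subseteq> (toric_kernel E :: ('a set, 'k) mpoly set)"
    using binomial_mem XE by (intro gen_least T) blast
  show "(toric_kernel E :: ('a set, 'k) mpoly set) \<subseteq> gen E (insert binomial (toric_kernel X))"
  proof
    fix p :: "('a set, 'k) mpoly" assume p: "p \<in> toric_kernel E"
    note J = gen_ideal[OF sub] and s = gen_superset[OF sub]
    show "p \<in> gen E (insert binomial (toric_kernel X))"
    proof (rule push_kernel_subset[OF J])
      fix m m' assume m: "m \<in> monomials E" "m' \<in> monomials E" "vertex_degrees m = vertex_degrees m'"
      show "single m 1 - single m' 1 \<in> (gen E (insert binomial (toric_kernel X)) :: ('a set, 'k) mpoly set)"
      proof (cases "lookup m' (f 1) \<le> lookup m (f 1)")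
        case True
        show ?thesis by (rule monomial_difference_mem[OF J s m True])
      next
        case False
        then have "single m' 1 - single m 1 \<in> (gen E (insert binomial (toric_kernel X)) :: ('a set, 'k) mpoly set)"
          by (intro monomial_difference_mem[OF J s m(2,1) m(3)[symmetric]]) simp
        then show ?thesis using ideal_uminus[OF J] by fastforce
      qed
    qed (use p in \<open>auto simp: toric_kernel_def\<close>)
  qed
qed

text \<open>
  The odd edge \<open>f 1\<close> plays the role of \<open>y\<close>, the other odd edges are the factors of \<open>q\<close>, and \<open>s\<close> is the
  negative product of the even edges, among them the old edge \<open>f 0\<close>.
\<close>

theorem gvd_add_cycle:
  assumes g: "gvd X (toric_kernel X :: ('a set, 'k::field) mpoly set)"
  shows "gvd E (toric_kernel E :: ('a set, 'k) mpoly set)"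
proof -
  let ?A = "A ` {1..<k}" and ?B = "B ` {1..<k}"
  let ?s = "- (\<Prod>i<k. var (B i)) :: ('a set, 'k) mpoly"
  have less: "i < k" "Suc (2 * i) < 2 * k" "2 * i < 2 * k" if "i \<in> {1..<k}" for i using that by auto
  have injA: "inj_on A {1..<k}" by (intro inj_onI) (auto simp: f_eq_iff)
  have AX: "?A \<inter> X = {}" "?B \<inter> X = {}" using f_notin_X by auto
  have AB: "?B \<inter> ?A = {}"
  proof -
    have "f (2 * i) \<noteq> f (Suc (2 * j))" if "i < k" "j < k" for i j
    proof -
      have "2 * i \<noteq> Suc (2 * j)" by presburger
      then show ?thesis using f_eq_iff[of "2 * i" "Suc (2 * j)"] that by simp
    qed
    then show ?thesis by fastforce
  qed
  have y: "f 1 \<notin> X \<union> ?A \<union> ?B"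
  proof -
    have "f 1 \<noteq> A i \<and> f 1 \<noteq> B i" if "i \<in> {1..<k}" for i
    proof -
      have "1 \<noteq> 2 * i" by presburger
      then show ?thesis using f_eq_iff[of 1 "Suc (2 * i)"] f_eq_iff[of 1 "2 * i"] that by simp
    qed
    then have "f 1 \<notin> ?A" "f 1 \<notin> ?B" by blast+
    then show ?thesis using f_notin_X[of 1] k by simp
  qed
  have k0: "{..<k} = insert 0 {1..<k}" using k by auto
  have EE: "E = insert (f 1) (X \<union> ?A \<union> ?B)"
  proof
    show "E \<subseteq> insert (f 1) (X \<union> ?A \<union> ?B)"
    proof
      fix e assume "e \<in> E"
      then consider "e \<in> X" | i where "i < 2 * k" "e = f i" by blast
      then show "e \<in> insert (f 1) (X \<union> ?A \<union> ?B)"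
      proof cases
        case 2
        show ?thesis
        proof (cases "even i")
          case True
          then obtain j where j: "i = 2 * j" by blast
          show ?thesis
          proof (cases "j = 0")
            case True
            then show ?thesis using 2 j f0 e0 by simp
          next
            case False
            then have "e \<in> ?B" using 2 j by auto
            then show ?thesis by blast
          qed
        next
          case False
          then obtain j where j: "i = Suc (2 * j)" by (metis oddE Suc_eq_plus1)
          show ?thesis
          proof (cases "j = 0")
            case True
            then show ?thesis using 2 j by simp
          next
            case False
            then have "e \<in> ?A" using 2 j by auto
            then show ?thesis by blast
          qed
        qed
      qed simp
    qed
    show "insert (f 1) (X \<union> ?A \<union> ?B) \<subseteq> E" using less k by auto
  qed
  have pA: "(\<Prod>i<k. var (A i)) = var (f 1) * (\<Prod>e\<in>?A. var e :: ('a set, 'k) mpoly)"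
    unfolding k0 prod.reindex[OF injA] by simp
  have J: "toric_kernel E = gen (insert (f 1) (X \<union> ?A \<union> ?B))
      (insert (var (f 1) * (\<Prod>e\<in>?A. var e) + ?s) (toric_kernel X))"
    unfolding toric_kernel_add_cycle EE[symmetric] pA by simp
  have s: "?s \<in> polys (X \<union> ?A \<union> ?B)"
    using f0 e0 unfolding k0 by (auto intro!: polys_uminus polys_mult polys_prod polys_var)
  show ?thesis
    unfolding EE
  proof (rule gvd_add_binomial[OF X(1) toric_kernel_prime g _ AX(1) _ _ y s])
    show "toric_kernel (insert (f 1) (X \<union> ?A \<union> ?B)) = gen (insert (f 1) (X \<union> ?A \<union> ?B))
      (insert (var (f 1) * (\<Prod>e\<in>?A. var e) + ?s) (toric_kernel X))" using J unfolding EE .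
  qed (use AX AB toric_kernel_prime in auto)
qed

end


section \<open>The graph obtained by gluing a cycle\<close>

text \<open>
  Rotating the numbering moves the given edge to the position 0.
\<close>

lemma cycle_graph_from_edge:
  assumes C: "cycle_graph n C" and cd: "{c, d} \<in> edges C"
  obtains v where "inj_on v {..<n}" "verts C = v ` {..<n}"
    "edges C = {{v i, v (Suc i mod n)} | i. i < n}" "{c, d} = {v 0, v 1}"
proof -
  from C obtain u where n: "n \<ge> 3" and u: "inj_on u {..<n}" "verts C = u ` {..<n}"
    "edges C = {{u i, u (Suc i mod n)} | i. i < n}" unfolding cycle_graph_def by blast
  obtain s where s: "s < n" "{c, d} = {u s, u (Suc s mod n)}" using cd u(3) by blast
  define r where "r i = (s + i) mod n" for i
  have r: "r ` {..<n} = {..<n}" "inj_on r {..<n}"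
  proof -
    show inj: "inj_on r {..<n}"
    proof (rule inj_onI)
      fix i j assume ij: "i \<in> {..<n}" "j \<in> {..<n}" "r i = r j"
      have "r l = (if s + l < n then s + l else s + l - n)" if "l < n" for l
        unfolding r_def using that s(1) by (auto simp: mod_if)
      then show "i = j" using ij s(1) by (auto split: if_splits)
    qed
    have "r ` {..<n} \<subseteq> {..<n}" using n by (auto simp: r_def)
    then show "r ` {..<n} = {..<n}" using inj by (intro endo_inj_surj) auto
  qed
  define v where "v = u \<circ> r"
  have suc: "r (Suc i mod n) = Suc (r i) mod n" for i
    unfolding r_def by (simp add: mod_simps)
  show ?thesis
  proof (rule that)
    show "inj_on v {..<n}" unfolding v_def using u(1) r by (intro comp_inj_on) simp_all
    show "verts C = v ` {..<n}" unfolding v_def image_comp[symmetric] r(1) u(2) ..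
    have "{{v i, v (Suc i mod n)} | i. i < n} = (\<lambda>j. {u j, u (Suc j mod n)}) ` r ` {..<n}"
      by (auto simp: v_def suc)
    also have "\<dots> = edges C" unfolding r(1) u(3) by auto
    finally show "edges C = {{v i, v (Suc i mod n)} | i. i < n}" ..
    show "{c, d} = {v 0, v 1}" using s n by (simp add: v_def r_def)
  qed
qed

text \<open>
  The isomorphism onto \<open>H\<close>, restricted to the vertices of \<open>G\<close>, is \<open>g\<close>; composed with the identification
  of \<open>c, d\<close> with \<open>a, b\<close> on the cycle it yields \<open>w\<close>.
\<close>

lemma glued_graph:
  fixes G :: "'a ugraph" and C :: "'b ugraph" and H :: "'c ugraph"
  assumes G: "finite_simple_graph G" and C: "cycle_graph n C"
    and ab: "{a, b} \<in> edges G" and cd: "{c, d} \<in> edges C"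
    and H: "graph_iso (glue_along_edge G (a, b) C (c, d)) H"
  obtains g :: "'a \<Rightarrow> 'c" and w :: "nat \<Rightarrow> 'c" where "inj_on g (verts G)" "inj_on w {..<n}"
    "{w 0, w 1} \<in> (`) g ` edges G" "\<And>i. 2 \<le> i \<Longrightarrow> i < n \<Longrightarrow> w i \<notin> g ` verts G"
    "edges H = (`) g ` edges G \<union> (\<lambda>i. {w i, w (Suc i mod n)}) ` {..<n}"
proof -
  have n: "n \<ge> 3" using C unfolding cycle_graph_def by blast
  obtain v where v: "inj_on v {..<n}" "verts C = v ` {..<n}"
    "edges C = {{v i, v (Suc i mod n)} | i. i < n}" "{c, d} = {v 0, v 1}"
    using cycle_graph_from_edge[OF C cd] by blast
  have abV: "a \<in> verts G" "b \<in> verts G" "a \<noteq> b"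
    using G ab unfolding finite_simple_graph_def by fastforce+
  define t :: "'a + 'b \<Rightarrow> 'a + 'b" where "t = id(Inr c := Inl a, Inr d := Inl b)"
  define D where "D = disjoint_union G C"
  obtain h where h: "inj_on h (t ` verts D)" and Hh: "H = map_graph h (map_graph t D)"
    using H unfolding graph_iso_def glue_along_edge_def map_graph_def t_def D_def by auto
  define g where "g x = h (Inl x)" for x
  define w where "w i = h (t (Inr (v i)))" for i
  have tl: "t (Inl x) = Inl x" for x by (simp add: t_def)
  have "v 0 \<noteq> v 1" using inj_onD[OF v(1), of 0 1] n by auto
  then have cd': "c \<noteq> d" using v(4) by auto
  have tr: "t (Inr (v 0)) \<in> {Inl a, Inl b}" "t (Inr (v 1)) \<in> {Inl a, Inl b}" "t (Inr (v 0)) \<noteq> t (Inr (v 1))"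
    "{t (Inr (v 0)), t (Inr (v 1))} = {Inl a, Inl b}"
    using v(4) cd' abV(3) unfolding t_def by (auto simp: doubleton_eq_iff)
  have tr2: "t (Inr (v i)) = Inr (v i)" if "2 \<le> i" "i < n" for i
  proof -
    have "v i \<noteq> v 0" "v i \<noteq> v 1" using inj_onD[OF v(1), of i 0] inj_onD[OF v(1), of i 1] that n by auto
    then have "v i \<notin> {c, d}" unfolding v(4) by simp
    then show ?thesis by (simp add: t_def)
  qed
  have vD: "Inl x \<in> t ` verts D" if "x \<in> verts G" for x
    using that tl unfolding D_def disjoint_union_def by (auto intro!: image_eqI[of _ _ "Inl x"])
  have wD: "t (Inr (v i)) \<in> t ` verts D" if "i < n" for i
    using that v(2) unfolding D_def disjoint_union_def by auto
  have t_inj: "i = j" if ij: "i < n" "j < n" "t (Inr (v i)) = t (Inr (v j))" for i j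
  proof -
    have small: "t (Inr (v i)) \<noteq> t (Inr (v j))" if "i < 2" "2 \<le> j" "j < n" for i j
    proof -
      have "i = 0 \<or> i = 1" using that(1) by auto
      then show ?thesis using tr(1,2) tr2[OF that(2,3)] by auto
    qed
    consider "i < 2" "j < 2" | "i < 2" "2 \<le> j" | "2 \<le> i" "j < 2" | "2 \<le> i" "2 \<le> j" by linarith
    then show ?thesis
    proof cases
      case 1
      then have "(i = 0 \<or> i = 1) \<and> (j = 0 \<or> j = 1)" by auto
      then show ?thesis using ij(3) tr(3) by auto
    next
      case 2
      then show ?thesis using small ij by blast
    next
      case 3
      then show ?thesis using small[of j i] ij by simp
    next
      case 4
      then have "v i = v j" using ij tr2 by simp
      then show ?thesis using inj_onD[OF v(1), of i j] ij by simp
    qed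
  qed
  show ?thesis
  proof (rule that)
    show "inj_on g (verts G)"
    proof (rule inj_onI)
      fix x y assume xy: "x \<in> verts G" "y \<in> verts G" "g x = g y"
      then have "(Inl x :: 'a + 'b) = Inl y" using inj_onD[OF h _ vD vD] by (simp add: g_def)
      then show "x = y" by simp
    qed
    show "inj_on w {..<n}"
    proof (rule inj_onI)
      fix i j assume ij: "i \<in> {..<n}" "j \<in> {..<n}" "w i = w j"
      then have "t (Inr (v i)) = t (Inr (v j))" using inj_onD[OF h _ wD wD] by (simp add: w_def)
      then show "i = j" using t_inj ij by simp
    qed
    have "{w 0, w 1} = h ` {t (Inr (v 0)), t (Inr (v 1))}" by (simp add: w_def)
    also have "\<dots> = g ` {a, b}" unfolding tr(4) by (simp add: g_def)
    finally show "{w 0, w 1} \<in> (`) g ` edges G" using imageI[OF ab, of "(`) g"] by (simp only:)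
    show "w i \<notin> g ` verts G" if i: "2 \<le> i" "i < n" for i
    proof
      assume "w i \<in> g ` verts G"
      then obtain x where x: "x \<in> verts G" "h (t (Inr (v i))) = h (Inl x)" by (auto simp: w_def g_def)
      then have "t (Inr (v i)) = Inl x" using inj_onD[OF h x(2) wD[OF i(2)] vD[OF x(1)]] by simp
      then show False using tr2[OF i] by simp
    qed
    have "edges H = (`) h ` (`) t ` ((`) Inl ` edges G \<union> (`) Inr ` edges C)"
      by (simp add: Hh map_graph_def D_def disjoint_union_def)
    also have "\<dots> = (`) g ` edges G \<union> (\<lambda>e. (\<lambda>x. h (t (Inr x))) ` e) ` edges C"
      by (simp add: image_Un image_image tl g_def)
    also have "(\<lambda>e. (\<lambda>x. h (t (Inr x))) ` e) ` edges C = (\<lambda>i. {w i, w (Suc i mod n)}) ` {..<n}"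
    proof -
      have "edges C = (\<lambda>i. {v i, v (Suc i mod n)}) ` {..<n}" unfolding v(3) by auto
      then show ?thesis by (simp add: image_image w_def)
    qed
    finally show "edges H = (`) g ` edges G \<union> (\<lambda>i. {w i, w (Suc i mod n)}) ` {..<n}" .
  qed
qed

theorem theorem1p2:
  fixes G :: "'a ugraph" and C :: "'b ugraph" and H :: "'c ugraph"
    and a b :: 'a and c d :: 'b and n :: nat
  assumes "finite_simple_graph G"
    and "cycle_graph n C" and "even n"
    and "{a, b} \<in> edges G" and "{c, d} \<in> edges C"
    and "graph_iso (glue_along_edge G (a, b) C (c, d)) H"
    and "gvd (edges G) (toric_ideal G :: ('a set, 'k::{alg_closed_field, field_char_0}) mpoly set)"
  shows "gvd (edges H) (toric_ideal H :: ('c set, 'k) mpoly set)"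
proof -
  obtain g :: "'a \<Rightarrow> 'c" and w where g: "inj_on g (verts G)" and w: "inj_on w {..<n}"
    and e0: "{w 0, w 1} \<in> (`) g ` edges G" and new: "\<And>i. 2 \<le> i \<Longrightarrow> i < n \<Longrightarrow> w i \<notin> g ` verts G"
    and edges: "edges H = (`) g ` edges G \<union> (\<lambda>i. {w i, w (Suc i mod n)}) ` {..<n}"
    by (rule glued_graph[OF assms(1,2,4,5,6)]) (rule that)
  obtain k where n: "n = 2 * k" using assms(3) by blast
  have k: "k \<ge> 2" using assms(2) n unfolding cycle_graph_def by simp
  have eV: "e \<subseteq> verts G" if "e \<in> edges G" for e
    using that assms(1) unfolding finite_simple_graph_def by blast
  have fin: "finite (edges G)"
  proof (rule finite_subset)
    show "edges G \<subseteq> Pow (verts G)" using eV by blast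
    show "finite (Pow (verts G))" using assms(1) by (simp add: finite_simple_graph_def)
  qed
  let ?X = "(`) g ` edges G"
  have inv: "inverse_on (edges G) ((`) g) ((`) (inv_into (verts G) g))"
    unfolding inverse_on_def using inv_into_image_cancel[OF g eV] by blast
  have "gvd ?X (rename ((`) g) ` toric_kernel (edges G) :: ('c set, 'k) mpoly set)"
    using gvd_rename[OF _ fin inv] assms(7) unfolding toric_ideal_eq by blast
  then have gX: "gvd ?X (toric_kernel ?X :: ('c set, 'k) mpoly set)"
    using toric_kernel_rename[OF g eV, where 'k = 'k] by simp
  have "edges H = ?X \<union> cycle_edge w k ` {..<2 * k}"
    unfolding edges n by (simp add: cycle_edge_def[abs_def])
  moreover have "gvd (?X \<union> cycle_edge w k ` {..<2 * k}) (toric_kernel (?X \<union> cycle_edge w k ` {..<2 * k}) :: ('c set, 'k) mpoly set)"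
  proof (rule gvd_add_cycle[OF k w[unfolded n] _ _ _ e0 gX])
    show "finite ?X" using fin by simp
    have fV: "finite (g ` verts G)" using assms(1) by (simp add: finite_simple_graph_def)
    have sub: "e \<subseteq> g ` verts G" if e: "e \<in> ?X" for e
    proof -
      obtain e' where "e = g ` e'" "e' \<in> edges G" using e by blast
      then show ?thesis using eV[of e'] by blast
    qed
    show "finite e" if "e \<in> ?X" for e by (rule finite_subset[OF sub[OF that] fV])
    show "w j \<notin> e" if "e \<in> ?X" "2 \<le> j" "j < 2 * k" for e j
      using new[of j] sub[OF that(1)] that(2,3) unfolding n by blast
  qed
  ultimately show ?thesis unfolding toric_ideal_eq by simp
qed

end
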